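(* Let $n\ge 4$ and $3\le d\le n-2$. Let $\lambda_2^\#= \min \{\lambda_2(T): T\in \mathcal{T}(n,d)\}$ and let $T^\# \in \mathcal{T}(n,d)$ be such that $\lambda_2(T^\#)=\lambda_2^\#$. Then $T^\#$ has the following shape: it consists of a path $v_0v_1\ldots v_d$ together with a tree $B$ that contains $v_{\lfloor d/2\rfloor}$ and has only the vertex $v_{\lfloor d/2\rfloor}$ in common with the path, with no edges other than those of the path and of $B$ (so $B$ is attached to the path at $v_{\lfloor d/2\rfloor}$, and every other vertex of the path has degree at most $2$ in $T^\#$). Moreover, the following holds: (i) $\lambda_1(B-v_{\lfloor d/2 \rfloor})\le \lambda_2^\# \le \lambda_1(P_{\lceil d/2\rceil})$. (ii) If $d$ is even then $\lambda_2^\#= \lambda_1(P_{d/2})<2$, and $B-v_{d/2}$ is any disjoint union of Smith graphs with spectral radius at most $\lambda_2^\#$, provided the diameter and order constraints on $T^\#$ are satisfied. (That is, $B-v_{d/2}$ is a disjoint union of Smith graphs each with spectral radius at most $\lambda_2^\#$; and conversely every tree in $\mathcal{T}(n,d)$ that consists of a path $v_0v_1\ldots v_d$ together with a tree $B$ containing $v_{d/2}$ and having only the vertex $v_{d/2}$ in common with the path, with no edges other than those of the path and of $B$, and for which $B-v_{d/2}$ is such a disjoint union, attains $\lambda_2^\#$.) (iii) If $d$ is odd then $\lambda_1(P_{(d-1)/2})< \lambda_2^\# < \lambda_1(P_{(d+1)/2})$ and $T^\#$ (in particular $B$) is a subdivision of a star with central vertex $v_{(d-1)/2}$.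
   Context: All graphs are finite and simple. For a graph $G$, $\lambda_1(G)\ge\lambda_2(G)\ge\cdots$ are the eigenvalues (with multiplicity) of its adjacency matrix; $\lambda_1(G)$ is the spectral radius. $\mathcal{T}(n,d)$ is the set of trees on $n$ vertices with diameter $d$. $P_m$ denotes the path on $m$ vertices. A Smith graph is a connected graph $G$ with $\lambda_1(G)\le 2$. A subdivision of a star with central vertex $v$ is a tree in which every vertex other than $v$ has degree at most $2$. *)

theory Defs
  imports
    "Graph_Theory.Digraph_Component"
    "Graph_Theory.Shortest_Path"
    "Jordan_Normal_Form.Char_Poly"
    "HOL-Computational_Algebra.Polynomial"
begin

text \<open>
  Finite simple graphs are the \<^locale>\<open>pair_graph\<close>s of the library: finite symmetric loop-free
  digraphs whose arcs are pairs of vertices, an undirected edge being a pair of opposite arcs.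
  In particular \<^const>\<open>out_degree\<close> is the degree and \<^const>\<open>Digraph_Component.connected\<close>
  (which also requires a vertex) is connectedness.
\<close>

section \<open>Eigenvalues of the adjacency matrix\<close>

definition adj_mat :: "'a pair_pre_digraph \<Rightarrow> 'a list \<Rightarrow> real mat" where
  "adj_mat G vs = mat (length vs) (length vs)
     (\<lambda>(i, j). if (vs ! i, vs ! j) \<in> parcs G then 1 else 0)"

text \<open>The chosen enumeration of the vertices is irrelevant: see \<open>spectrum_eq\<close> below.\<close>

definition spectrum_graph :: "'a pair_pre_digraph \<Rightarrow> real multiset" where
  "spectrum_graph G = proots (char_poly (adj_mat G (SOME vs. distinct vs \<and> set vs = pverts G)))"

text \<open>\<open>eig k G\<close> is the \<open>k\<close>-th largest eigenvalue, counted from \<open>k = 1\<close>.\<close>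

definition eig :: "nat \<Rightarrow> 'a pair_pre_digraph \<Rightarrow> real" where
  "eig k G = rev (sorted_list_of_multiset (spectrum_graph G)) ! (k - 1)"

lemma char_poly_adj_mat_eq:
  assumes "distinct vs" "distinct ws" "set vs = set ws"
  shows "char_poly (adj_mat G vs) = char_poly (adj_mat G ws)"
proof -
  define n where "n = length vs"
  have n': "length ws = n"
    using assms by (metis n_def distinct_card)
  have "mset vs = mset ws"
    using assms by (simp add: set_eq_iff_mset_eq_distinct)
  then obtain p where p0: "p permutes {..<length ws}" "permute_list p ws = vs"
    by (metis mset_eq_permutation)
  have p: "p permutes {0..<n}"
    using p0 n' by (simp add: atLeast0LessThan)
  have vs: "vs ! i = ws ! p i" if "i < n" for i
    using p0 that n' permute_list_nth by metis
  have pn: "p i < n" if "i < n" for i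
    using p that by (metis atLeastLessThan_iff permutes_in_image zero_le)
  have inj: "p i = p j \<longleftrightarrow> i = j" for i j
    using permutes_inj[OF p] by (auto dest: injD)
  let ?A = "char_poly_matrix (adj_mat G ws)" and ?B = "char_poly_matrix (adj_mat G vs)"
  let ?C = "mat n n (\<lambda>(i, j). ?A $$ (p i, j))"
  have A: "?A \<in> carrier_mat n n"
    using n' by (auto simp: char_poly_matrix_def adj_mat_def)
  have C: "transpose_mat ?C \<in> carrier_mat n n" by auto
  have B: "transpose_mat ?B = mat n n (\<lambda>(i, j). transpose_mat ?C $$ (p i, j))"
    using n' n_def[symmetric] vs pn inj
    by (intro eq_matI) (auto simp: char_poly_matrix_def adj_mat_def)
  have Bc: "?B \<in> carrier_mat n n"
    using n_def by (auto simp: char_poly_matrix_def adj_mat_def)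
  have "det ?B = det (transpose_mat ?B)"
    using det_transpose[OF Bc] by simp
  also have "\<dots> = signof p * det (transpose_mat ?C)"
    unfolding B by (rule det_permute_rows[OF C p])
  also have "det (transpose_mat ?C) = det ?C"
    by (rule det_transpose) auto
  also have "\<dots> = signof p * det ?A"
    by (rule det_permute_rows[OF A p])
  finally show ?thesis
    by (simp add: char_poly_def sign_def)
qed

lemma spectrum_eq:
  assumes "distinct vs" "set vs = pverts G"
  shows "spectrum_graph G = proots (char_poly (adj_mat G vs))"
proof -
  have "distinct (SOME vs. distinct vs \<and> set vs = pverts G) \<and>
      set (SOME vs. distinct vs \<and> set vs = pverts G) = pverts G"
    by (rule someI[of _ vs]) (use assms in auto)
  then show ?thesis
    unfolding spectrum_graph_def using char_poly_adj_mat_eq assms by metis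
qed

section \<open>Trees, diameter\<close>

text \<open>
  The library's \<^const>\<open>tree\<close> is not the right notion for symmetric digraphs, as its cycles
  include the closed walks \<open>u, v, u\<close> along a single edge.
\<close>

definition is_tree :: "'a pair_pre_digraph \<Rightarrow> bool" where
  "is_tree G \<longleftrightarrow> pair_graph G \<and> Digraph_Component.connected (with_proj G) \<and>
     \<not> (\<exists>p. pre_digraph.cycle (with_proj G) p \<and> 3 \<le> length p)"

definition graph_diameter :: "'a pair_pre_digraph \<Rightarrow> ereal" where
  "graph_diameter G = (SUP u\<in>pverts G. SUP v\<in>pverts G. wf_digraph.\<mu> (with_proj G) (\<lambda>_. 1) u v)"

definition trees :: "nat \<Rightarrow> nat \<Rightarrow> 'a pair_pre_digraph set" where
  "trees n d = {T. is_tree T \<and> card (pverts T) = n \<and> graph_diameter T = ereal (real d)}"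

lemma finite_eig_trees: "finite (eig k ` trees n d)"
proof -
  define M :: "real mat set" where
    "M = (\<lambda>S. mat n n (\<lambda>x. if x \<in> S then 1 else 0)) ` Pow ({..<n} \<times> {..<n})"
  have "finite M"
    unfolding M_def by simp
  moreover have "eig k T \<in> (\<lambda>A. rev (sorted_list_of_multiset (proots (char_poly A))) ! (k - 1)) ` M"
    if "T \<in> trees n d" for T
  proof -
    have "finite (pverts T)" and n: "card (pverts T) = n"
      using that by (auto simp: trees_def is_tree_def pair_graph_def pair_digraph_def
          pair_fin_digraph_def pair_fin_digraph_axioms_def)
    then obtain vs where vs: "set vs = pverts T" "distinct vs"
      using finite_distinct_list by blast
    have len: "length vs = n" using vs n distinct_card by metis
    have "adj_mat T vs \<in> M"
      unfolding M_def
      by (rule image_eqI[where x = "{(i, j). i < n \<and> j < n \<and> (vs ! i, vs ! j) \<in> parcs T}"])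
        (auto simp: adj_mat_def len intro!: eq_matI)
    then show ?thesis
      unfolding eig_def spectrum_eq[OF vs(2,1)] by blast
  qed
  ultimately show ?thesis
    by (meson finite_imageI finite_subset image_subsetI)
qed

section \<open>Special graphs\<close>

text \<open>The path \<open>v 0, v 1, \<dots>, v (m - 1)\<close>; it is a \<open>P\<^sub>m\<close> if \<open>v\<close> is injective there.\<close>

definition path_along :: "(nat \<Rightarrow> 'a) \<Rightarrow> nat \<Rightarrow> 'a pair_pre_digraph" where
  "path_along v m = \<lparr> pverts = v ` {..<m},
     parcs = (\<Union>i\<in>{i. Suc i < m}. {(v i, v (Suc i)), (v (Suc i), v i)}) \<rparr>"

definition path_graph :: "nat \<Rightarrow> nat pair_pre_digraph" where
  "path_graph m = path_along id m"

definition remove_vert :: "'a pair_pre_digraph \<Rightarrow> 'a \<Rightarrow> 'a pair_pre_digraph" where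
  "remove_vert G v = \<lparr> pverts = pverts G - {v}, parcs = {e \<in> parcs G. fst e \<noteq> v \<and> snd e \<noteq> v} \<rparr>"

lemma with_proj_remove_vert:
  "with_proj (remove_vert G v) = pre_digraph.del_vert (with_proj G) v"
  by (simp add: remove_vert_def pre_digraph.del_vert_def with_proj_def)

definition smith_graph :: "'a pair_pre_digraph \<Rightarrow> bool" where
  "smith_graph G \<longleftrightarrow> pair_graph G \<and> Digraph_Component.connected (with_proj G) \<and> eig 1 G \<le> 2"

definition disjoint_union_of :: "('a pair_pre_digraph \<Rightarrow> bool) \<Rightarrow> 'a pair_pre_digraph \<Rightarrow> bool" where
  "disjoint_union_of Q G \<longleftrightarrow> (\<exists>\<C>. (\<forall>C\<in>\<C>. Q C) \<and>
     pairwise (\<lambda>C D. disjnt (pverts C) (pverts D)) \<C> \<and>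
     pverts G = \<Union> (pverts ` \<C>) \<and> parcs G = \<Union> (parcs ` \<C>))"

definition star_subdivision :: "'a pair_pre_digraph \<Rightarrow> 'a \<Rightarrow> bool" where
  "star_subdivision G v \<longleftrightarrow> is_tree G \<and> v \<in> pverts G \<and>
     (\<forall>u\<in>pverts G. u \<noteq> v \<longrightarrow> out_degree (with_proj G) u \<le> 2)"

text \<open>\<open>T\<close> consists of the path \<open>v 0, \<dots>, v d\<close> and a tree \<open>B\<close> meeting it exactly in \<open>v (d div 2)\<close>.\<close>

definition path_with_tree ::
  "'a pair_pre_digraph \<Rightarrow> nat \<Rightarrow> (nat \<Rightarrow> 'a) \<Rightarrow> 'a pair_pre_digraph \<Rightarrow> bool" where
  "path_with_tree T d v B \<longleftrightarrow> inj_on v {..d} \<and> is_tree B \<and>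
     pverts (path_along v (Suc d)) \<inter> pverts B = {v (d div 2)} \<and>
     pverts T = pverts (path_along v (Suc d)) \<union> pverts B \<and>
     parcs T = parcs (path_along v (Suc d)) \<union> parcs B"

end

theory Submission
  imports Defs "HOL-Analysis.Function_Topology"
begin

text \<open>Root the tree at the central vertex \<open>r = v\<^bsub>\<lfloor>d/2\<rfloor>\<^esub>\<close> of a diametral path. Eliminating from the leaves to
  the root turns \<open>c |x|\<^sup>2 - x\<^sup>T A x\<close> into a sum of squares whose coefficients \<open>1 / g v\<close> satisfy
  \<open>1 / g v = c - (\<Sum>w. g w)\<close>, the sum being over the children \<open>w\<close> of \<open>v\<close>; if exactly one coefficient is
  negative and the recursion has slack somewhere, then \<open>\<lambda>\<^sub>2 < c\<close>.

  If \<open>d = 2k\<close>, hanging all vertices off the path at \<open>r\<close> as leaves shows \<open>\<lambda>\<^sub>2\<^sup># \<le> \<lambda>\<^sub>1(P\<^sub>k)\<close>. Since one half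
  of the path attains this value, a branch at \<open>r\<close> exceeding it would allow a perturbation of two test
  vectors that pushes \<open>\<lambda>\<^sub>2\<close> above it, so no branch does, and the halves of the path carry nothing else.

  If \<open>d = 2k + 1\<close>, the same comparison tree gives \<open>\<mu> = \<lambda>\<^sub>2\<^sup># < \<lambda>\<^sub>1(P\<^sub>k\<^sub>+\<^sub>1)\<close>. The two halves of the path then
  force every branch off the middle edge \<open>r s\<close> strictly below \<open>\<mu>\<close>, and an eigenvector \<open>z\<close> for \<open>\<mu>\<close>
  changes sign exactly across \<open>r s\<close>; its ratios \<open>g v = z v / z (p v)\<close> form a certificate without slack.
  Merging two chains below a branching vertex, or moving branches from \<open>s\<close> to \<open>r\<close>, would create slack
  without changing the order or the diameter, contradicting minimality. Hence only one of \<open>r\<close>, \<open>s\<close> has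
  degree greater than 2, and reversing the path makes it \<open>r\<close>.\<close>

section \<open>The spectral theorem for quadratic forms of graphs\<close>

text \<open>Minimality says something only about competitors of the same order and diameter, and the
  diameter is what a surgery threatens. The certificate itself removes this obstacle: positive
  coefficients along a descending chain dominate those of a bare path, so when \<mu> is below the
  spectral radius of the path on k + 1 vertices, no long chain avoids both \<open>r\<close> and
  \<open>s\<close>. A competitor that carries a certificate has bounded depth on both sides of the
  middle edge, and two surviving path ends make the bounds sharp.

  No spectrum of a competitor is ever computed: a surgery changes the inequalities at few vertices
  only, and since eigenvector ratios give equality everywhere, a single strict inequality is a
  contradiction.

  For even d several trees may attain the minimum, so an argument that produces strict improvement
  cannot describe them; there the shape comes from the strict positivity of maximisers on a
  connected branch.\<close>

definition supp_in :: "'a set \<Rightarrow> ('a \<Rightarrow> real) \<Rightarrow> bool" where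
  "supp_in D x \<longleftrightarrow> (\<forall>v. v \<notin> D \<longrightarrow> x v = 0)"

definition sqn :: "'a set \<Rightarrow> ('a \<Rightarrow> real) \<Rightarrow> real" where
  "sqn V x = (\<Sum>v\<in>V. (x v)\<^sup>2)"

text \<open>An undirected edge enters with both of its arcs, so for symmetric \<open>E\<close> this
  is the bilinear form of the adjacency matrix, and \<open>qform\<close> counts every edge
  twice.\<close>

definition bform :: "'a rel \<Rightarrow> ('a \<Rightarrow> real) \<Rightarrow> ('a \<Rightarrow> real) \<Rightarrow> real" where
  "bform E x y = (\<Sum>(u, v)\<in>E. x u * y v)"

abbreviation qform :: "'a rel \<Rightarrow> ('a \<Rightarrow> real) \<Rightarrow> real" where
  "qform E x \<equiv> bform E x x"

definition adj_app :: "'a rel \<Rightarrow> ('a \<Rightarrow> real) \<Rightarrow> 'a \<Rightarrow> real" where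
  "adj_app E x v = (\<Sum>w\<in>E `` {v}. x w)"

lemma bform_adj_app:
  assumes "finite V" "E \<subseteq> V \<times> V"
  shows "bform E x y = (\<Sum>v\<in>V. x v * adj_app E y v)"
proof -
  have E: "E = (SIGMA v:V. E `` {v})" using assms by auto
  have "bform E x y = (\<Sum>(u, v)\<in>(SIGMA v:V. E `` {v}). x u * y v)"
    unfolding bform_def using E by simp
  also have "\<dots> = (\<Sum>v\<in>V. \<Sum>w\<in>E `` {v}. x v * y w)"
    using assms by (intro sum.Sigma[symmetric]) (auto intro: finite_subset)
  finally show ?thesis by (simp add: adj_app_def sum_distrib_left)
qed

lemma bform_sym:
  assumes "sym E"
  shows "bform E x y = bform E y x"
  unfolding bform_def
  by (rule sum.reindex_bij_witness[of _ prod.swap prod.swap])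
    (use assms in \<open>auto simp: sym_def mult.commute\<close>)

lemma bform_add_left: "bform E (\<lambda>v. a * x v + b * y v) z = a * bform E x z + b * bform E y z"
  by (auto simp: bform_def sum_distrib_left sum.distrib[symmetric] algebra_simps intro!: sum.cong)

lemma bform_add_right: "bform E z (\<lambda>v. a * x v + b * y v) = a * bform E z x + b * bform E z y"
  by (auto simp: bform_def sum_distrib_left sum.distrib[symmetric] algebra_simps intro!: sum.cong)

lemma qform_comb:
  assumes "sym E"
  shows "qform E (\<lambda>v. a * x v + b * y v) = a\<^sup>2 * qform E x + 2 * a * b * bform E x y + b\<^sup>2 * qform E y"
  by (simp add: bform_add_left bform_add_right bform_sym[OF assms, of y x] power2_eq_square algebra_simps)

lemma sqn_comb:
  "sqn V (\<lambda>v. a * x v + b * y v) = a\<^sup>2 * sqn V x + 2 * a * b * (\<Sum>v\<in>V. x v * y v) + b\<^sup>2 * sqn V y"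
  by (auto simp: sqn_def sum_distrib_left sum.distrib[symmetric] power2_eq_square algebra_simps intro!: sum.cong)

lemma sqn_nonneg [simp]: "0 \<le> sqn V x"
  by (simp add: sqn_def sum_nonneg)

lemma sqn_zero_iff:
  assumes "finite V" "supp_in V x"
  shows "sqn V x = 0 \<longleftrightarrow> x = (\<lambda>_. 0)"
  using assms by (auto simp: sqn_def sum_nonneg_eq_0_iff supp_in_def)

lemma supp_in_comb: "supp_in D x \<Longrightarrow> supp_in D y \<Longrightarrow> supp_in D (\<lambda>v. a * x v + b * y v)"
  by (simp add: supp_in_def)

lemma supp_in_mono: "supp_in D x \<Longrightarrow> D \<subseteq> D' \<Longrightarrow> supp_in D' x"
  by (auto simp: supp_in_def)

lemma quadratic_nonneg_linear_zero:
  fixes a b :: real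
  assumes "\<And>t. 0 \<le> 2 * t * b + t\<^sup>2 * a"
  shows "b = 0"
proof (rule ccontr)
  assume b: "b \<noteq> 0"
  \<comment> \<open>Adding 1 keeps the denominator positive when \<open>a = 0\<close>.\<close>
  define s where "s = \<bar>a\<bar> + 1"
  have s: "s > 0" "a \<le> s" by (auto simp: s_def)
  define t where "t = - b / s"
  have "2 * t * b + t\<^sup>2 * a \<le> 2 * t * b + t\<^sup>2 * s"
    using s by (intro add_left_mono mult_left_mono) auto
  also have "\<dots> = - b\<^sup>2 / s"
    using s by (simp add: t_def power2_eq_square)
  also have "\<dots> < 0"
    using b s by (simp add: divide_neg_pos)
  finally show False using assms[of t] by simp
qed

text \<open>First variation: \<open>d * sqn - qform\<close> is nonnegative on the line through
  \<open>x\<close> in direction \<open>y\<close> and vanishes at \<open>x\<close>, so its linear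
  term vanishes. Only one direction is involved, which allows \<open>x\<close> to be a maximiser
  merely within a subspace containing \<open>y\<close>.\<close>

lemma rayleigh_critical:
  assumes "sym E" "qform E x = d * sqn V x"
    and "\<And>t. qform E (\<lambda>v. x v + t * y v) \<le> d * sqn V (\<lambda>v. x v + t * y v)"
  shows "bform E y x = d * (\<Sum>v\<in>V. y v * x v)"
proof -
  have "d * (\<Sum>v\<in>V. x v * y v) - bform E x y = 0"
  proof (rule quadratic_nonneg_linear_zero)
    fix t
    show "0 \<le> 2 * t * (d * (\<Sum>v\<in>V. x v * y v) - bform E x y) + t\<^sup>2 * (d * sqn V y - qform E y)"
      using assms(3)[of t] qform_comb[OF assms(1), of 1 x t y] sqn_comb[of V 1 x t y] assms(2)
      by (simp add: algebra_simps)
  qed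
  then show ?thesis by (simp add: bform_sym[OF assms(1), of y x] mult.commute)
qed

lemma homogeneous_solution:
  fixes g :: "nat \<Rightarrow> 'a \<Rightarrow> real"
  assumes "finite V" "k < card V"
  shows "\<exists>x. supp_in V x \<and> x \<noteq> (\<lambda>_. 0) \<and> (\<forall>j<k. (\<Sum>v\<in>V. x v * g j v) = 0)"
  using assms
proof (induction k arbitrary: V g)
  case 0
  then obtain v where "v \<in> V" by fastforce
  then show ?case
    by (intro exI[of _ "\<lambda>w. if w = v then 1 else 0"]) (auto simp: supp_in_def fun_eq_iff)
next
  case (Suc k)
  show ?case
  proof (cases "\<forall>v\<in>V. g k v = 0")
    case True
    with Suc.IH[of V g] Suc.prems show ?thesis
      by (auto simp: less_Suc_eq)
  next
    case False
    then obtain v0 where v0: "v0 \<in> V" "g k v0 \<noteq> 0" by auto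
    \<comment> \<open>Gaussian elimination with pivot \<open>v0\<close>: a multiple of equation
      \<open>k\<close> is subtracted from the others so that \<open>v0\<close> no longer occurs in
      them; the value of \<open>y\<close> at \<open>v0\<close> is then found by back
      substitution.\<close>
    define g' where "g' j v = g j v - g j v0 / g k v0 * g k v" for j v
    have "k < card (V - {v0})" "finite (V - {v0})" using Suc.prems v0 by auto
    from Suc.IH[OF this(2,1), of g'] obtain x where x: "supp_in (V - {v0}) x" "x \<noteq> (\<lambda>_. 0)"
      "\<And>j. j < k \<Longrightarrow> (\<Sum>v\<in>V - {v0}. x v * g' j v) = 0" by blast
    define s where "s = (\<Sum>v\<in>V - {v0}. x v * g k v)"
    define y where "y = x(v0 := - s / g k v0)"
    have split: "(\<Sum>v\<in>V. y v * g j v) = - s / g k v0 * g j v0 + (\<Sum>v\<in>V - {v0}. x v * g j v)" for j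
      using v0 Suc.prems by (subst sum.remove[of _ v0]) (auto simp: y_def intro!: sum.cong)
    have "(\<Sum>v\<in>V. y v * g j v) = 0" if "j < Suc k" for j
    proof (cases "j = k")
      case True
      then show ?thesis using v0 by (simp add: split s_def)
    next
      case False
      with that have "j < k" by simp
      have "(\<Sum>v\<in>V - {v0}. x v * g' j v) = (\<Sum>v\<in>V - {v0}. x v * g j v) - g j v0 / g k v0 * s"
        by (simp add: g'_def s_def sum_distrib_left algebra_simps flip: sum_subtractf)
      with x(3)[OF \<open>j < k\<close>] show ?thesis by (simp add: split)
    qed
    moreover have "supp_in V y" using x(1) v0 by (auto simp: supp_in_def y_def)
    moreover have "y \<noteq> (\<lambda>_. 0)"
    proof
      assume y: "y = (\<lambda>_. 0)"
      have "x v = 0" for v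
        using x(1) fun_cong[OF y, of v] by (cases "v = v0") (auto simp: supp_in_def y_def)
      with x(2) show False by auto
    qed
    ultimately show ?thesis by blast
  qed
qed

text \<open>The vectors are functions on a possibly infinite type. They lie in a product of
  intervals, collapsed to \<open>{0}\<close> outside \<open>V\<close>, which is compact by
  Tychonoff; the conditions cut out a closed set.\<close>

lemma compact_unit_vectors:
  assumes "finite V"
  shows "compact {x. supp_in V x \<and> sqn V x = 1 \<and> (\<forall>j<k. (\<Sum>v\<in>V. x v * g j v) = 0)}"
    (is "compact ?S")
proof -
  define K where "K = (\<lambda>v. if v \<in> V then {-1..1::real} else {0})"
  have co: "continuous_on UNIV (\<lambda>x::'a \<Rightarrow> real. x v)" for v
    by (rule continuous_on_product_coordinates)
  have "compactin (product_topology (\<lambda>_. euclidean) UNIV) (PiE UNIV K)"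
    by (subst compactin_PiE) (auto simp: K_def)
  then have "compact (PiE UNIV K)"
    by (simp add: euclidean_product_topology flip: compactin_euclidean_iff)
  moreover have "closed ?S"
  proof -
    have "?S = (\<Inter>v\<in>-V. {x. x v = 0}) \<inter> {x. sqn V x = 1} \<inter> (\<Inter>j\<in>{..<k}. {x. (\<Sum>v\<in>V. x v * g j v) = 0})"
      by (auto simp: supp_in_def)
    then show ?thesis
      by (simp only: sqn_def) (intro closed_Int closed_INT ballI closed_Collect_eq continuous_intros co)
  qed
  moreover have "?S \<subseteq> PiE UNIV K"
  proof
    fix x assume x: "x \<in> ?S"
    have "x v \<in> K v" for v
    proof (cases "v \<in> V")
      case True
      have "(x v)\<^sup>2 \<le> sqn V x"
        unfolding sqn_def using True assms by (intro member_le_sum) auto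
      then have "\<bar>x v\<bar> \<le> 1" using x by (simp add: abs_square_le_1)
      then show ?thesis using True by (simp add: K_def abs_le_iff)
    next
      case False
      then show ?thesis using x by (simp add: K_def supp_in_def)
    qed
    then show "x \<in> PiE UNIV K" by auto
  qed
  ultimately have "compact (PiE UNIV K \<inter> ?S)" "PiE UNIV K \<inter> ?S = ?S"
    by (blast intro: compact_Int_closed)+
  then show ?thesis by simp
qed

text \<open>One step of building an eigenbasis by successive maximisation. The constraints come from
  earlier eigenvectors, so the orthogonal complement is invariant under the adjacency operator and
  the constrained maximiser is a genuine eigenvector.\<close>

lemma rayleigh_maximum:
  assumes V: "finite V" and E: "E \<subseteq> V \<times> V" "sym E"
    and k: "k < card V"
    and ev: "\<And>j. j < k \<Longrightarrow> supp_in V (g j)"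
      "\<And>j v. j < k \<Longrightarrow> v \<in> V \<Longrightarrow> adj_app E (g j) v = c j * g j v"
  shows "\<exists>x d. supp_in V x \<and> sqn V x = 1 \<and> (\<forall>j<k. (\<Sum>v\<in>V. x v * g j v) = 0) \<and>
    (\<forall>v\<in>V. adj_app E x v = d * x v) \<and>
    (\<forall>y. supp_in V y \<longrightarrow> (\<forall>j<k. (\<Sum>v\<in>V. y v * g j v) = 0) \<longrightarrow> qform E y \<le> d * sqn V y)"
proof -
  define W where "W = {x. supp_in V x \<and> (\<forall>j<k. (\<Sum>v\<in>V. x v * g j v) = 0)}"
  let ?S = "{x. supp_in V x \<and> sqn V x = 1 \<and> (\<forall>j<k. (\<Sum>v\<in>V. x v * g j v) = 0)}"
  have finE: "finite E" using V E by (auto intro: finite_subset)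
  have comb: "(\<lambda>v. a * x v + b * y v) \<in> W" if "x \<in> W" "y \<in> W" for a b x y
  proof -
    have "(\<Sum>v\<in>V. (a * x v + b * y v) * g j v) = a * (\<Sum>v\<in>V. x v * g j v) + b * (\<Sum>v\<in>V. y v * g j v)" for j
      by (simp add: sum.distrib sum_distrib_left algebra_simps)
    then show ?thesis using that by (simp add: W_def supp_in_comb)
  qed
  have normalise: "\<exists>s>0. (\<lambda>v. s * x v) \<in> ?S \<and> s\<^sup>2 * sqn V x = 1" if "x \<in> W" "x \<noteq> (\<lambda>_. 0)" for x
  proof -
    have pos: "sqn V x > 0"
      using that sqn_zero_iff[OF V, of x] sqn_nonneg[of V x] by (auto simp: W_def less_le)
    define s where "s = 1 / sqrt (sqn V x)"
    have s: "s > 0" "s\<^sup>2 * sqn V x = 1"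
      using pos by (auto simp: s_def power_divide)
    moreover have "(\<lambda>v. s * x v) \<in> W" using comb[OF that(1) that(1), of s 0] by simp
    moreover have "sqn V (\<lambda>v. s * x v) = 1"
      using s by (simp add: sqn_def power_mult_distrib flip: sum_distrib_left)
    ultimately show ?thesis by (auto simp: W_def)
  qed
  obtain x0 where "x0 \<in> W" "x0 \<noteq> (\<lambda>_. 0)"
    using homogeneous_solution[OF V k, of g] by (auto simp: W_def)
  then have "?S \<noteq> {}" using normalise by blast
  moreover have "continuous_on ?S (\<lambda>x. qform E x)"
    unfolding bform_def case_prod_unfold
    by (intro continuous_on_sum continuous_on_mult continuous_on_subset[OF continuous_on_product_coordinates]) auto
  ultimately have "\<exists>x\<in>?S. \<forall>y\<in>?S. qform E y \<le> qform E x"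
    by (rule continuous_attains_sup[OF compact_unit_vectors[OF V]])
  then obtain x where x: "x \<in> ?S" and xmax: "\<forall>y\<in>?S. qform E y \<le> qform E x"
    by (elim bexE)
  define d where "d = qform E x"
  have max: "qform E y \<le> d * sqn V y" if y: "y \<in> W" for y
  proof (cases "y = (\<lambda>_. 0)")
    case True
    then show ?thesis by (simp add: bform_def sqn_def)
  next
    case False
    then obtain s where s: "s > 0" "(\<lambda>v. s * y v) \<in> ?S" "s\<^sup>2 * sqn V y = 1"
      using normalise y by blast
    have "qform E (\<lambda>v. s * y v) = s\<^sup>2 * qform E y"
      using qform_comb[OF E(2), of s y 0 y] by simp
    then have "s\<^sup>2 * qform E y \<le> d * (s\<^sup>2 * sqn V y)"
      using bspec[OF xmax s(2)] s(3) by (simp add: d_def)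
    then show ?thesis using s(1) by (simp add: mult.left_commute)
  qed
  have xW: "x \<in> W" and x1: "sqn V x = 1" using x by (auto simp: W_def)
  \<comment> \<open>The residual of the eigenvalue equation. It satisfies the constraints, hence is
    itself an admissible direction, and criticality in this direction makes its norm zero.\<close>
  define z where "z v = (if v \<in> V then adj_app E x v - d * x v else 0)" for v
  have crit: "bform E y x = d * (\<Sum>v\<in>V. y v * x v)" if "y \<in> W" for y
  proof (rule rayleigh_critical[OF E(2)])
    show "qform E x = d * sqn V x" by (simp add: d_def x1)
    show "qform E (\<lambda>v. x v + t * y v) \<le> d * sqn V (\<lambda>v. x v + t * y v)" for t
      using max[OF comb[OF xW that, of 1 t]] by simp
  qed
  have "z \<in> W"
  proof -
    have "(\<Sum>v\<in>V. z v * g j v) = 0" if j: "j < k" for j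
    proof -
      have "(\<Sum>v\<in>V. z v * g j v) = (\<Sum>v\<in>V. g j v * adj_app E x v) - d * (\<Sum>v\<in>V. x v * g j v)"
        by (simp add: z_def sum_distrib_left algebra_simps flip: sum_subtractf)
      also have "(\<Sum>v\<in>V. g j v * adj_app E x v) = bform E x (g j)"
        using bform_adj_app[OF V E(1)] bform_sym[OF E(2)] by metis
      also have "\<dots> = c j * (\<Sum>v\<in>V. x v * g j v)"
        by (simp add: bform_adj_app[OF V E(1)] ev(2)[OF j] sum_distrib_left mult.left_commute)
      finally show ?thesis using xW j by (simp add: W_def)
    qed
    then show ?thesis by (simp add: W_def supp_in_def z_def)
  qed
  from crit[OF this] have "(\<Sum>v\<in>V. z v * (adj_app E x v - d * x v)) = 0"
    by (simp add: bform_adj_app[OF V E(1)] right_diff_distrib sum_subtractf sum_distrib_left mult.left_commute)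
  then have "sqn V z = 0"
    by (simp add: sqn_def power2_eq_square z_def)
  then have "z = (\<lambda>_. 0)" using sqn_zero_iff[OF V] \<open>z \<in> W\<close> by (auto simp: W_def)
  then have "\<forall>v\<in>V. adj_app E x v = d * x v" by (simp add: z_def fun_eq_iff) (metis eq_iff_diff_eq_0)
  with xW x1 max show ?thesis unfolding W_def by blast
qed

text \<open>The maximality of each eigenvalue on the complement of the preceding eigenvectors is
  recorded together with the eigenvectors, because the min-max bounds for the second eigenvalue rest
  on it.\<close>

lemma spectral_theorem:
  assumes V: "finite V" and E: "E \<subseteq> V \<times> V" "sym E"
  shows "\<exists>f d. (\<forall>i<card V. supp_in V (f i) \<and> sqn V (f i) = 1 \<and>
      (\<forall>j<i. (\<Sum>v\<in>V. f i v * f j v) = 0) \<and> (\<forall>v\<in>V. adj_app E (f i) v = d i * f i v) \<and>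
      (\<forall>y. supp_in V y \<longrightarrow> (\<forall>j<i. (\<Sum>v\<in>V. y v * f j v) = 0) \<longrightarrow> qform E y \<le> d i * sqn V y))"
proof -
  define P where "P f d i \<longleftrightarrow> supp_in V (f i) \<and> sqn V (f i) = 1 \<and>
      (\<forall>j<i. (\<Sum>v\<in>V. f i v * f j v) = 0) \<and> (\<forall>v\<in>V. adj_app E (f i) v = d i * f i v) \<and>
      (\<forall>y. supp_in V y \<longrightarrow> (\<forall>j<i. (\<Sum>v\<in>V. y v * f j v) = 0) \<longrightarrow> qform E y \<le> d i * sqn V y)"
    for f d and i :: nat
  have "\<exists>f d. \<forall>i<k. P f d i" if "k \<le> card V" for k
    using that
  proof (induction k)
    case (Suc k)
    then obtain f d where fd: "\<And>i. i < k \<Longrightarrow> P f d i" by auto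
    have k: "k < card V" using Suc.prems by simp
    have s: "supp_in V (f j)" if "j < k" for j
      using fd[OF that] unfolding P_def by blast
    have a: "adj_app E (f j) v = d j * f j v" if "j < k" "v \<in> V" for j v
      using fd[OF that(1)] that(2) unfolding P_def by blast
    obtain x e where xe:
      "supp_in V x" "sqn V x = 1" "\<forall>j<k. (\<Sum>v\<in>V. x v * f j v) = 0"
      "\<forall>v\<in>V. adj_app E x v = e * x v"
      "\<forall>y. supp_in V y \<longrightarrow> (\<forall>j<k. (\<Sum>v\<in>V. y v * f j v) = 0) \<longrightarrow> qform E y \<le> e * sqn V y"
      using rayleigh_maximum[where g = f and c = d, OF V E k s a] by blast
    have "P (f(k := x)) (d(k := e)) i" if "i < Suc k" for i
    proof (cases "i = k")
      case True
      then show ?thesis using xe by (simp add: P_def)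
    next
      case False
      with that fd[of i] show ?thesis by (simp add: P_def)
    qed
    then show ?case by blast
  qed auto
  from this[of "card V"] show ?thesis unfolding P_def by blast
qed

section \<open>Variational bounds for the two largest eigenvalues\<close>

lemma pair_graph_iff:
  "pair_graph G \<longleftrightarrow> finite (pverts G) \<and> parcs G \<subseteq> pverts G \<times> pverts G \<and> sym (parcs G) \<and> irrefl (parcs G)"
proof
  assume "pair_graph G"
  then interpret pair_graph G .
  have "parcs G \<subseteq> pverts G \<times> pverts G" using in_arcsD1 in_arcsD2 by auto
  moreover have "sym (parcs G)" using arcs_symmetric by (auto simp: sym_def)
  moreover have "irrefl (parcs G)" using no_loops' by (auto simp: irrefl_def)
  ultimately show "finite (pverts G) \<and> parcs G \<subseteq> pverts G \<times> pverts G \<and> sym (parcs G) \<and> irrefl (parcs G)"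
    by auto
next
  assume a: "finite (pverts G) \<and> parcs G \<subseteq> pverts G \<times> pverts G \<and> sym (parcs G) \<and> irrefl (parcs G)"
  then have "finite (parcs G)" by (auto intro: finite_subset)
  with a show "pair_graph G"
    by unfold_locales (auto simp: symmetric_def irrefl_def)
qed

lemma qform_eigenvector:
  assumes "finite V" "E \<subseteq> V \<times> V" "\<And>v. v \<in> V \<Longrightarrow> adj_app E x v = c * x v"
  shows "qform E x = c * sqn V x"
  using assms(3)
  by (simp add: bform_adj_app[OF assms(1,2)] sqn_def sum_distrib_left power2_eq_square mult.left_commute)

section \<open>From an eigenbasis to the ordered spectrum\<close>

lemma proots_prod_linear: "proots (\<Prod>a\<leftarrow>xs. [:- a, 1:]) = mset (xs :: real list)"
proof (induction xs)
  case (Cons a xs)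
  have "(\<Prod>a\<leftarrow>xs. [:- a, 1:]) \<noteq> 0"
    by (induction xs) (simp_all del: mult_pCons_left)
  then have "proots ([:- a, 1:] * (\<Prod>a\<leftarrow>xs. [:- a, 1:])) = {#a#} + mset xs"
    using Cons by (subst proots_mult) auto
  then show ?case by (simp del: mult_pCons_left)
qed simp

text \<open>The bridge to \<open>eig\<close>, which is defined through roots of the characteristic
  polynomial: orthonormal eigenvectors as columns make the adjacency matrix similar to a diagonal
  one, and since \<open>d\<close> is decreasing, the reversed sorted list of roots is
  \<open>d\<close> itself.\<close>

lemma eig_spectrum:
  assumes G: "pair_graph G" and n: "n = card (pverts G)"
    and orth: "\<And>i j. i < n \<Longrightarrow> j < n \<Longrightarrow> (\<Sum>v\<in>pverts G. f i v * f j v) = (if i = j then 1 else 0)"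
    and ev: "\<And>i v. i < n \<Longrightarrow> v \<in> pverts G \<Longrightarrow> adj_app (parcs G) (f i) v = d i * f i v"
    and anti: "\<And>i j. i \<le> j \<Longrightarrow> j < n \<Longrightarrow> d j \<le> d i"
    and i: "i < n"
  shows "eig (Suc i) G = d i"
proof -
  have fin: "finite (pverts G)" and sub: "parcs G \<subseteq> pverts G \<times> pverts G" using G by (auto simp: pair_graph_iff)
  obtain vs where vs: "distinct vs" "set vs = pverts G" using finite_distinct_list[OF fin] by blast
  then have len: "length vs = n" using n distinct_card by metis
  have sum_vs: "(\<Sum>l\<in>{0..<n}. g (vs ! l)) = (\<Sum>v\<in>pverts G. g v)" for g :: "'a \<Rightarrow> real"
    using sum.reindex_bij_betw[OF bij_betw_nth[OF vs(1) refl refl], of g] vs(2) len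
    by (simp add: atLeast0LessThan)
  define A where "A = adj_mat G vs"
  define U where "U = Matrix.mat n n (\<lambda>(i, j). f j (vs ! i))"
  define W where "W = Matrix.mat n n (\<lambda>(i, j). f i (vs ! j))"
  define D where "D = Matrix.mat n n (\<lambda>(i, j). if i = j then d i else 0)"
  have A: "A \<in> carrier_mat n n" and U: "U \<in> carrier_mat n n" and W: "W \<in> carrier_mat n n"
    and D: "D \<in> carrier_mat n n"
    by (auto simp: A_def adj_mat_def len U_def W_def D_def)
  have WU: "W * U = 1\<^sub>m n"
  proof (rule eq_matI)
    fix i j assume ij: "i < dim_row (1\<^sub>m n)" "j < dim_col (1\<^sub>m n)"
    have "(W * U) $$ (i, j) = (\<Sum>l\<in>{0..<n}. f i (vs ! l) * f j (vs ! l))"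
      using ij W U by (auto simp: scalar_prod_def W_def U_def)
    also have "\<dots> = (if i = j then 1 else 0)"
      using sum_vs[of "\<lambda>v. f i v * f j v"] orth ij by simp
    finally show "(W * U) $$ (i, j) = 1\<^sub>m n $$ (i, j)" using ij by simp
  qed (use W U in auto)
  then have UW: "U * W = 1\<^sub>m n" using mat_mult_left_right_inverse[OF W U] by simp
  have "A * U = U * D"
  proof (rule eq_matI)
    fix i j assume ij: "i < dim_row (U * D)" "j < dim_col (U * D)"
    then have ij: "i < n" "j < n" using U D by auto
    then have vi: "vs ! i \<in> pverts G" using vs len nth_mem by blast
    have "(A * U) $$ (i, j) = (\<Sum>l\<in>{0..<n}. (if (vs ! i, vs ! l) \<in> parcs G then 1 else 0) * f j (vs ! l))"
      using ij A U by (auto simp: scalar_prod_def A_def adj_mat_def len U_def)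
    also have "\<dots> = (\<Sum>v\<in>pverts G. (if (vs ! i, v) \<in> parcs G then 1 else 0) * f j v)"
      by (rule sum_vs)
    also have "\<dots> = (\<Sum>v\<in>parcs G `` {vs ! i}. f j v)"
      using fin sub by (intro sum.mono_neutral_cong_right) auto
    also have "\<dots> = d j * f j (vs ! i)" using ev[OF ij(2) vi] by (simp add: adj_app_def)
    also have "\<dots> = (\<Sum>l\<in>{0..<n}. f l (vs ! i) * (if l = j then d l else 0))"
      using ij by (simp add: if_distrib[of "\<lambda>x. _ * x"] cong: if_cong)
    also have "\<dots> = (U * D) $$ (i, j)"
      using ij U D by (auto simp: scalar_prod_def U_def D_def intro!: sum.cong)
    finally show "(A * U) $$ (i, j) = (U * D) $$ (i, j)" .
  qed (use A U D in auto)
  then have "A = U * D * W"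
    using A U W UW by (metis assoc_mult_mat right_mult_one_mat)
  then have "similar_mat A D"
    using A U W D WU UW by (intro similar_matI) auto
  then have "char_poly A = char_poly D" by (rule char_poly_similar)
  also have "\<dots> = (\<Prod>a\<leftarrow>diag_mat D. [:- a, 1:])"
    by (rule char_poly_upper_triangular[OF D]) (auto simp: D_def)
  also have "diag_mat D = map d [0..<n]" by (auto simp: diag_mat_def D_def)
  finally have "proots (char_poly A) = mset (map d [0..<n])"
    using proots_prod_linear by metis
  then have "sorted_list_of_multiset (spectrum_graph G) = sort (map d [0..<n])"
    using spectrum_eq[OF vs] unfolding A_def by (metis sorted_list_of_multiset_mset)
  also have "\<dots> = rev (map d [0..<n])"
  proof -
    have "sorted (rev (map d [0..<n]))"
      using anti by (auto simp: sorted_iff_nth_mono rev_nth)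
    then show ?thesis by (intro properties_for_sort) auto
  qed
  finally show ?thesis using i by (simp add: eig_def)
qed

lemma eig_eigenbasis:
  assumes G: "pair_graph G"
  shows "\<exists>f. \<forall>i<card (pverts G). supp_in (pverts G) (f i) \<and> sqn (pverts G) (f i) = 1 \<and>
      (\<forall>j<i. (\<Sum>v\<in>pverts G. f i v * f j v) = 0) \<and>
      (\<forall>v\<in>pverts G. adj_app (parcs G) (f i) v = eig (Suc i) G * f i v) \<and>
      (\<forall>y. supp_in (pverts G) y \<longrightarrow> (\<forall>j<i. (\<Sum>v\<in>pverts G. y v * f j v) = 0) \<longrightarrow>
        qform (parcs G) y \<le> eig (Suc i) G * sqn (pverts G) y)"
proof -
  define V E n where "V = pverts G" and "E = parcs G" and "n = card (pverts G)"
  have VE: "finite V" "E \<subseteq> V \<times> V" "sym E" using G by (auto simp: pair_graph_iff V_def E_def)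
  obtain f d where fd: "\<forall>i<n. supp_in V (f i) \<and> sqn V (f i) = 1 \<and>
      (\<forall>j<i. (\<Sum>v\<in>V. f i v * f j v) = 0) \<and> (\<forall>v\<in>V. adj_app E (f i) v = d i * f i v) \<and>
      (\<forall>y. supp_in V y \<longrightarrow> (\<forall>j<i. (\<Sum>v\<in>V. y v * f j v) = 0) \<longrightarrow> qform E y \<le> d i * sqn V y)"
    using spectral_theorem[OF VE] unfolding n_def V_def by blast
  have orth: "(\<Sum>v\<in>V. f i v * f j v) = (if i = j then 1 else 0)" if "i < n" "j < n" for i j
  proof (cases i j rule: linorder_cases)
    case less
    then have "(\<Sum>v\<in>V. f j v * f i v) = 0" using fd that by simp
    then show ?thesis using less by (simp add: mult.commute)
  next
    case equal
    then show ?thesis using fd that by (simp add: sqn_def power2_eq_square)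
  next
    case greater
    then show ?thesis using fd that by simp
  qed
  have q: "qform E (f j) = d j" if "j < n" for j
  proof -
    have "qform E (f j) = d j * sqn V (f j)"
      using fd that by (intro qform_eigenvector[OF VE(1,2)]) blast
    then show ?thesis using fd that by simp
  qed
  \<comment> \<open>A later eigenvector is orthogonal to all those before index \<open>i\<close>, so
    it competes in the maximisation that produced \<open>d i\<close>.\<close>
  have anti: "d j \<le> d i" if "i \<le> j" "j < n" for i j
  proof -
    have "\<forall>l<i. (\<Sum>v\<in>V. f j v * f l v) = 0" using fd that by simp
    moreover have "supp_in V (f j)" "sqn V (f j) = 1" using fd that by auto
    ultimately have "qform E (f j) \<le> d i * 1" using fd that by (metis le_less_trans)
    then show ?thesis using q that by simp
  qed
  have "eig (Suc i) G = d i" if "i < n" for i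
    using eig_spectrum[OF G n_def, of f d i] orth fd anti that unfolding V_def E_def by blast
  then show ?thesis using fd unfolding V_def E_def n_def by (intro exI[of _ f]) auto
qed

lemma eig1_eigenvector:
  assumes "pair_graph G" "pverts G \<noteq> {}"
  shows "\<exists>x. supp_in (pverts G) x \<and> sqn (pverts G) x = 1 \<and>
    (\<forall>v\<in>pverts G. adj_app (parcs G) x v = eig 1 G * x v)"
proof -
  have "0 < card (pverts G)" using assms by (simp add: pair_graph_iff card_gt_0_iff)
  then show ?thesis using eig_eigenbasis[OF assms(1)] by auto
qed

lemma qform_le_eig1:
  assumes "pair_graph G" "supp_in (pverts G) y"
  shows "qform (parcs G) y \<le> eig 1 G * sqn (pverts G) y"
proof (cases "pverts G = {}")
  case True
  \<comment> \<open>Without vertices \<open>eig 1 G\<close> is an entry beyond the end of an empty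
    list, but both sides are zero whatever it is.\<close>
  then have "parcs G = {}" using assms(1) by (auto simp: pair_graph_iff)
  then show ?thesis using True by (simp add: bform_def sqn_def)
next
  case False
  then have "0 < card (pverts G)" using assms by (simp add: pair_graph_iff card_gt_0_iff)
  then show ?thesis using eig_eigenbasis[OF assms(1)] assms(2) by auto
qed

lemma eig1_le:
  assumes "pair_graph G" "pverts G \<noteq> {}"
    and "\<And>y. supp_in (pverts G) y \<Longrightarrow> qform (parcs G) y \<le> c * sqn (pverts G) y"
  shows "eig 1 G \<le> c"
proof -
  obtain x where x: "supp_in (pverts G) x" "sqn (pverts G) x = 1"
    "\<And>v. v\<in>pverts G \<Longrightarrow> adj_app (parcs G) x v = eig 1 G * x v"
    using eig1_eigenvector[OF assms(1,2)] by blast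
  have "qform (parcs G) x = eig 1 G * sqn (pverts G) x"
    using assms(1) x(3) by (intro qform_eigenvector) (auto simp: pair_graph_iff)
  with assms(3)[OF x(1)] x(2) show ?thesis by simp
qed

lemma eig2_eigenvector:
  assumes "pair_graph G" "2 \<le> card (pverts G)"
  shows "\<exists>x. supp_in (pverts G) x \<and> sqn (pverts G) x = 1 \<and>
    (\<forall>v\<in>pverts G. adj_app (parcs G) x v = eig 2 G * x v)"
  using eig_eigenbasis[OF assms(1)] assms(2) by (auto simp: numeral_2_eq_2 Suc_le_eq)

section \<open>Min-max bounds for the second eigenvalue\<close>

lemma two_combination:
  fixes s t :: real
  obtains a b where "a * s + b * t = 0" "(a, b) \<noteq> (0, 0)"
proof (cases "s = 0 \<and> t = 0")
  case True
  then show ?thesis using that[of 1 0] by simp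
next
  case False
  then show ?thesis using that[of t "-s"] by (auto simp: mult.commute)
qed

text \<open>The span of two vectors meets the hyperplane orthogonal to the first eigenvector, and
  there the form is bounded by the second eigenvalue.\<close>

lemma eig2_test_vector:
  assumes G: "pair_graph G" "2 \<le> card (pverts G)" and "supp_in (pverts G) x" "supp_in (pverts G) y"
  obtains a b where "(a, b) \<noteq> (0, 0)" "qform (parcs G) (\<lambda>v. a * x v + b * y v)
    \<le> eig 2 G * sqn (pverts G) (\<lambda>v. a * x v + b * y v)"
proof -
  obtain f where f: "\<And>i. i<card (pverts G) \<Longrightarrow> (\<forall>y. supp_in (pverts G) y \<longrightarrow>
      (\<forall>j<i. (\<Sum>v\<in>pverts G. y v * f j v) = 0) \<longrightarrow>
        qform (parcs G) y \<le> eig (Suc i) G * sqn (pverts G) y)"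
    using eig_eigenbasis[OF G(1)] by blast
  obtain a b where ab: "a * (\<Sum>v\<in>pverts G. x v * f 0 v) + b * (\<Sum>v\<in>pverts G. y v * f 0 v) = 0"
    "(a, b) \<noteq> (0, 0)" by (rule two_combination)
  have "(\<Sum>v\<in>pverts G. (a * x v + b * y v) * f 0 v) = 0"
    using ab(1) by (simp add: sum_distrib_left sum.distrib distrib_right mult.assoc)
  then have "\<forall>j<1. (\<Sum>v\<in>pverts G. (a * x v + b * y v) * f j v) = 0" by simp
  moreover have "supp_in (pverts G) (\<lambda>v. a * x v + b * y v)"
    using assms(3,4) by (rule supp_in_comb)
  ultimately show ?thesis
    using f[of 1] G(2) that[OF ab(2)] by (simp add: numeral_2_eq_2)
qed

text \<open>Linear independence of \<open>x\<close> and \<open>y\<close> is implicit: a nontrivial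
  combination equal to zero would violate the strict inequality.\<close>

lemma eig2_greater:
  assumes "pair_graph G" "2 \<le> card (pverts G)" "supp_in (pverts G) x" "supp_in (pverts G) y"
    and pos: "\<And>a b. (a, b) \<noteq> (0, 0) \<Longrightarrow> c * sqn (pverts G) (\<lambda>v. a * x v + b * y v)
      < qform (parcs G) (\<lambda>v. a * x v + b * y v)"
  shows "c < eig 2 G"
proof -
  obtain a b where ab: "(a, b) \<noteq> (0, 0)" "qform (parcs G) (\<lambda>v. a * x v + b * y v)
    \<le> eig 2 G * sqn (pverts G) (\<lambda>v. a * x v + b * y v)"
    by (rule eig2_test_vector[OF assms(1-4)])
  with pos[OF ab(1)] have "c * sqn (pverts G) (\<lambda>v. a * x v + b * y v)
      < eig 2 G * sqn (pverts G) (\<lambda>v. a * x v + b * y v)" by simp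
  then show ?thesis
    by (meson mult_right_mono not_less sqn_nonneg)
qed

text \<open>The weak inequality holds for the zero vector as well, so here independence has to be
  demanded through a positive norm.\<close>

lemma eig2_ge:
  assumes "pair_graph G" "2 \<le> card (pverts G)" "supp_in (pverts G) x" "supp_in (pverts G) y"
    and pos: "\<And>a b. (a, b) \<noteq> (0, 0) \<Longrightarrow> 0 < sqn (pverts G) (\<lambda>v. a * x v + b * y v) \<and>
      c * sqn (pverts G) (\<lambda>v. a * x v + b * y v) \<le> qform (parcs G) (\<lambda>v. a * x v + b * y v)"
  shows "c \<le> eig 2 G"
proof -
  obtain a b where ab: "(a, b) \<noteq> (0, 0)" "qform (parcs G) (\<lambda>v. a * x v + b * y v)
    \<le> eig 2 G * sqn (pverts G) (\<lambda>v. a * x v + b * y v)"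
    by (rule eig2_test_vector[OF assms(1-4)])
  with pos[OF ab(1)] have "c * sqn (pverts G) (\<lambda>v. a * x v + b * y v)
      \<le> eig 2 G * sqn (pverts G) (\<lambda>v. a * x v + b * y v)" by (meson order_trans)
  moreover have "0 < sqn (pverts G) (\<lambda>v. a * x v + b * y v)" using pos[OF ab(1)] by blast
  ultimately show ?thesis by simp
qed

text \<open>The dual half of the min-max principle: the span of the first two eigenvectors meets the
  kernel of the functional \<open>l\<close>, and on that span the form is at least the second
  eigenvalue times the norm. Upper bounds thus need to be checked on one hyperplane of choice
  only.\<close>

lemma eig2_hyperplane:
  assumes G: "pair_graph G" "2 \<le> card (pverts G)"
    and lin: "\<And>x y a b. l (\<lambda>v. a * x v + b * y v) = a * l x + b * (l y :: real)"
  obtains z where "supp_in (pverts G) z" "z \<noteq> (\<lambda>_. 0)" "l z = 0"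
    "eig 2 G * sqn (pverts G) z \<le> qform (parcs G) z"
proof -
  let ?V = "pverts G" and ?E = "parcs G"
  have V: "finite ?V" "?E \<subseteq> ?V \<times> ?V" "sym ?E" using G(1) by (auto simp: pair_graph_iff)
  obtain f where f: "\<And>i. i<card ?V \<Longrightarrow> supp_in ?V (f i) \<and> sqn ?V (f i) = 1 \<and>
      (\<forall>j<i. (\<Sum>v\<in>?V. f i v * f j v) = 0) \<and>
      (\<forall>v\<in>?V. adj_app ?E (f i) v = eig (Suc i) G * f i v) \<and>
      (\<forall>y. supp_in ?V y \<longrightarrow> (\<forall>j<i. (\<Sum>v\<in>?V. y v * f j v) = 0) \<longrightarrow>
        qform ?E y \<le> eig (Suc i) G * sqn ?V y)"
    using eig_eigenbasis[OF G(1)] by blast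
  define e where "e = eig 1 G"
  have f0: "supp_in ?V (f 0)" "sqn ?V (f 0) = 1" "\<And>v. v\<in>?V \<Longrightarrow> adj_app ?E (f 0) v = e * f 0 v"
    "\<And>y. supp_in ?V y \<Longrightarrow> qform ?E y \<le> e * sqn ?V y"
    using f[of 0] G(2) by (auto simp: e_def)
  have "\<exists>g. supp_in ?V g \<and> sqn ?V g = 1 \<and> (\<forall>v\<in>?V. adj_app ?E g v = eig 2 G * g v) \<and>
    (\<Sum>v\<in>?V. g v * f 0 v) = 0"
    using f[of 1] G(2) by (intro exI[of _ "f 1"]) (simp add: numeral_2_eq_2)
  then obtain g where f1: "supp_in ?V g" "sqn ?V g = 1" "\<And>v. v\<in>?V \<Longrightarrow> adj_app ?E g v = eig 2 G * g v"
    "(\<Sum>v\<in>?V. f 0 v * g v) = 0"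
    by (auto simp: mult.commute)
  have q0: "qform ?E (f 0) = e" and q1: "qform ?E (g) = eig 2 G"
    using qform_eigenvector[OF V(1,2) f0(3)] qform_eigenvector[OF V(1,2) f1(3)] f0(2) f1(2) by auto
  have "eig 2 G \<le> e" using f0(4)[OF f1(1)] q1 f1(2) by simp
  have b: "bform ?E (f 0) g = 0"
  proof -
    have "bform ?E (f 0) g = eig 2 G * (\<Sum>v\<in>?V. f 0 v * g v)"
      by (simp add: bform_adj_app[OF V(1,2)] f1(3) mult.left_commute sum_distrib_left)
    then show ?thesis using f1(4) by simp
  qed
  obtain a b where ab: "a * l (f 0) + b * l (g) = 0" "(a, b) \<noteq> (0, 0)" by (rule two_combination)
  let ?z = "\<lambda>v. a * f 0 v + b * g v"
  have s: "sqn ?V ?z = a\<^sup>2 + b\<^sup>2" by (simp add: sqn_comb f0(2) f1(2,4))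
  have "qform ?E ?z = a\<^sup>2 * e + b\<^sup>2 * eig 2 G" by (simp add: qform_comb[OF V(3)] q0 q1 b)
  moreover have "a\<^sup>2 * eig 2 G \<le> a\<^sup>2 * e"
    using \<open>eig 2 G \<le> e\<close> by (intro mult_left_mono) auto
  ultimately have "eig 2 G * sqn ?V ?z \<le> qform ?E ?z"
    unfolding s by (simp add: distrib_left mult.commute)
  moreover have "?z \<noteq> (\<lambda>_. 0)"
  proof
    assume "?z = (\<lambda>_. 0)"
    then have "sqn ?V ?z = 0" by (simp add: sqn_def)
    then show False using ab(2) s by (simp add: sum_power2_eq_zero_iff)
  qed
  ultimately show ?thesis
    using that[of ?z] supp_in_comb[OF f0(1) f1(1)] lin[of a "f 0" b "g"] ab(1) by simp
qed

lemma eig2_less: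
  assumes G: "pair_graph G" "2 \<le> card (pverts G)"
    and lin: "\<And>x y a b. l (\<lambda>v. a * x v + b * y v) = a * l x + b * (l y :: real)"
    and neg: "\<And>z. supp_in (pverts G) z \<Longrightarrow> z \<noteq> (\<lambda>_. 0) \<Longrightarrow> l z = 0 \<Longrightarrow>
      qform (parcs G) z < c * sqn (pverts G) z"
  shows "eig 2 G < c"
proof -
  obtain z where z: "supp_in (pverts G) z" "z \<noteq> (\<lambda>_. 0)" "l z = 0"
    "eig 2 G * sqn (pverts G) z \<le> qform (parcs G) z"
    by (rule eig2_hyperplane[OF G lin])
  have "eig 2 G * sqn (pverts G) z < c * sqn (pverts G) z" using z(4) neg[OF z(1-3)] by simp
  then show ?thesis by (meson mult_right_mono not_less sqn_nonneg)
qed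

lemma eig2_le:
  assumes G: "pair_graph G" "2 \<le> card (pverts G)"
    and lin: "\<And>x y a b. l (\<lambda>v. a * x v + b * y v) = a * l x + b * (l y :: real)"
    and neg: "\<And>z. supp_in (pverts G) z \<Longrightarrow> l z = 0 \<Longrightarrow>
      qform (parcs G) z \<le> c * sqn (pverts G) z"
  shows "eig 2 G \<le> c"
proof -
  obtain z where z: "supp_in (pverts G) z" "z \<noteq> (\<lambda>_. 0)" "l z = 0"
    "eig 2 G * sqn (pverts G) z \<le> qform (parcs G) z"
    by (rule eig2_hyperplane[OF G lin])
  have "sqn (pverts G) z > 0"
    using z(1,2) sqn_zero_iff[of "pverts G" z] G(1) sqn_nonneg[of "pverts G" z]
    by (auto simp: pair_graph_iff less_le)
  moreover have "eig 2 G * sqn (pverts G) z \<le> c * sqn (pverts G) z" using z(4) neg[OF z(1,3)] by simp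
  ultimately show ?thesis by simp
qed

section \<open>Splitting forms into blocks and perturbing test vectors\<close>

lemma qform_block_le:
  assumes V: "finite V" and D: "finite \<D>" "\<Union>\<D> \<subseteq> V" "pairwise disjnt \<D>"
    and x: "supp_in (\<Union>\<D>) x"
    and arcs: "\<And>u v. (u, v) \<in> E \<Longrightarrow> u \<in> \<Union>\<D> \<Longrightarrow> v \<in> \<Union>\<D> \<Longrightarrow> \<exists>D\<in>\<D>. u \<in> D \<and> v \<in> D"
    and le: "\<And>D y. D \<in> \<D> \<Longrightarrow> supp_in D y \<Longrightarrow> qform E y \<le> c * sqn V y"
  shows "qform E x \<le> c * sqn V x"
proof -
  define xD where "xD D v = (if v \<in> D then x v else 0)" for D v
  \<comment> \<open>Stated for arcs and for \<open>u = v\<close> at once, so that the same identity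
    splits the form and the norm.\<close>
  have split: "(\<Sum>D\<in>\<D>. xD D u * xD D v) = x u * x v" if "(u, v) \<in> E \<or> u = v" for u v
  proof (cases "x u * x v = 0")
    case True
    then have "(\<Sum>D\<in>\<D>. xD D u * xD D v) = 0" by (intro sum.neutral) (auto simp: xD_def)
    then show ?thesis using True by simp
  next
    case False
    then have "u \<in> \<Union>\<D>" "v \<in> \<Union>\<D>" using x by (auto simp: supp_in_def)
    then have "\<exists>D\<in>\<D>. u \<in> D \<and> v \<in> D" using that arcs[of u v] by auto
    then obtain D0 where D0: "D0 \<in> \<D>" "u \<in> D0" "v \<in> D0" by blast
    have "(\<Sum>D\<in>\<D> - {D0}. xD D u * xD D v) = 0"
      using D0 D(3) by (intro sum.neutral) (auto simp: xD_def pairwise_def disjnt_iff)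
    then have "(\<Sum>D\<in>\<D>. xD D u * xD D v) = xD D0 u * xD D0 v"
      using D(1) D0(1) by (subst sum.remove[of _ D0]) auto
    then show ?thesis using D0 by (simp add: xD_def)
  qed
  have "qform E x = (\<Sum>(u, v)\<in>E. \<Sum>D\<in>\<D>. xD D u * xD D v)"
    unfolding bform_def using split by (intro sum.cong) auto
  also have "\<dots> = (\<Sum>D\<in>\<D>. qform E (xD D))"
    unfolding bform_def by (simp add: case_prod_unfold sum.swap[of _ \<D>])
  also have "\<dots> \<le> (\<Sum>D\<in>\<D>. c * sqn V (xD D))"
    by (intro sum_mono le) (auto simp: supp_in_def xD_def)
  also have "\<dots> = c * (\<Sum>v\<in>V. \<Sum>D\<in>\<D>. xD D v * xD D v)"
    by (simp add: sqn_def power2_eq_square sum.swap[of _ \<D>] flip: sum_distrib_left)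
  also have "\<dots> = c * sqn V x"
    using split by (simp add: sqn_def power2_eq_square)
  finally show ?thesis .
qed

text \<open>Multiplying by \<open>P\<close> completes the square; what remains is the determinant
  times the square of \<open>t\<close>.\<close>

lemma binary_form_pos:
  fixes P d b :: real
  assumes "P > 0" "b\<^sup>2 < P * d" "(s, t) \<noteq> (0, 0)"
  shows "0 < s\<^sup>2 * P + 2 * s * t * b + t\<^sup>2 * d"
proof -
  have "P * (s\<^sup>2 * P + 2 * s * t * b + t\<^sup>2 * d) = (P * s + b * t)\<^sup>2 + (P * d - b\<^sup>2) * t\<^sup>2"
    by (simp add: power2_eq_square algebra_simps)
  also have "\<dots> > 0"
  proof (cases "t = 0")
    case True
    then show ?thesis using assms by simp
  next
    case False
    then show ?thesis using assms by (intro add_nonneg_pos) auto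
  qed
  finally show ?thesis using assms(1) by (simp add: zero_less_mult_iff)
qed

text \<open>Two test vectors without mutual adjacency already give \<open>\<lambda>\<^sub>2 \<ge> c\<close>; strictness comes from
  perturbing \<open>x\<close> at a further vertex \<open>a\<close> adjacent to its support.\<close>

lemma eig2_greater_perturb:
  assumes G: "pair_graph G" "a \<in> pverts G" "2 \<le> card (pverts G)"
    and x: "supp_in (pverts G) x" and y: "supp_in (pverts G) y"
    and xa: "x a = 0" "y a = 0" and xy: "(\<Sum>v\<in>pverts G. x v * y v) = 0" "bform (parcs G) x y = 0"
    and qx: "c * sqn (pverts G) x \<le> qform (parcs G) x" and qy: "c * sqn (pverts G) y < qform (parcs G) y"
    and ad: "0 < adj_app (parcs G) x a"
  shows "c < eig 2 G"
proof -
  let ?V = "pverts G" and ?E = "parcs G"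
  have V: "finite ?V" "?E \<subseteq> ?V \<times> ?V" "sym ?E" "irrefl ?E" using G(1) by (auto simp: pair_graph_iff)
  define e where "e v = (if v = a then 1 else 0 :: real)" for v
  have be: "bform ?E z e = adj_app ?E z a" for z
  proof -
    have "bform ?E z e = bform ?E e z" by (rule bform_sym[OF V(3)])
    also have "\<dots> = (\<Sum>v\<in>?V. if v = a then adj_app ?E z v else 0)"
      unfolding bform_adj_app[OF V(1,2)] by (intro sum.cong) (auto simp: e_def)
    finally show ?thesis using G(2) V(1) by simp
  qed
  have ze: "(\<Sum>v\<in>?V. z v * e v) = z a" for z
    using G(2) V(1) by (simp add: e_def if_distrib[of "\<lambda>w. _ * w"] cong: if_cong)
  have see: "sqn ?V e = 1" using ze[of e] by (simp add: sqn_def power2_eq_square e_def)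
  have qe: "qform ?E e = 0"
    using V(4) unfolding be by (auto simp: adj_app_def e_def irrefl_def intro!: sum.neutral)
  have qe': "adj_app ?E e a = 0" using qe unfolding be .
  define X Y d where "X = adj_app ?E x a" and "Y = adj_app ?E y a" and "d = qform ?E y - c * sqn ?V y"
  have pos: "X > 0" "d > 0" using ad qy by (auto simp: X_def d_def)
  \<comment> \<open>On the span of x + \<epsilon>e and \<open>y\<close> the excess of the form over
    c times the norm has diagonal entries at least
    \<open>2 * \<epsilon> * X - c * \<epsilon>\<^sup>2\<close> and \<open>d\<close>, and
    off-diagonal entry \<open>\<epsilon> * Y\<close>. Its determinant is positive once
    \<open>\<epsilon> * (c * d + Y\<^sup>2) < 2 * X * d\<close>, which \<epsilon> = X d / w ensures;
    the absolute value and the summand 1 keep \<open>w\<close> positive.\<close>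
  define w where "w = \<bar>c\<bar> * d + Y\<^sup>2 + 1"
  have w: "w > 0" using pos(2) unfolding w_def by (intro add_nonneg_pos add_nonneg_nonneg) auto
  define \<epsilon> where "\<epsilon> = X * d / w"
  have eps: "\<epsilon> > 0" using pos w by (simp add: \<epsilon>_def)
  have "c * d + Y\<^sup>2 \<le> \<bar>c\<bar> * d + Y\<^sup>2" using pos(2) by (intro add_right_mono mult_right_mono) auto
  also have "\<dots> < w" by (simp add: w_def)
  finally have "\<epsilon> * (c * d + Y\<^sup>2) < \<epsilon> * w" using eps by simp
  also have "\<dots> = X * d" using w by (simp add: \<epsilon>_def)
  finally have "\<epsilon> * (c * d + Y\<^sup>2) < 2 * X * d" using mult_pos_pos[OF pos] by linarith
  then have "\<epsilon> * (\<epsilon> * (c * d + Y\<^sup>2)) < \<epsilon> * (2 * X * d)" using eps by simp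
  then have disc: "(\<epsilon> * Y)\<^sup>2 < (2 * \<epsilon> * X - c * \<epsilon>\<^sup>2) * d"
    by (simp add: power2_eq_square algebra_simps)
  \<comment> \<open>The determinant inequality bounds a square by the product of this entry with the
    positive \<open>d\<close>.\<close>
  have P: "2 * \<epsilon> * X - c * \<epsilon>\<^sup>2 > 0"
  proof (rule ccontr)
    assume "\<not> ?thesis"
    then have "(2 * \<epsilon> * X - c * \<epsilon>\<^sup>2) * d \<le> 0" using pos(2) by (simp add: mult_nonpos_nonneg)
    with disc show False by (smt (verit) zero_le_power2)
  qed
  define x' where "x' v = 1 * x v + \<epsilon> * e v" for v
  have supp: "supp_in ?V x'"
    unfolding x'_def using x G(2) by (intro supp_in_comb) (auto simp: supp_in_def e_def)
  have sx': "sqn ?V x' = sqn ?V x + \<epsilon>\<^sup>2" unfolding x'_def sqn_comb by (simp add: see ze xa)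
  have qx': "qform ?E x' = qform ?E x + 2 * \<epsilon> * X"
    unfolding x'_def qform_comb[OF V(3)] by (simp add: qe' be X_def)
  have b': "bform ?E x' y = \<epsilon> * Y"
    unfolding x'_def bform_add_left by (simp add: xy(2) bform_sym[OF V(3), of e y] be Y_def)
  have xy': "(\<Sum>v\<in>?V. x' v * y v) = 0"
    using xy(1) ze[of y] xa by (simp add: x'_def distrib_right sum.distrib mult.assoc mult.commute[of "e _"] flip: sum_distrib_left)
  show ?thesis
  proof (rule eig2_greater[OF G(1,3) supp y])
    fix s t :: real assume st: "(s, t) \<noteq> (0, 0)"
    have "0 < s\<^sup>2 * (2 * \<epsilon> * X - c * \<epsilon>\<^sup>2) + 2 * s * t * (\<epsilon> * Y) + t\<^sup>2 * d"
      by (rule binary_form_pos[OF P disc st])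
    also have "\<dots> \<le> s\<^sup>2 * (qform ?E x - c * sqn ?V x + (2 * \<epsilon> * X - c * \<epsilon>\<^sup>2)) + 2 * s * t * (\<epsilon> * Y) + t\<^sup>2 * d"
      using qx by (intro add_right_mono mult_left_mono) auto
    also have "\<dots> = qform ?E (\<lambda>v. s * x' v + t * y v) - c * sqn ?V (\<lambda>v. s * x' v + t * y v)"
      unfolding qform_comb[OF V(3)] sqn_comb sx' qx' b' xy' d_def by (simp add: algebra_simps)
    finally show "c * sqn ?V (\<lambda>v. s * x' v + t * y v) < qform ?E (\<lambda>v. s * x' v + t * y v)" by simp
  qed
qed

text \<open>Since the norm does not change under absolute values, maximisers may be chosen
  nonnegative; this is the source of all Perron type positivity below.\<close>

lemma qform_abs_ge: "qform E x \<le> qform E (\<lambda>v. \<bar>x v\<bar>)"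
  unfolding bform_def by (intro sum_mono) (auto simp flip: abs_mult)

lemma sqn_abs [simp]: "sqn V (\<lambda>v. \<bar>x v\<bar>) = sqn V x"
  by (simp add: sqn_def)

text \<open>Trees are encoded by parent functions so that a surgery becomes an update of
  \<open>p\<close> while the vertex set stays fixed.\<close>

definition parent_arcs :: "'a set \<Rightarrow> 'a \<Rightarrow> ('a \<Rightarrow> 'a) \<Rightarrow> 'a rel" where
  "parent_arcs V r p = (\<lambda>v. (v, p v)) ` (V - {r}) \<union> (\<lambda>v. (p v, v)) ` (V - {r})"

definition parent_graph :: "'a set \<Rightarrow> 'a \<Rightarrow> ('a \<Rightarrow> 'a) \<Rightarrow> 'a pair_pre_digraph" where
  "parent_graph V r p = \<lparr>pverts = V, parcs = parent_arcs V r p\<rparr>"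

lemma parent_graph_simps [simp]:
  "pverts (parent_graph V r p) = V" "parcs (parent_graph V r p) = parent_arcs V r p"
  by (simp_all add: parent_graph_def)

section \<open>Elimination certificates on rooted trees\<close>

text \<open>The depth \<open>h\<close> turns parent pointers into a tree: it drops by one at each
  step and is zero at \<open>r\<close> alone, so every vertex climbs to \<open>r\<close> and no
  chain of parents returns.\<close>

locale rooted_tree =
  fixes V :: "'a set" and r :: 'a and p :: "'a \<Rightarrow> 'a" and h :: "'a \<Rightarrow> nat"
  assumes fin: "finite V" and root: "r \<in> V" "h r = 0"
    and par: "v \<in> V \<Longrightarrow> v \<noteq> r \<Longrightarrow> p v \<in> V"
    and dep: "v \<in> V \<Longrightarrow> v \<noteq> r \<Longrightarrow> h v = Suc (h (p v))"
begin

abbreviation "E \<equiv> parent_arcs V r p"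
abbreviation "G \<equiv> parent_graph V r p"

definition ch :: "'a \<Rightarrow> 'a set" where
  "ch u = {v \<in> V - {r}. p v = u}"

text \<open>The descendants of \<open>u\<close>, with \<open>u\<close> included. The number of
  upward steps is dictated by the depths, so subtrees of distinct vertices of equal depth are
  disjoint by definition.\<close>

definition sub :: "'a \<Rightarrow> 'a set" where
  "sub u = {v \<in> V. h u \<le> h v \<and> (p ^^ (h v - h u)) v = u}"

lemma ch_iff: "v \<in> ch u \<longleftrightarrow> v \<in> V \<and> v \<noteq> r \<and> p v = u"
  by (auto simp: ch_def)

lemma fin_ch [simp]: "finite (ch u)"
  using fin by (simp add: ch_def)

lemma arcs_iff: "(u, v) \<in> E \<longleftrightarrow> u \<in> V \<and> u \<noteq> r \<and> v = p u \<or> v \<in> V \<and> v \<noteq> r \<and> u = p v"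
  by (auto simp: parent_arcs_def)

lemma E_sub: "E \<subseteq> V \<times> V"
  using par by (auto simp: parent_arcs_def)

lemma E_sym: "sym E"
  by (auto simp: sym_def arcs_iff)

lemma par_neq: "v \<in> V \<Longrightarrow> v \<noteq> r \<Longrightarrow> p v \<noteq> v"
  using dep by fastforce

lemma pair_graph_G: "pair_graph G"
  using fin E_sub E_sym par_neq by (simp add: pair_graph_iff irrefl_def arcs_iff) metis

lemma disj: "(\<lambda>v. (v, p v)) ` (V - {r}) \<inter> (\<lambda>v. (p v, v)) ` (V - {r}) = {}"
proof -
  have "(v, p v) \<noteq> (p w, w)" if "v \<in> V - {r}" "w \<in> V - {r}" for v w
    using dep[of v] dep[of w] that by auto
  then show ?thesis by (auto elim!: imageE)
qed

lemma bform_parent: "bform E x y = (\<Sum>v\<in>V - {r}. x v * y (p v) + x (p v) * y v)"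
proof -
  have "bform E x y = (\<Sum>(u, v)\<in>(\<lambda>v. (v, p v)) ` (V - {r}). x u * y v) + (\<Sum>(u, v)\<in>(\<lambda>v. (p v, v)) ` (V - {r}). x u * y v)"
    unfolding bform_def parent_arcs_def using fin disj by (intro sum.union_disjoint) auto
  also have "\<dots> = (\<Sum>v\<in>V - {r}. x v * y (p v)) + (\<Sum>v\<in>V - {r}. x (p v) * y v)"
    by (subst (1 2) sum.reindex) (auto simp: inj_on_def)
  finally show ?thesis by (simp add: sum.distrib)
qed

lemma qform_parent: "qform E x = 2 * (\<Sum>v\<in>V - {r}. x v * x (p v))"
  by (simp add: bform_parent sum_distrib_left mult.commute)

lemma sum_children:
  fixes g :: "'a \<Rightarrow> real"
  shows "(\<Sum>u\<in>V. \<Sum>w\<in>ch u. g w) = (\<Sum>w\<in>V - {r}. g w)"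
proof -
  have "(\<Sum>u\<in>V. \<Sum>w\<in>ch u. g w) = (\<Sum>w\<in>(\<Union>u\<in>V. ch u). g w)"
    using fin by (intro sum.UNION_disjoint[symmetric]) (auto simp: ch_iff)
  also have "(\<Union>u\<in>V. ch u) = V - {r}" by (auto simp: ch_iff dest: par)
  finally show ?thesis .
qed

lemma adj_app_parent:
  assumes "v \<in> V"
  shows "adj_app E x v = (if v = r then 0 else x (p v)) + (\<Sum>w\<in>ch v. x w)"
proof -
  have im: "E `` {v} = (if v = r then {} else {p v}) \<union> ch v"
    by (rule Set.set_eqI) (use assms in \<open>simp add: arcs_iff ch_iff, blast\<close>)
  have "p v \<notin> ch v" if "v \<noteq> r"
    using dep[of v] dep[of "p v"] assms that by (auto simp: ch_iff)
  then show ?thesis unfolding adj_app_def im by (cases "v = r") simp_all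
qed

text \<open>The Schur complements of the leaf-to-root elimination diagonalise the form
  \<open>c |x|\<^sup>2 - x\<^sup>T A x\<close>.\<close>

lemma certificate_identity:
  assumes "\<And>v. v \<in> V \<Longrightarrow> v \<noteq> r \<Longrightarrow> g v \<noteq> 0"
  shows "c * sqn V x - qform E x = (\<Sum>v\<in>V - {r}. 1 / g v * (x v - g v * x (p v))\<^sup>2) +
    (\<Sum>v\<in>V. (c - (\<Sum>w\<in>ch v. g w) - (if v = r then 0 else 1 / g v)) * (x v)\<^sup>2)"
proof -
  have "(\<Sum>v\<in>V - {r}. 1 / g v * (x v - g v * x (p v))\<^sup>2) =
      (\<Sum>v\<in>V - {r}. 1 / g v * (x v)\<^sup>2 - 2 * (x v * x (p v)) + g v * (x (p v))\<^sup>2)"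
    using assms by (intro sum.cong) (auto simp: power2_eq_square field_simps)
  also have "\<dots> = (\<Sum>v\<in>V - {r}. 1 / g v * (x v)\<^sup>2) - qform E x + (\<Sum>v\<in>V - {r}. g v * (x (p v))\<^sup>2)"
    by (simp add: sum.distrib sum_subtractf qform_parent sum_distrib_left)
  also have "(\<Sum>v\<in>V - {r}. g v * (x (p v))\<^sup>2) = (\<Sum>u\<in>V. \<Sum>w\<in>ch u. g w * (x (p w))\<^sup>2)"
    by (rule sum_children[symmetric])
  also have "\<dots> = (\<Sum>u\<in>V. (\<Sum>w\<in>ch u. g w) * (x u)\<^sup>2)"
    by (simp add: sum_distrib_right ch_iff)
  finally have 1: "(\<Sum>v\<in>V - {r}. 1 / g v * (x v - g v * x (p v))\<^sup>2) =
    (\<Sum>v\<in>V - {r}. 1 / g v * (x v)\<^sup>2) - qform E x + (\<Sum>u\<in>V. (\<Sum>w\<in>ch u. g w) * (x u)\<^sup>2)" .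
  have "(\<Sum>v\<in>V. (if v = r then 0 else 1 / g v) * (x v)\<^sup>2) = (\<Sum>v\<in>V - {r}. 1 / g v * (x v)\<^sup>2)"
    using fin by (intro sum.mono_neutral_cong_right) auto
  then have 2: "(\<Sum>v\<in>V. (c - (\<Sum>w\<in>ch v. g w) - (if v = r then 0 else 1 / g v)) * (x v)\<^sup>2) =
    c * sqn V x - (\<Sum>u\<in>V. (\<Sum>w\<in>ch u. g w) * (x u)\<^sup>2) - (\<Sum>v\<in>V - {r}. 1 / g v * (x v)\<^sup>2)"
    by (simp add: left_diff_distrib sum_subtractf sqn_def sum_distrib_left)
  show ?thesis unfolding 1 2 by simp
qed

text \<open>On the hyperplane where the square belonging to \<open>s\<close> vanishes, the only
  negative coefficient of the diagonalised form disappears and the rest is a sum of nonnegative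
  terms. The slack at \<open>w\<close> makes it definite: if all terms vanish then so does the
  vector at \<open>w\<close>, and the other squares carry this zero through the tree.\<close>

lemma certificate_eig2_less:
  assumes s: "s \<in> V" "s \<noteq> r"
    and pos: "\<And>v. v \<in> V \<Longrightarrow> v \<noteq> r \<Longrightarrow> v \<noteq> s \<Longrightarrow> 0 < g v" and neg: "g s < 0"
    and le: "\<And>v. v \<in> V \<Longrightarrow> (\<Sum>w\<in>ch v. g w) + (if v = r then 0 else 1 / g v) \<le> c"
    and less: "w \<in> V" "(\<Sum>u\<in>ch w. g u) + (if w = r then 0 else 1 / g w) < c"
  shows "eig 2 G < c"
proof -
  have g0: "g v \<noteq> 0" if "v \<in> V" "v \<noteq> r" for v using pos[OF that] neg by (cases "v = s") auto
  define sl where "sl v = c - (\<Sum>w\<in>ch v. g w) - (if v = r then 0 else 1 / g v)" for v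
  have sl: "0 \<le> sl v" if "v \<in> V" for v using le[OF that] by (simp add: sl_def)
  have slw: "0 < sl w" using less by (simp add: sl_def)
  have card: "2 \<le> card (pverts G)"
  proof -
    have "card {r, s} \<le> card V" using fin root s by (intro card_mono) auto
    then show ?thesis using s by simp
  qed
  show ?thesis
  proof (rule eig2_less[OF pair_graph_G card, of "\<lambda>x. x s - g s * x (p s)"])
    fix x assume x: "supp_in (pverts G) x" "x \<noteq> (\<lambda>_. 0)" "x s - g s * x (p s) = 0"
    define T where "T v = 1 / g v * (x v - g v * x (p v))\<^sup>2" for v
    have id: "c * sqn V x - qform E x = (\<Sum>v\<in>V - {r}. T v) + (\<Sum>v\<in>V. sl v * (x v)\<^sup>2)"
      unfolding T_def sl_def by (rule certificate_identity[OF g0])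
    have T: "0 \<le> T v" if "v \<in> V - {r}" for v
      using x(3) pos[of v] that by (cases "v = s") (auto simp: T_def)
    have S: "0 \<le> sl v * (x v)\<^sup>2" if "v \<in> V" for v using sl[OF that] by simp
    have "c * sqn V x - qform E x \<noteq> 0"
    proof
      assume "c * sqn V x - qform E x = 0"
      then have "(\<Sum>v\<in>V - {r}. T v) + (\<Sum>v\<in>V. sl v * (x v)\<^sup>2) = 0" using id by simp
      moreover have "0 \<le> (\<Sum>v\<in>V - {r}. T v)" "0 \<le> (\<Sum>v\<in>V. sl v * (x v)\<^sup>2)"
        by (intro sum_nonneg T S; assumption)+
      ultimately have "(\<Sum>v\<in>V - {r}. T v) = 0" "(\<Sum>v\<in>V. sl v * (x v)\<^sup>2) = 0" by linarith+
      then have T0: "\<forall>v\<in>V - {r}. T v = 0" and S0: "\<forall>v\<in>V. sl v * (x v)\<^sup>2 = 0"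
        using fin T S by (subst (asm) sum_nonneg_eq_0_iff; simp)+
      have step: "x v = g v * x (p v)" if "v \<in> V" "v \<noteq> r" for v
        using T0 that g0[OF that] by (auto simp: T_def)
      \<comment> \<open>Since no \<open>g v\<close> is zero, a zero entry climbs from
        \<open>w\<close> to the root; from there the same relations push it down to every
        vertex.\<close>
      have up: "v \<in> V \<Longrightarrow> x v = 0 \<Longrightarrow> x r = 0" for v
      proof (induction "h v" arbitrary: v)
        case 0
        then have "v = r" using dep by fastforce
        then show ?case using 0 by simp
      next
        case (Suc n)
        then have "v \<noteq> r" using root by auto
        then have "x (p v) = 0" "p v \<in> V" "h (p v) = n"
          using step[of v] g0[of v] Suc.prems Suc.hyps(2) par dep by auto
        then show ?case using Suc.hyps(1) by auto
      qed
      have "x w = 0" using S0 less(1) slw by auto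
      then have r0: "x r = 0" using up less(1) by blast
      have "v \<in> V \<Longrightarrow> x v = 0" for v
      proof (induction "h v" arbitrary: v)
        case 0
        then have "v = r" using dep by fastforce
        then show ?case using r0 by simp
      next
        case (Suc n)
        then have "v \<noteq> r" using root by auto
        then have "p v \<in> V" "h (p v) = n" using Suc.prems Suc.hyps(2) par dep by auto
        then show ?case using Suc.hyps(1)[of "p v"] step[of v] Suc.prems \<open>v \<noteq> r\<close> by simp
      qed
      then have "x = (\<lambda>_. 0)" using x(1) by (auto simp: supp_in_def fun_eq_iff)
      with x(2) show False by simp
    qed
    moreover have "0 \<le> c * sqn V x - qform E x"
      unfolding id by (intro add_nonneg_nonneg sum_nonneg T S)
    ultimately show "qform (parcs G) x < c * sqn (pverts G) x" by simp
  qed (simp add: algebra_simps)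
qed

lemma qform_le_certificate:
  assumes pos: "\<And>v. v \<in> V \<Longrightarrow> v \<noteq> r \<Longrightarrow> 0 < g v"
    and le: "\<And>v. v \<in> V \<Longrightarrow> (\<Sum>w\<in>ch v. g w) + (if v = r then 0 else 1 / g v) \<le> c"
  shows "qform E x \<le> c * sqn V x"
proof -
  have g0: "g v \<noteq> 0" if "v \<in> V" "v \<noteq> r" for v using pos[OF that] by simp
  have "c * sqn V x - qform E x = (\<Sum>v\<in>V - {r}. 1 / g v * (x v - g v * x (p v))\<^sup>2) +
    (\<Sum>v\<in>V. (c - (\<Sum>w\<in>ch v. g w) - (if v = r then 0 else 1 / g v)) * (x v)\<^sup>2)"
    by (rule certificate_identity[OF g0])
  also have "\<dots> \<ge> 0"
    by (intro add_nonneg_nonneg sum_nonneg mult_nonneg_nonneg)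
      (use pos le in \<open>auto simp: less_imp_le diff_diff_eq\<close>)
  finally show ?thesis by simp
qed

section \<open>Subtrees of descendants\<close>

lemma sub_self: "u \<in> V \<Longrightarrow> u \<in> sub u"
  by (simp add: sub_def)

lemma sub_subset: "sub u \<subseteq> V"
  by (auto simp: sub_def)

lemma sub_depth: "v \<in> sub u \<Longrightarrow> h u \<le> h v"
  by (simp add: sub_def)

lemma sub_step:
  assumes "v \<in> V" "v \<noteq> r" "v \<noteq> u"
  shows "v \<in> sub u \<longleftrightarrow> p v \<in> sub u"
proof (cases "h u \<le> h (p v)")
  case True
  then have "h v - h u = Suc (h (p v) - h u)" using dep[OF assms(1,2)] by simp
  then have "(p ^^ (h v - h u)) v = (p ^^ (h (p v) - h u)) (p v)" by (simp only: funpow_Suc_right o_apply)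
  then show ?thesis using True dep[OF assms(1,2)] par[OF assms(1,2)] assms(1) by (simp add: sub_def)
next
  case False
  then have "\<not> (h u \<le> h v \<and> (p ^^ (h v - h u)) v = u)"
    using dep[OF assms(1,2)] assms(3) by (cases "h u = h v") auto
  then show ?thesis using False by (simp add: sub_def)
qed

lemma root_sub: "u \<in> V \<Longrightarrow> r \<in> sub u \<Longrightarrow> u = r"
  by (auto simp: sub_def root)

lemma par_not_sub: "u \<in> V \<Longrightarrow> u \<noteq> r \<Longrightarrow> p u \<notin> sub u"
  using sub_depth dep by fastforce

lemma sub_induct [consumes 2, case_names self step]:
  assumes "u \<in> V" "v \<in> sub u"
    and self: "P u"
    and step: "\<And>v. v \<in> V \<Longrightarrow> v \<noteq> r \<Longrightarrow> v \<noteq> u \<Longrightarrow> v \<in> sub u \<Longrightarrow> p v \<in> sub u \<Longrightarrow> P (p v) \<Longrightarrow> P v"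
  shows "P v"
  using assms(2)
proof (induction "h v" arbitrary: v rule: less_induct)
  case less
  show ?case
  proof (cases "v = u")
    case True
    then show ?thesis using self by simp
  next
    case False
    have v: "v \<in> V" "v \<noteq> r" using less.prems sub_subset root_sub[OF assms(1)] False by auto
    then have "p v \<in> sub u" using less.prems sub_step False by blast
    moreover have "h (p v) < h v" using dep v by simp
    ultimately show ?thesis using step[OF v False less.prems] less.hyps by blast
  qed
qed

text \<open>Depth leaves only the edge from the top vertex to its parent as an exit, so a vector
  supported in a branch interacts with the rest of the tree through \<open>p u\<close>
  alone.\<close>

lemma sub_arc:
  assumes "u \<in> V" "(v, w) \<in> E" "v \<in> sub u"
  shows "w \<in> sub u \<or> v = u \<and> u \<noteq> r \<and> w = p u"
  using assms(2) unfolding arcs_iff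
proof (elim disjE conjE)
  assume "v \<in> V" "v \<noteq> r" "w = p v"
  then show ?thesis using sub_step[of v u] assms(3) by blast
next
  assume w: "w \<in> V" "w \<noteq> r" "v = p w"
  have "w \<noteq> u" using w assms(3) par_not_sub[of u] by auto
  then show ?thesis using sub_step[of w u] w assms(3) by blast
qed

text \<open>Perron's argument on a connected branch: a nonnegative maximiser satisfies the
  eigenvalue equation at every vertex of the branch, so a zero entry forces zeros at all neighbours.
  Zeros would spread up to \<open>u\<close> and then over the whole branch.\<close>

lemma sub_maximiser_pos:
  assumes u: "u \<in> V" and x: "supp_in (sub u) x" "x \<noteq> (\<lambda>_. 0)" "\<And>v. 0 \<le> x v"
    and eq: "c * sqn V x \<le> qform E x"
    and max: "\<And>y. supp_in (sub u) y \<Longrightarrow> qform E y \<le> c * sqn V y"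
    and v: "v \<in> sub u"
  shows "0 < x v"
proof -
  have ev: "adj_app E x w = c * x w" if w: "w \<in> sub u" for w
  proof -
    define e where "e z = (if z = w then 1 else 0 :: real)" for z
    have wV: "w \<in> V" using w sub_subset by blast
    have "bform E e x = c * (\<Sum>v\<in>V. e v * x v)"
    proof (rule rayleigh_critical[OF E_sym])
      show "qform E x = c * sqn V x" using eq max[OF x(1)] by simp
      show "qform E (\<lambda>v. x v + t * e v) \<le> c * sqn V (\<lambda>v. x v + t * e v)" for t
        using w x(1) by (intro max) (auto simp: supp_in_def e_def)
    qed
    moreover have "bform E e x = (\<Sum>v\<in>V. if v = w then adj_app E x v else 0)"
      unfolding bform_adj_app[OF fin E_sub] by (intro sum.cong) (auto simp: e_def)
    moreover have "(\<Sum>v\<in>V. e v * x v) = (\<Sum>v\<in>V. if v = w then x v else 0)"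
      by (intro sum.cong) (auto simp: e_def)
    ultimately show ?thesis using wV fin by simp
  qed
  \<comment> \<open>The eigenvalue equation at \<open>w\<close> says that nonnegative entries sum to
    zero.\<close>
  have zero: "x z = 0" if "w \<in> sub u" "x w = 0" "(w, z) \<in> E" for w z
  proof -
    have "(\<Sum>z\<in>E `` {w}. x z) = 0" using ev[OF that(1)] that(2) by (simp add: adj_app_def)
    moreover have "finite (E `` {w})" using E_sub fin by (auto intro: finite_subset)
    ultimately show ?thesis using x(3) that(3) by (subst (asm) sum_nonneg_eq_0_iff) auto
  qed
  have up: "x w = 0 \<longrightarrow> x u = 0" if "w \<in> sub u" for w
    using u that
  proof (induction rule: sub_induct)
    case (step w)
    from step(1,2) have "(w, p w) \<in> E" by (simp add: arcs_iff)
    then have "x w = 0 \<Longrightarrow> x (p w) = 0" using zero[OF step(4)] by blast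
    then show ?case using step(6) by simp
  qed simp
  have down: "x u = 0 \<longrightarrow> x w = 0" if "w \<in> sub u" for w
    using u that
  proof (induction rule: sub_induct)
    case (step w)
    from step(1,2) have "(p w, w) \<in> E" by (simp add: arcs_iff)
    then have "x (p w) = 0 \<Longrightarrow> x w = 0" using zero[OF step(5)] by blast
    then show ?case using step(6) by simp
  qed simp
  have "x v \<noteq> 0"
  proof
    assume "x v = 0"
    then have "x w = 0" for w using up[OF v] down[of w] x(1) by (auto simp: supp_in_def)
    with x(2) show False by auto
  qed
  with x(3)[of v] show ?thesis by simp
qed

text \<open>Testing the equation against the negative part \<open>y\<close> of \<open>z\<close>
  gives \<open>c * sqn V y \<le> qform E y\<close>, which strictness permits only for
  \<open>y\<close> zero. This is a minimum principle for a branch whose boundary value at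
  \<open>p u\<close> is nonnegative.\<close>

lemma sub_eigenvector_nonneg:
  assumes u: "u \<in> V" "u \<noteq> r" and z: "\<And>v. v \<in> sub u \<Longrightarrow> adj_app E z v = c * z v" and zu: "0 \<le> z (p u)"
    and less: "\<And>y. supp_in (sub u) y \<Longrightarrow> y \<noteq> (\<lambda>_. 0) \<Longrightarrow> qform E y < c * sqn V y"
    and v: "v \<in> sub u"
  shows "0 \<le> z v"
proof -
  define y where "y w = (if w \<in> sub u then max 0 (- z w) else 0)" for w
  have supp: "supp_in (sub u) y" by (simp add: supp_in_def y_def)
  have "bform E y z = c * (\<Sum>v\<in>V. y v * z v)"
    unfolding bform_adj_app[OF fin E_sub] sum_distrib_left
    using z by (intro sum.cong) (auto simp: y_def)
  also have "(\<Sum>v\<in>V. y v * z v) = - sqn V y"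
    unfolding sqn_def sum_negf[symmetric] by (intro sum.cong) (auto simp: y_def max_def power2_eq_square)
  finally have "bform E y z = - c * sqn V y" by simp
  moreover have "- qform E y \<le> bform E y z"
    unfolding bform_def sum_negf[symmetric]
  proof (intro sum_mono)
    fix e assume e: "e \<in> E"
    obtain a b where ab: "e = (a, b)" by (cases e)
    \<comment> \<open>Inside the branch \<open>- y b \<le> z b\<close> holds by definition of the
      negative part; at \<open>p u\<close>, the only other neighbour, it is the sign of the boundary
      value.\<close>
    have "- (y a * y b) \<le> y a * z b"
    proof (cases "a \<in> sub u")
      case True
      then have "b \<in> sub u \<or> 0 \<le> z b" using sub_arc[OF u(1)] e ab zu by blast
      then have "- y b \<le> z b" by (auto simp: y_def)
      moreover have "0 \<le> y a" by (simp add: y_def)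
      ultimately have "y a * (- y b) \<le> y a * z b" by (rule mult_left_mono)
      then show ?thesis by simp
    next
      case False
      then show ?thesis by (simp add: y_def)
    qed
    then show "- (case e of (u, v) \<Rightarrow> y u * y v) \<le> (case e of (u, v) \<Rightarrow> y u * z v)" by (simp add: ab)
  qed
  ultimately have "y = (\<lambda>_. 0)" using less[OF supp] by fastforce
  then have "y v = 0" by simp
  then show ?thesis using v by (simp add: y_def max_def split: if_splits)
qed

text \<open>With nonnegativity known, \<open>c * z w\<close> is at least the value at the parent of
  \<open>w\<close>, so strict positivity descends from \<open>p u\<close>.\<close>

lemma sub_eigenvector_pos:
  assumes u: "u \<in> V" "u \<noteq> r" and z: "\<And>v. v \<in> sub u \<Longrightarrow> adj_app E z v = c * z v" and zu: "0 < z (p u)"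
    and less: "\<And>y. supp_in (sub u) y \<Longrightarrow> y \<noteq> (\<lambda>_. 0) \<Longrightarrow> qform E y < c * sqn V y"
    and c: "0 < c" and v: "v \<in> sub u"
  shows "0 < z v"
proof -
  have nn: "0 \<le> z w" if "w \<in> sub u" for w
    using sub_eigenvector_nonneg[OF u z less_imp_le[OF zu] less] that by blast
  have pos: "0 < z w" if "w \<in> sub u" "w \<noteq> r" "0 < z (p w)" for w
  proof -
    have w: "w \<in> V" using that sub_subset by blast
    have "0 \<le> (\<Sum>v\<in>ch w. z v)"
    proof (intro sum_nonneg nn)
      fix v assume "v \<in> ch w"
      then have v: "v \<in> V" "v \<noteq> r" "p v = w" by (auto simp: ch_iff)
      moreover have "v \<noteq> u" using v sub_depth[OF that(1)] dep[of v] by auto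
      ultimately show "v \<in> sub u" using that(1) sub_step by blast
    qed
    then have "0 < c * z w" using z[OF that(1)] adj_app_parent[OF w, of z] that(2,3) by simp
    then show ?thesis using c by (simp add: zero_less_mult_iff)
  qed
  show ?thesis using u(1) v
  proof (induction rule: sub_induct)
    case self
    then show ?case using pos[OF sub_self] u zu by blast
  next
    case (step v)
    then show ?case using pos by blast
  qed
qed

end

section \<open>Paths\<close>

lemma parcs_path_graph: "parcs (path_graph m) = {(i, j). i < m \<and> j < m \<and> (j = Suc i \<or> i = Suc j)}"
  by (auto simp: path_graph_def path_along_def)

lemma pverts_path_graph [simp]: "pverts (path_graph m) = {..<m}"
  by (simp add: path_graph_def path_along_def)

definition path_parent :: "nat \<Rightarrow> nat" where
  "path_parent i = i - 1"

lemma path_parent_Suc [simp]: "path_parent (Suc i) = i"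
  by (simp add: path_parent_def)

text \<open>Rooting the path at its end 0 makes the positivity results for subtrees available for
  its Perron vector.\<close>

lemma path_graph_rooted:
  assumes "0 < m"
  shows "rooted_tree {..<m} 0 path_parent (\<lambda>i. i)" "path_graph m = parent_graph {..<m} 0 path_parent"
proof -
  show "rooted_tree {..<m} 0 path_parent (\<lambda>i. i)" using assms by unfold_locales (auto simp: path_parent_def)
  have "parcs (path_graph m) = parent_arcs {..<m} 0 path_parent"
  proof (intro equalityI subsetI)
    fix e assume "e \<in> parcs (path_graph m)"
    then obtain i j where e: "e = (i, j)" "i < m" "j < m" "j = Suc i \<or> i = Suc j"
      by (auto simp: parcs_path_graph)
    then show "e \<in> parent_arcs {..<m} 0 path_parent"
      unfolding parent_arcs_def by (auto simp: image_iff path_parent_def)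
  qed (auto simp: parent_arcs_def parcs_path_graph path_parent_def)
  then show "path_graph m = parent_graph {..<m} 0 path_parent"
    by (simp add: parent_graph_def)
qed

lemma pair_graph_path_graph: "pair_graph (path_graph m)"
  by (auto simp: pair_graph_iff parcs_path_graph sym_def irrefl_def)

lemma qform_path_graph: "qform (parcs (path_graph (Suc j))) y = 2 * (\<Sum>i<j. y i * y (Suc i))"
proof -
  interpret rooted_tree "{..<Suc j}" 0 path_parent "\<lambda>i. i" using path_graph_rooted by simp
  have "qform (parcs (path_graph (Suc j))) y = 2 * (\<Sum>v\<in>{..<Suc j} - {0}. y v * y (v - 1))"
    using qform_parent path_graph_rooted(2)[of "Suc j"] by (simp add: path_parent_def)
  also have "(\<Sum>v\<in>{..<Suc j} - {0}. y v * y (v - 1)) = (\<Sum>i<j. y (Suc i) * y i)"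
    by (rule sum.reindex_bij_witness[of _ Suc "\<lambda>v. v - 1"]) auto
  finally show ?thesis by (simp add: mult.commute)
qed

text \<open>The Perron vector with its three-term recursion. At the far end the term
  \<open>y (Suc i)\<close> vanishes through the support condition, at 0 the missing neighbour needs
  the case distinction.\<close>

lemma path_graph_eigenvector:
  assumes "0 < m"
  shows "\<exists>y. supp_in {..<m} y \<and> (\<forall>i<m. 0 < y i) \<and>
    (\<forall>i<m. (if i = 0 then 0 else y (i - 1)) + y (Suc i) = eig 1 (path_graph m) * y i)"
proof -
  interpret rooted_tree "{..<m}" 0 path_parent "\<lambda>i. i" using path_graph_rooted assms by simp
  have G: "path_graph m = G" using path_graph_rooted(2) assms by simp
  let ?c = "eig 1 (path_graph m)"
  have ne: "pverts (path_graph m) \<noteq> {}" using assms by auto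
  obtain x where x: "supp_in {..<m} x" "sqn {..<m} x = 1" "\<And>v. v<m \<Longrightarrow> adj_app E x v = ?c * x v"
    using eig1_eigenvector[OF pair_graph_path_graph ne] by (auto simp: G)
  define y where "y v = \<bar>x v\<bar>" for v
  have y: "supp_in {..<m} y" "sqn {..<m} y = 1" using x(1,2) by (auto simp: supp_in_def y_def sqn_def)
  have "qform E x = ?c * sqn {..<m} x" using x(3) by (intro qform_eigenvector[OF fin E_sub]) auto
  then have qy: "?c * sqn {..<m} y \<le> qform E y"
    using qform_abs_ge[of E x] x(2) y(2) unfolding y_def by simp
  have max: "qform E z \<le> ?c * sqn {..<m} z" if "supp_in {..<m} z" for z
    using qform_le_eig1[OF pair_graph_path_graph, of m z] that by (simp add: G)
  have "v \<in> sub 0" if "v < m" for v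
    using that
  proof (induction v)
    case (Suc v)
    then show ?case using sub_step[of "Suc v" 0] by simp
  qed (use sub_self root in simp)
  then have sub0: "sub 0 = {..<m}" using sub_subset[of 0] by auto
  have y0: "y \<noteq> (\<lambda>_. 0)" using y(2) by (auto simp: sqn_def)
  have pos: "0 < y v" if "v < m" for v
    using sub_maximiser_pos[OF root(1) _ y0 _ qy, of v] sub0 max y(1) that unfolding y_def by simp
  have "adj_app E y v = ?c * y v" if "v < m" for v
  proof -
    define e where "e z = (if z = v then 1 else 0 :: real)" for z
    have "bform E e y = ?c * (\<Sum>v<m. e v * y v)"
    proof (rule rayleigh_critical[OF E_sym])
      show "qform E y = ?c * sqn {..<m} y" using qy max[OF y(1)] by simp
      show "qform E (\<lambda>v. y v + t * e v) \<le> ?c * sqn {..<m} (\<lambda>v. y v + t * e v)" for t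
        using that y(1) by (intro max) (auto simp: supp_in_def e_def)
    qed
    moreover have "bform E e y = (\<Sum>w<m. if w = v then adj_app E y w else 0)"
      unfolding bform_adj_app[OF fin E_sub] by (intro sum.cong) (auto simp: e_def)
    moreover have "(\<Sum>w<m. e w * y w) = (\<Sum>w<m. if w = v then y w else 0)"
      by (intro sum.cong) (auto simp: e_def)
    ultimately show ?thesis using that by simp
  qed
  moreover have "adj_app E y v = (if v = 0 then 0 else y (v - 1)) + y (Suc v)" if "v < m" for v
  proof -
    have "ch v = (if Suc v < m then {Suc v} else {})" by (auto simp: ch_iff path_parent_def)
    then show ?thesis using adj_app_parent[of v y] that y(1) by (auto simp: supp_in_def path_parent_def)
  qed
  ultimately show ?thesis using y(1) pos by (intro exI[of _ y]) simp
qed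

text \<open>The coefficient \<open>g v\<close> that leaf-to-root elimination assigns to the top vertex of a hanging path with
  \<open>j + 1\<close> vertices.\<close>

fun chain_coeff :: "real \<Rightarrow> nat \<Rightarrow> real" where
  "chain_coeff c 0 = 1 / c"
| "chain_coeff c (Suc j) = 1 / (c - chain_coeff c j)"

text \<open>Completing squares from vertex 0 onwards leaves a multiple of the last square. Demanding
  positivity of all coefficients says that the elimination never breaks down.\<close>

lemma chain_coeff_form:
  assumes "\<And>i. i \<le> j \<Longrightarrow> 0 < chain_coeff c i"
  shows "1 / chain_coeff c j * (y j)\<^sup>2 \<le> c * (\<Sum>i\<le>j. (y i)\<^sup>2) - 2 * (\<Sum>i<j. y i * y (Suc i))"
  using assms
proof (induction j)
  case 0
  then show ?case by simp
next
  case (Suc j)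
  let ?f = "chain_coeff c j"
  have f: "0 < ?f" using Suc.prems[of j] by simp
  have "0 \<le> 1 / ?f * (y j - ?f * y (Suc j))\<^sup>2" using f by simp
  also have "\<dots> = 1 / ?f * (y j)\<^sup>2 - 2 * (y j * y (Suc j)) + ?f * (y (Suc j))\<^sup>2"
    using f by (simp add: power2_eq_square field_simps)
  finally have "2 * (y j * y (Suc j)) - ?f * (y (Suc j))\<^sup>2 \<le> 1 / ?f * (y j)\<^sup>2" by simp
  moreover have "1 / ?f * (y j)\<^sup>2 \<le> c * (\<Sum>i\<le>j. (y i)\<^sup>2) - 2 * (\<Sum>i<j. y i * y (Suc i))"
    using Suc by simp
  ultimately show ?case
    by (simp add: distrib_left left_diff_distrib)
qed

lemma sqn_lessThan_Suc: "sqn {..<Suc j} y = (\<Sum>i\<le>j. (y i)\<^sup>2)"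
  by (simp add: sqn_def lessThan_Suc_atMost)

text \<open>Positive coefficients up to \<open>j\<close> make the form of c minus the adjacency
  matrix positive definite on \<open>j + 1\<close> vertices; evaluated at the Perron vector this is
  the strict inequality.\<close>

lemma eig1_path_less:
  assumes "\<And>i. i \<le> j \<Longrightarrow> 0 < chain_coeff c i"
  shows "eig 1 (path_graph (Suc j)) < c"
proof -
  let ?L = "eig 1 (path_graph (Suc j))"
  obtain y where y: "supp_in {..<Suc j} y" "\<And>i. i < Suc j \<Longrightarrow> 0 < y i"
    "\<And>i. i < Suc j \<Longrightarrow> (if i = 0 then 0 else y (i - 1)) + y (Suc i) = ?L * y i"
    using path_graph_eigenvector[OF zero_less_Suc[of j]] by blast
  have "?L * sqn {..<Suc j} y = (\<Sum>i<Suc j. y i * ((if i = 0 then 0 else y (i - 1)) + y (Suc i)))"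
    unfolding sqn_def sum_distrib_left using y(3) by (intro sum.cong) (auto simp: power2_eq_square)
  also have "\<dots> = (\<Sum>i<Suc j. y i * (if i = 0 then 0 else y (i - 1))) + (\<Sum>i<Suc j. y i * y (Suc i))"
    by (simp add: distrib_left sum.distrib del: sum.lessThan_Suc)
  also have "(\<Sum>i<Suc j. y i * (if i = 0 then 0 else y (i - 1))) = (\<Sum>i<j. y i * y (Suc i))"
    by (subst sum.lessThan_Suc_shift) (simp add: mult.commute)
  also have "(\<Sum>i<Suc j. y i * y (Suc i)) = (\<Sum>i<j. y i * y (Suc i))"
    using y(1) by (simp add: supp_in_def)
  finally have "?L * (\<Sum>i\<le>j. (y i)\<^sup>2) = 2 * (\<Sum>i<j. y i * y (Suc i))"
    by (simp add: sqn_lessThan_Suc)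
  moreover have "0 < 1 / chain_coeff c j * (y j)\<^sup>2" using assms[of j] y(2)[of j] by simp
  ultimately have "?L * (\<Sum>i\<le>j. (y i)\<^sup>2) < c * (\<Sum>i\<le>j. (y i)\<^sup>2)"
    using chain_coeff_form[OF assms, of j y] by simp
  then show ?thesis by (meson mult_right_mono not_less sum_nonneg zero_le_power2)
qed

text \<open>A further vertex adds the square with coefficient \<open>c - chain_coeff c j\<close>;
  when this is nonnegative, the form is still semidefinite.\<close>

lemma eig1_path_le:
  assumes "\<And>i. i \<le> j \<Longrightarrow> 0 < chain_coeff c i" "chain_coeff c j \<le> c"
  shows "eig 1 (path_graph (Suc (Suc j))) \<le> c"
proof (rule eig1_le[OF pair_graph_path_graph])
  show "pverts (path_graph (Suc (Suc j))) \<noteq> {}" by auto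
  fix y :: "nat \<Rightarrow> real"
  let ?f = "chain_coeff c j"
  have f: "0 < ?f" using assms(1)[of j] by simp
  have "0 \<le> 1 / ?f * (y j - ?f * y (Suc j))\<^sup>2 + (c - ?f) * (y (Suc j))\<^sup>2" using f assms(2) by simp
  also have "\<dots> = 1 / ?f * (y j)\<^sup>2 - 2 * (y j * y (Suc j)) + c * (y (Suc j))\<^sup>2"
    using f by (simp add: power2_eq_square field_simps)
  finally show "qform (parcs (path_graph (Suc (Suc j)))) y \<le> c * sqn (pverts (path_graph (Suc (Suc j)))) y"
    using chain_coeff_form[OF assms(1), of j y]
    unfolding qform_path_graph pverts_path_graph sqn_lessThan_Suc by (simp add: distrib_left)
qed

lemma eig1_path_less_2: "eig 1 (path_graph (Suc j)) < 2"
proof (rule eig1_path_less)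
  \<comment> \<open>At c = 2 the recursion has a closed form, which replaces the trigonometric
    formula for the eigenvalues of a path.\<close>
  have "chain_coeff 2 i = real (i + 1) / real (i + 2)" for i
  proof (induction i)
    case (Suc i)
    have "2 - real (i + 1) / real (i + 2) = real (i + 3) / real (i + 2)" by (simp add: field_simps)
    then show ?case by (simp add: Suc.IH del: of_nat_Suc)
  qed simp
  then show "0 < chain_coeff 2 i" for i by simp
qed

lemma eig1_path_nonneg:
  assumes "0 < m"
  shows "0 \<le> eig 1 (path_graph m)"
proof -
  obtain y where y: "supp_in {..<m} y" "\<And>i. i < m \<Longrightarrow> 0 < y i"
    "\<And>i. i < m \<Longrightarrow> (if i = 0 then 0 else y (i - 1)) + y (Suc i) = eig 1 (path_graph m) * y i"
    using path_graph_eigenvector[OF assms] by blast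
  have "0 \<le> y 1" using y(1) y(2)[of 1] by (cases "1 < m") (auto simp: supp_in_def less_imp_le)
  then show ?thesis using y(3)[of 0] y(2)[of 0] assms by (simp add: zero_le_mult_iff)
qed

lemma eig1_path_pos:
  assumes "2 \<le> m"
  shows "0 < eig 1 (path_graph m)"
proof -
  obtain y where y: "supp_in {..<m} y" "\<And>i. i < m \<Longrightarrow> 0 < y i"
    "\<And>i. i < m \<Longrightarrow> (if i = 0 then 0 else y (i - 1)) + y (Suc i) = eig 1 (path_graph m) * y i"
    using path_graph_eigenvector[of m] assms by fastforce
  have "0 < y 1" using y(2)[of 1] assms by simp
  then show ?thesis using y(3)[of 0] y(2)[of 0] assms by (simp add: zero_less_mult_iff)
qed

section \<open>Monotonicity and merging of chain coefficients\<close>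

lemma chain_coeff_mono:
  assumes "\<And>i. i \<le> Suc j \<Longrightarrow> 0 < chain_coeff c i"
  shows "chain_coeff c j \<le> chain_coeff c (Suc j)"
  using assms
proof (induction j)
  case 0
  from 0[of 0] have c: "c > 0" by simp
  from 0[of 1] have "c - 1 / c > 0" by simp
  then show ?case using c by (simp add: frac_le)
next
  case (Suc j)
  then have le: "chain_coeff c j \<le> chain_coeff c (Suc j)" by simp
  have "0 < chain_coeff c (Suc (Suc j))" using Suc.prems by blast
  then have "c - chain_coeff c (Suc j) > 0" by (simp del: chain_coeff.simps(2) add: chain_coeff.simps(2)[of c "Suc j"])
  then have "1 / (c - chain_coeff c j) \<le> 1 / (c - chain_coeff c (Suc j))" using le by (intro frac_le) auto
  then show ?case by (simp only: chain_coeff.simps(2))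
qed

lemma chain_coeff_mono_le:
  assumes "\<And>i. i \<le> n \<Longrightarrow> 0 < chain_coeff c i" "m \<le> n"
  shows "chain_coeff c m \<le> chain_coeff c n"
  using assms(2,1)
proof (induction n rule: dec_induct)
  case (step k)
  then have "chain_coeff c m \<le> chain_coeff c k" by simp
  also have "\<dots> \<le> chain_coeff c (Suc k)" using step.prems by (intro chain_coeff_mono) auto
  finally show ?case .
qed simp

declare chain_coeff.simps(2) [simp del]

text \<open>For A = c - a and B = c - b, with a and b the coefficients of two chains, the left side
  is the loss in the sum of two coefficients when one vertex moves from the chain above b to the one
  of a. The factorisation displays its sign.\<close>

lemma merge_identity:
  fixes A B :: real
  assumes "A > 0" "B > 0"
  shows "(B - A) + 1 / B - 1 / A = (B - A) * (1 - 1 / (A * B))"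
  using assms by (simp add: field_simps)

text \<open>Moves one vertex at a time from the shorter to the longer chain.\<close>

lemma chain_coeff_merge_aux:
  assumes "\<And>i. i \<le> m \<Longrightarrow> 0 < chain_coeff c i" "\<And>i. i \<le> l \<Longrightarrow> 0 < chain_coeff c i"
    and "chain_coeff c m + chain_coeff c l < c" "l \<le> m"
  shows "(\<forall>i \<le> m + l + 1. 0 < chain_coeff c i) \<and> chain_coeff c (m + l + 1) < chain_coeff c m + chain_coeff c l"
  using assms
proof (induction l arbitrary: m)
  case 0
  define a where "a = chain_coeff c m"
  have c: "c > 0" and a: "a > 0" using 0(1)[of 0] 0(1)[of m] by (auto simp: a_def)
  have ac: "1 / c < c - a" using 0(3) by (simp add: a_def)
  moreover have "0 < 1 / c" using c by simp
  ultimately have ca: "0 < c - a" by linarith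
  have "1 < (c - a) * c" using ac c by (simp add: divide_less_eq)
  \<comment> \<open>Here the shorter chain consists of one vertex, so nothing lies below it: this is
    the exchange with b = 0.\<close>
  then have "0 < (c - (c - a)) * (1 - 1 / ((c - a) * c))"
    using a by (intro mult_pos_pos) (simp_all add: divide_less_eq)
  then have "0 < (c - (c - a)) + 1 / c - 1 / (c - a)" by (simp only: merge_identity[OF ca c])
  then have less: "1 / (c - a) < a + 1 / c" by linarith
  have suc: "chain_coeff c (Suc m) = 1 / (c - a)" by (simp add: a_def chain_coeff.simps(2))
  have "0 < chain_coeff c i" if "i \<le> Suc m" for i
    using that 0(1) ca suc by (cases "i = Suc m") simp_all
  then show ?case using less suc by (simp add: a_def)
next
  case (Suc l)
  define a b where "a = chain_coeff c m" and "b = chain_coeff c l"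
  have suc_l: "chain_coeff c (Suc l) = 1 / (c - b)" and suc_m: "chain_coeff c (Suc m) = 1 / (c - a)"
    by (simp_all add: a_def b_def chain_coeff.simps(2))
  have "0 < 1 / (c - b)" using Suc.prems(2)[of "Suc l"] suc_l by simp
  then have cb: "c - b > 0" by (simp add: zero_less_divide_iff)
  have less: "1 / (c - b) < c - a" using Suc.prems(3) unfolding suc_l a_def[symmetric] by linarith
  then have ca: "c - a > 0" using \<open>0 < 1 / (c - b)\<close> by linarith
  have prod: "1 < (c - a) * (c - b)" using less cb by (simp add: divide_less_eq)
  have pos: "0 < chain_coeff c i" if "i \<le> Suc m" for i
    using that Suc.prems(1) ca suc_m by (cases "i = Suc m") simp_all
  have ab: "b \<le> a" unfolding a_def b_def using Suc.prems(1,4) by (intro chain_coeff_mono_le) auto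
  \<comment> \<open>The longer chain has the larger coefficient, so moving one vertex to it does not
    increase the sum, and the induction continues with one vertex moved.\<close>
  have "0 \<le> ((c - b) - (c - a)) * (1 - 1 / ((c - a) * (c - b)))"
    using ab prod by (intro mult_nonneg_nonneg) (simp_all add: divide_le_eq)
  then have "0 \<le> ((c - b) - (c - a)) + 1 / (c - b) - 1 / (c - a)" by (simp only: merge_identity[OF ca cb])
  then have le: "1 / (c - a) + b \<le> a + 1 / (c - b)" by linarith
  have IH: "(\<forall>i \<le> Suc m + l + 1. 0 < chain_coeff c i) \<and>
      chain_coeff c (Suc m + l + 1) < chain_coeff c (Suc m) + chain_coeff c l"
  proof (rule Suc.IH[OF pos])
    show "0 < chain_coeff c i" if "i \<le> l" for i using Suc.prems(2) that by simp
    show "chain_coeff c (Suc m) + chain_coeff c l < c"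
      using Suc.prems(3) le unfolding suc_m suc_l a_def[symmetric] b_def[symmetric] by linarith
    show "l \<le> Suc m" using Suc.prems(4) by simp
  qed
  have eq: "m + Suc l + 1 = Suc m + l + 1" by simp
  have "chain_coeff c (Suc m) + chain_coeff c l \<le> chain_coeff c m + chain_coeff c (Suc l)"
    unfolding suc_m suc_l using le by (simp add: a_def b_def)
  then have "chain_coeff c (Suc m + l + 1) < chain_coeff c m + chain_coeff c (Suc l)"
    using IH by linarith
  then show ?case unfolding eq using IH by blast
qed

text \<open>Indices are one less than numbers of vertices, hence \<open>m + l + 1\<close>. A vertex
  with two bare chains below it thus gains strictly when they are put one under the other.\<close>

lemma chain_coeff_merge:
  assumes "\<And>i. i \<le> m \<Longrightarrow> 0 < chain_coeff c i" "\<And>i. i \<le> l \<Longrightarrow> 0 < chain_coeff c i"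
    and "chain_coeff c m + chain_coeff c l < c"
  shows "\<And>i. i \<le> m + l + 1 \<Longrightarrow> 0 < chain_coeff c i"
    "chain_coeff c (m + l + 1) < chain_coeff c m + chain_coeff c l"
proof -
  have "(\<forall>i \<le> m + l + 1. 0 < chain_coeff c i) \<and> chain_coeff c (m + l + 1) < chain_coeff c m + chain_coeff c l"
  proof (cases "l \<le> m")
    case True
    show ?thesis by (rule chain_coeff_merge_aux[OF assms True])
  next
    case False
    have "chain_coeff c l + chain_coeff c m < c" using assms(3) by linarith
    from chain_coeff_merge_aux[OF assms(2,1) this] False show ?thesis
      unfolding add.commute[of l m] add.commute[of "chain_coeff c l"] by simp
  qed
  then show "\<And>i. i \<le> m + l + 1 \<Longrightarrow> 0 < chain_coeff c i"
    "chain_coeff c (m + l + 1) < chain_coeff c m + chain_coeff c l" by auto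
qed

section \<open>Paths embedded in a graph\<close>

lemma qform_chain:
  assumes "finite V" "E \<subseteq> V \<times> V" "inj_on e {..<m}" "supp_in (e ` {..<m}) x"
    and "E \<inter> (e ` {..<m} \<times> e ` {..<m}) = map_prod e e ` parcs (path_graph m)"
  shows "qform E x = qform (parcs (path_graph m)) (x \<circ> e)"
proof -
  have "qform E x = (\<Sum>(u, v)\<in>E \<inter> (e ` {..<m} \<times> e ` {..<m}). x u * x v)"
    unfolding bform_def using assms(1,2,4)
    by (intro sum.mono_neutral_right) (auto simp: supp_in_def intro: finite_subset)
  also have "\<dots> = qform (parcs (path_graph m)) (x \<circ> e)"
    unfolding assms(5) bform_def
    by (subst sum.reindex) (use assms(3) in \<open>auto simp: inj_on_def parcs_path_graph case_prod_unfold\<close>)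
  finally show ?thesis .
qed

lemma sqn_chain:
  assumes "finite V" "e ` {..<m} \<subseteq> V" "inj_on e {..<m}" "supp_in (e ` {..<m}) x"
  shows "sqn V x = sqn {..<m} (x \<circ> e)"
proof -
  have "sqn V x = (\<Sum>v\<in>e ` {..<m}. (x v)\<^sup>2)"
    unfolding sqn_def using assms(1,2,4) by (intro sum.mono_neutral_right) (auto simp: supp_in_def)
  also have "\<dots> = sqn {..<m} (x \<circ> e)"
    unfolding sqn_def by (subst sum.reindex[OF assms(3)]) simp
  finally show ?thesis .
qed

lemma qform_chain_le:
  assumes "finite V" "E \<subseteq> V \<times> V" "inj_on e {..<m}" "supp_in (e ` {..<m}) x" "e ` {..<m} \<subseteq> V"
    and "E \<inter> (e ` {..<m} \<times> e ` {..<m}) = map_prod e e ` parcs (path_graph m)" "0 < m"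
  shows "qform E x \<le> eig 1 (path_graph m) * sqn V x"
proof -
  \<comment> \<open>The pulled back vector is cut off beyond the path, where the values of
    \<open>e\<close> are not controlled.\<close>
  define y where "y i = (if i < m then x (e i) else 0)" for i
  have "qform (parcs (path_graph m)) y = qform (parcs (path_graph m)) (x \<circ> e)"
    unfolding bform_def by (intro sum.cong) (auto simp: y_def parcs_path_graph)
  moreover have "sqn {..<m} y = sqn {..<m} (x \<circ> e)" by (simp add: sqn_def y_def)
  moreover have "qform (parcs (path_graph m)) y \<le> eig 1 (path_graph m) * sqn {..<m} y"
    using qform_le_eig1[OF pair_graph_path_graph, of m y] by (simp add: supp_in_def y_def)
  ultimately show ?thesis using qform_chain[OF assms(1-4,6)] sqn_chain[OF assms(1,5,3,4)] by simp
qed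

text \<open>The Perron vector of a path is transplanted along \<open>e\<close>. Being nonnegative,
  it can only gain from arcs of \<open>E\<close> beyond those of the path, so the path need not be
  induced.\<close>

lemma chain_vector:
  assumes E: "finite V" "E \<subseteq> V \<times> V" "sym E" and e: "inj_on e {..<m}" "e ` {..<m} \<subseteq> V" "0 < m"
    and arcs: "\<And>i. Suc i < m \<Longrightarrow> (e i, e (Suc i)) \<in> E"
  shows "\<exists>x. supp_in (e ` {..<m}) x \<and> (\<forall>i<m. 0 < x (e i)) \<and> (\<forall>v. 0 \<le> x v) \<and>
    eig 1 (path_graph m) * sqn V x \<le> qform E x \<and> 0 < sqn V x"
proof -
  obtain y where y: "supp_in {..<m} y" "\<And>i. i < m \<Longrightarrow> 0 < y i"
    "\<And>i. i < m \<Longrightarrow> (if i = 0 then 0 else y (i - 1)) + y (Suc i) = eig 1 (path_graph m) * y i"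
    using path_graph_eigenvector[OF e(3)] by blast
  define x where "x v = (if v \<in> e ` {..<m} then y (the_inv_into {..<m} e v) else 0)" for v
  have xe: "x (e i) = y i" if "i < m" for i
    using that e(1) by (simp add: x_def the_inv_into_f_f)
  have supp: "supp_in (e ` {..<m}) x" by (simp add: supp_in_def x_def)
  have nn: "0 \<le> x v" for v
    using xe y(2) supp by (cases "v \<in> e ` {..<m}") (auto simp: supp_in_def less_imp_le)
  have "eig 1 (path_graph m) * sqn V x = eig 1 (path_graph m) * sqn {..<m} y"
    using sqn_chain[OF E(1) e(2,1) supp] xe by (simp add: sqn_def)
  also have "\<dots> = qform (parcs (path_graph m)) y"
  proof (rule qform_eigenvector[symmetric])
    show "adj_app (parcs (path_graph m)) y i = eig 1 (path_graph m) * y i" if "i \<in> {..<m}" for i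
    proof -
      have "parcs (path_graph m) `` {i} = (if i = 0 then {} else {i - 1}) \<union> (if Suc i < m then {Suc i} else {})"
        using that by (auto simp: parcs_path_graph)
      then show ?thesis using y(1) y(3)[of i] that
        by (auto simp: adj_app_def supp_in_def)
    qed
  qed (auto simp: parcs_path_graph)
  also have "\<dots> = (\<Sum>(u, v)\<in>map_prod e e ` parcs (path_graph m). x u * x v)"
    unfolding bform_def
    by (subst sum.reindex) (use e(1) in \<open>auto simp: inj_on_def parcs_path_graph case_prod_unfold xe\<close>)
  also have "\<dots> \<le> qform E x"
  proof -
    have "map_prod e e ` parcs (path_graph m) \<subseteq> E"
      using arcs E(3) by (auto simp: parcs_path_graph sym_def)
    then show ?thesis unfolding bform_def using E(1,2) nn
      by (intro sum_mono2) (auto intro: finite_subset)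
  qed
  finally have "eig 1 (path_graph m) * sqn V x \<le> qform E x" .
  moreover have "0 < sqn V x"
  proof -
    have "(x (e 0))\<^sup>2 \<le> sqn V x" unfolding sqn_def using E(1) e(2,3) by (intro member_le_sum) auto
    moreover have "0 < x (e 0)" using xe y(2) e(3) by simp
    ultimately show ?thesis by (meson less_le_trans zero_less_power)
  qed
  ultimately show ?thesis using supp xe y(2) nn by (intro exI[of _ x]) simp
qed

text \<open>The hyperplane of vectors vanishing at \<open>r\<close> is the one to test: on it the
  form splits over the pieces left after deleting \<open>r\<close>.\<close>

lemma eig2_le_blocks:
  assumes G: "pair_graph G" "2 \<le> card (pverts G)" and r: "r \<in> pverts G"
    and D: "finite \<D>" "\<Union>\<D> = pverts G - {r}" "pairwise disjnt \<D>"
    and arcs: "\<And>u v. (u, v) \<in> parcs G \<Longrightarrow> u \<noteq> r \<Longrightarrow> v \<noteq> r \<Longrightarrow> \<exists>D\<in>\<D>. u \<in> D \<and> v \<in> D"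
    and le: "\<And>D y. D \<in> \<D> \<Longrightarrow> supp_in D y \<Longrightarrow> qform (parcs G) y \<le> c * sqn (pverts G) y"
  shows "eig 2 G \<le> c"
proof -
  have main: "qform (parcs G) z \<le> c * sqn (pverts G) z" if z: "supp_in (pverts G) z" "z r = 0" for z
  proof -
    have supp: "supp_in (\<Union>\<D>) z" unfolding D(2) using z by (auto simp: supp_in_def)
    have fin: "finite (pverts G)" using G(1) by (simp add: pair_graph_iff)
    have sub: "\<Union>\<D> \<subseteq> pverts G" unfolding D(2) by blast
    have arcs': "\<exists>D\<in>\<D>. u \<in> D \<and> v \<in> D" if "(u, v) \<in> parcs G" "u \<in> \<Union>\<D>" "v \<in> \<Union>\<D>" for u v
    proof -
      have "u \<noteq> r" "v \<noteq> r" using that(2,3) unfolding D(2) by auto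
      then show ?thesis by (rule arcs[OF that(1)])
    qed
    show "qform (parcs G) z \<le> c * sqn (pverts G) z"
      by (rule qform_block_le[OF fin D(1) sub D(3) supp arcs' le])
  qed
  show ?thesis
    by (rule eig2_le[OF G, where l = "\<lambda>x. x r"]) (simp_all add: main)
qed

section \<open>Trees, distances and diameter\<close>

lemma pcas_nth:
  assumes "pcas u q v" "Suc i < length q"
  shows "fst (q ! Suc i) = snd (q ! i)"
  using assms
proof (induction q arbitrary: u i)
  case (Cons e q)
  then show ?case by (cases i; cases q) auto
qed simp

lemma pcas_hd_last:
  assumes "pcas u q v" "q \<noteq> []"
  shows "fst (q ! 0) = u" "snd (q ! (length q - 1)) = v"
proof -
  show "fst (q ! 0) = u" using assms by (cases q) auto
  show "snd (q ! (length q - 1)) = v"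
    using assms
  proof (induction q arbitrary: u)
    case (Cons e q)
    then show ?case by (cases q) auto
  qed simp
qed

lemma pawalk_verts_tl: "pcas u q v \<Longrightarrow> tl (pawalk_verts u q) = map snd q"
proof (induction q arbitrary: u)
  case (Cons e q)
  then show ?case by (cases q) auto
qed simp

lemma pawalk_verts_nth:
  assumes "pcas u q v" "i < length q"
  shows "pawalk_verts u q ! i = fst (q ! i)" "pawalk_verts u q ! Suc i = snd (q ! i)"
proof -
  show "pawalk_verts u q ! i = fst (q ! i)"
    using assms
  proof (induction q arbitrary: u i)
    case (Cons e q)
    then show ?case by (cases i) auto
  qed simp
  have "length (pawalk_verts u q) = Suc (length q)" by (induction q arbitrary: u) auto
  then have "pawalk_verts u q ! Suc i = tl (pawalk_verts u q) ! i" using assms(2) by (simp add: nth_tl)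
  then show "pawalk_verts u q ! Suc i = snd (q ! i)" using pawalk_verts_tl[OF assms(1)] assms(2) by simp
qed

context rooted_tree
begin

lemma root_relpow: "v \<in> V \<Longrightarrow> (r, v) \<in> E ^^ h v"
proof (induction "h v" arbitrary: v)
  case 0
  then have "v = r" using dep by fastforce
  then show ?case using root by simp
next
  case (Suc n)
  then have "v \<noteq> r" using root by auto
  then have v: "p v \<in> V" "h (p v) = n" "(p v, v) \<in> E" using Suc.prems Suc.hyps(2) par dep by (auto simp: arcs_iff)
  then have "(r, p v) \<in> E ^^ n" using Suc.hyps(1) by blast
  then have "(r, v) \<in> E ^^ Suc n" using v(3) by (auto simp: relpow.simps)
  then show ?case using Suc.hyps(2) by simp
qed

lemma ancestor_relpow: "u \<in> V \<Longrightarrow> v \<in> sub u \<Longrightarrow> (u, v) \<in> E ^^ (h v - h u)"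
proof (induction rule: sub_induct)
  case (step v)
  then have "(p v, v) \<in> E" by (simp add: arcs_iff)
  moreover have "h v - h u = Suc (h (p v) - h u)" using dep[OF step(1,2)] sub_depth[OF step(5)] by simp
  ultimately show ?case using step(6) by (auto simp: relpow.simps)
qed simp

lemma connected_G: "Digraph_Component.connected (with_proj G)"
proof -
  interpret GG: pair_graph G by (rule pair_graph_G)
  have reach: "r \<rightarrow>\<^sup>*\<^bsub>with_proj G\<^esub> v" if "v \<in> V" for v
  proof -
    have "(r, v) \<in> E\<^sup>*" using root_relpow[OF that] by (rule relpow_imp_rtrancl)
    then show ?thesis using GG.reachable_conv'[of r v] root by simp
  qed
  have "strongly_connected (with_proj G)"
    unfolding strongly_connected_def
  proof (intro conjI ballI)
    show "verts (with_proj G) \<noteq> {}" using root by auto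
    fix u v assume "u \<in> verts (with_proj G)" "v \<in> verts (with_proj G)"
    then show "u \<rightarrow>\<^sup>*\<^bsub>with_proj G\<^esub> v"
      using reach[of u] reach[of v] GG.symmetric_reachable' GG.reachable_trans by (metis parent_graph_simps(1) with_proj_simps(1))
  qed
  moreover have "(arcs_ends (with_proj G))\<^sup>s = arcs_ends (with_proj G)"
    using E_sym by (auto simp: symcl_def sym_def)
  ultimately show ?thesis
    unfolding connected_conv strongly_connected_def reachable_def by simp
qed

text \<open>At a deepest vertex of a cycle both neighbours on the cycle must be its parent, so they
  coincide.\<close>

lemma no_cycle:
  assumes q: "pcas u q u" "set q \<subseteq> E" "distinct (map snd q)" "3 \<le> length q"
  shows False
proof -
  let ?n = "length q"
  have ne: "q \<noteq> []" using q(4) by auto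
  obtain i where i: "i < ?n" "\<And>j. j < ?n \<Longrightarrow> h (snd (q ! j)) \<le> h (snd (q ! i))"
  proof -
    have "finite {..<?n}" "{..<?n} \<noteq> {}" using ne by auto
    from obtains_MAX[OF this, of "\<lambda>j. h (snd (q ! j))"] obtain i where
      "i \<in> {..<?n}" "h (snd (q ! i)) = Max ((\<lambda>j. h (snd (q ! j))) ` {..<?n})" by metis
    then show ?thesis using that[of i] by auto
  qed
  \<comment> \<open>\<open>k\<close> and \<open>j\<close> are the cyclic predecessor and successor
    of \<open>i\<close>; they differ because the length is at least 3.\<close>
  define k where "k = (if i = 0 then ?n - 1 else i - 1)"
  define j where "j = (if i = ?n - 1 then 0 else Suc i)"
  have k: "k < ?n" "fst (q ! i) = snd (q ! k)"
    using i pcas_nth[OF q(1), of "i - 1"] pcas_hd_last[OF q(1) ne] by (auto simp: k_def)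
  have j: "j < ?n" "fst (q ! j) = snd (q ! i)"
    using i ne pcas_nth[OF q(1), of i] pcas_hd_last[OF q(1) ne] by (auto simp: j_def)
  have kj: "k \<noteq> j" using i q(4) by (auto simp: k_def j_def split: if_splits)
  let ?x = "snd (q ! i)"
  have "(fst (q ! i), ?x) \<in> E" using q(2) i(1) nth_mem by (metis prod.collapse subset_iff)
  then have 1: "snd (q ! k) = p ?x"
    using i(2)[OF k(1)] dep k(2) by (fastforce simp: arcs_iff)
  have "(fst (q ! j), snd (q ! j)) \<in> E" using q(2) j(1) nth_mem by (metis prod.collapse subset_iff)
  then have 2: "snd (q ! j) = p ?x"
    using i(2)[OF j(1)] dep j(2) by (fastforce simp: arcs_iff)
  have "map snd q ! k = map snd q ! j" using 1 2 k(1) j(1) by simp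
  then show False using q(3) kj k(1) j(1) using nth_eq_iff_index_eq[OF q(3), of k j] by simp
qed

lemma is_tree_G: "is_tree G"
proof -
  interpret GG: pair_graph G by (rule pair_graph_G)
  have "\<not> (GG.cycle q \<and> 3 \<le> length q)" for q
  proof
    assume q: "GG.cycle q \<and> 3 \<le> length q"
    then obtain u where u: "GG.awalk u q u" "distinct (tl (GG.awalk_verts u q))"
      by (auto simp: GG.cycle_def)
    have c: "pcas u q u" "set q \<subseteq> E" using u(1) by (auto simp: GG.awalk_def)
    have "distinct (map snd q)" using u(2) pawalk_verts_tl[OF c(1)] by simp
    then show False using no_cycle c q by blast
  qed
  then show ?thesis unfolding is_tree_def using pair_graph_G connected_G by blast
qed

end

text \<open>The depth is the distance from \<open>r\<close> and a parent is any neighbour one step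
  closer. An arc outside the resulting parent graph would close a cycle with the path that joins its
  ends there.\<close>

lemma is_tree_rooted:
  assumes T: "is_tree T" and r: "r \<in> pverts T"
  obtains p h where "rooted_tree (pverts T) r p h" "T = parent_graph (pverts T) r p"
proof -
  interpret T: pair_graph T using T by (simp add: is_tree_def)
  let ?V = "pverts T" and ?R = "parcs T"
  have TR: "finite ?V" "?R \<subseteq> ?V \<times> ?V" "sym ?R" "irrefl ?R"
    using T.pair_graph by (auto simp: pair_graph_iff)
  have sc: "strongly_connected (with_proj T)"
    using T.symmetric_connected_imp_strongly_connected T T.sym_arcs by (auto simp: is_tree_def)
  have reach: "\<exists>n. (r, v) \<in> ?R ^^ n" if "v \<in> ?V" for v
  proof -
    have "r \<rightarrow>\<^sup>*\<^bsub>with_proj T\<^esub> v" using sc that r by (auto simp: strongly_connected_def)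
    from reachable_rtranclI[OF this] show ?thesis by (simp add: rtrancl_power)
  qed
  define h where "h v = (LEAST n. (r, v) \<in> ?R ^^ n)" for v
  have h: "(r, v) \<in> ?R ^^ h v" if "v \<in> ?V" for v
    unfolding h_def using reach[OF that] by (rule LeastI_ex)
  have h_le: "h v \<le> n" if "(r, v) \<in> ?R ^^ n" for v n
    unfolding h_def using that by (rule Least_le)
  have ex: "\<exists>u. (u, v) \<in> ?R \<and> h v = Suc (h u)" if v: "v \<in> ?V" "v \<noteq> r" for v
  proof -
    have "h v \<noteq> 0" using h[OF v(1)] v(2) by (metis IdE pair_in_Id_conv relpow.simps(1))
    then obtain m where m: "h v = Suc m" by (cases "h v") auto
    then obtain u where u: "(r, u) \<in> ?R ^^ m" "(u, v) \<in> ?R" using h[OF v(1)] by auto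
    then have "u \<in> ?V" using TR(2) by auto
    then have "(r, v) \<in> ?R ^^ Suc (h u)" using h u(2) by auto
    then have "Suc m \<le> Suc (h u)" using h_le m by metis
    moreover have "h u \<le> m" using u(1) h_le by blast
    ultimately show ?thesis using u(2) m by auto
  qed
  define p where "p v = (SOME u. (u, v) \<in> ?R \<and> h v = Suc (h u))" for v
  have p: "(p v, v) \<in> ?R" "h v = Suc (h (p v))" if "v \<in> ?V" "v \<noteq> r" for v
    using someI_ex[OF ex[OF that]] by (auto simp: p_def)
  have "h r \<le> 0" by (rule h_le) simp
  then interpret RT: rooted_tree ?V r p h
    using TR(1,2) r p by unfold_locales auto
  interpret H: pair_graph RT.G by (rule RT.pair_graph_G)
  have sub: "RT.E \<subseteq> ?R"
    using p TR(3) unfolding parent_arcs_def sym_def by blast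
  have "?R \<subseteq> RT.E"
  proof (rule ccontr)
    assume "\<not> ?thesis"
    then obtain a b where ab: "(a, b) \<in> ?R" "(a, b) \<notin> RT.E" by auto
    have V: "a \<in> ?V" "b \<in> ?V" using ab(1) TR(2) by auto
    have "strongly_connected (with_proj RT.G)"
      using H.symmetric_connected_imp_strongly_connected RT.connected_G H.sym_arcs by blast
    then have "a \<rightarrow>\<^sup>*\<^bsub>with_proj RT.G\<^esub> b" using V by (auto simp: strongly_connected_def)
    then obtain q where q: "H.apath a q b" using H.reachable_apath by blast
    have c: "pcas a q b" "set q \<subseteq> RT.E" "distinct (pawalk_verts a q)"
      using q by (auto simp: H.apath_def H.awalk_def)
    have "a \<noteq> b" using ab(1) TR(4) by (auto simp: irrefl_def)
    \<comment> \<open>A joining path with a single arc would be the supposedly missing arc, so the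
      closed walk below has length at least 3.\<close>
    have len: "2 \<le> length q"
    proof (rule ccontr)
      assume "\<not> ?thesis"
      then consider "q = []" | e where "q = [e]"
        by (cases q; cases "tl q") auto
      then show False
      proof cases
        case 1
        then show ?thesis using c(1) \<open>a \<noteq> b\<close> by simp
      next
        case 2
        then show ?thesis using c(1,2) ab(2) by (cases e) auto
      qed
    qed
    have "(b, a) \<in> ?R" using ab(1) TR(3) by (auto simp: sym_def)
    then have "T.awalk b ((b, a) # q) b" using c(1,2) sub V by (auto simp: T.awalk_def)
    moreover have "distinct (tl (T.awalk_verts b ((b, a) # q)))" using c(3) by simp
    ultimately have "T.cycle ((b, a) # q)" by (auto simp: T.cycle_def)
    moreover have "3 \<le> length ((b, a) # q)" using len by simp
    ultimately show False using T unfolding is_tree_def by blast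
  qed
  then have "?R = RT.E" using sub by blast
  then have "T = parent_graph ?V r p" by (simp add: parent_graph_def)
  then show ?thesis using that RT.rooted_tree_axioms by blast
qed

section \<open>Distances and diameter\<close>

lemma \<mu>_le_relpow:
  assumes G: "pair_graph G" and uv: "(u, v) \<in> parcs G ^^ n" "u \<in> pverts G"
  shows "wf_digraph.\<mu> (with_proj G) (\<lambda>_. 1) u v \<le> ereal (real n)"
proof -
  interpret pair_graph G by (rule G)
  have "\<exists>q. awalk u q v \<and> length q = n"
    using uv
  proof (induction n arbitrary: v)
    case 0
    then show ?case by (intro exI[of _ "[]"]) (auto simp: awalk_Nil_iff)
  next
    case (Suc n)
    then obtain w where w: "(u, w) \<in> parcs G ^^ n" "(w, v) \<in> parcs G" by auto
    with Suc obtain q where q: "awalk u q w" "length q = n" by blast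
    have "awalk w [(w, v)] v" using w(2) in_arcsD1[OF w(2)] by (simp add: awalk_def)
    with q have "awalk u (q @ [(w, v)]) v" by (metis awalk_appendI)
    then show ?case using q(2) by (intro exI[of _ "q @ [(w, v)]"]) simp
  qed
  then obtain q where q: "awalk u q v" "length q = n" by blast
  have "awalk_cost (\<lambda>_. 1) q = real (length q)" by (induction q) auto
  then show ?thesis using min_cost_le_walk_cost[OF q(1), of "\<lambda>_. 1"] q(2) by simp
qed

text \<open>A potential that changes by at most one along each arc cannot outrun the length of a
  walk. Integer values allow opposite signs on the two sides of an edge.\<close>

lemma lipschitz_le_\<mu>:
  assumes G: "pair_graph G" and f: "\<And>a b. (a, b) \<in> parcs G \<Longrightarrow> \<bar>f a - f b\<bar> \<le> (1 :: int)"
  shows "ereal (real_of_int (f v - f u)) \<le> wf_digraph.\<mu> (with_proj G) (\<lambda>_. 1) u v"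
proof -
  interpret pair_graph G by (rule G)
  have "f v - f u \<le> int (length q)" if "pcas u q v" "set q \<subseteq> parcs G" for q
    using that
  proof (induction q arbitrary: u)
    case (Cons e q)
    then have "f v - f (snd e) \<le> int (length q)" "fst e = u" "e \<in> parcs G" by auto
    moreover have "\<bar>f (fst e) - f (snd e)\<bar> \<le> 1" using f[of "fst e" "snd e"] \<open>e \<in> parcs G\<close> by simp
    ultimately show ?case by simp
  qed simp
  then have *: "f v - f u \<le> int (length q)" if "awalk u q v" for q
    using that by (auto simp: awalk_def)
  have cost: "awalk_cost (\<lambda>_. 1) q = real (length q)" for q :: "('a \<times> 'a) list" by (induction q) auto
  show ?thesis
    unfolding \<mu>_def
  proof (rule INF_greatest)
    fix q assume "q \<in> {q. awalk u q v}"
    then have "f v - f u \<le> int (length q)" using * by blast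
    then have "real_of_int (f v - f u) \<le> real (length q)"
      by (metis of_int_le_iff of_int_of_nat_eq)
    then show "ereal (real_of_int (f v - f u)) \<le> ereal (awalk_cost (\<lambda>_. 1) q)" by (simp add: cost)
  qed
qed

text \<open>\<open>S\<close> marks the side of the edge \<open>r s\<close> that contains
  \<open>s\<close>. Two vertices in \<open>S\<close> are joined through \<open>s\<close>, which
  saves two steps, so \<open>k2 \<le> k1 + 2\<close> keeps them within \<open>k1 + k2\<close>; all
  other pairs are joined through \<open>r\<close> with \<open>k1 \<le> k2\<close>.\<close>

lemma (in rooted_tree) graph_diameter_sides:
  assumes s: "s \<in> V" "s \<noteq> r" "p s = r"
    and S: "\<not> S r" "S s" "\<And>v. v \<in> V \<Longrightarrow> v \<noteq> r \<Longrightarrow> v \<noteq> s \<Longrightarrow> S v = S (p v)"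
    and k1: "\<And>v. v \<in> V \<Longrightarrow> \<not> S v \<Longrightarrow> h v \<le> k1"
    and k2: "\<And>v. v \<in> V \<Longrightarrow> S v \<Longrightarrow> h v \<le> k2"
    and k: "k1 \<le> k2" "k2 \<le> k1 + 2"
    and ex1: "a \<in> V" "\<not> S a" "h a = k1" and ex2: "b \<in> V" "S b" "h b = k2"
  shows "graph_diameter G = ereal (real (k1 + k2))"
proof -
  let ?d = "wf_digraph.\<mu> (with_proj G) (\<lambda>_. 1)"
  have S_sub: "v \<in> sub s" if "v \<in> V" "S v" for v
    using that
  proof (induction "h v" arbitrary: v rule: less_induct)
    case less
    show ?case
    proof (cases "v = s")
      case True
      then show ?thesis using sub_self s by simp
    next
      case False
      have "v \<noteq> r" using less.prems S by auto
      then have "S (p v)" "p v \<in> V" "h (p v) < h v"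
        using S(3)[OF less.prems(1) _ False] less.prems par dep by auto
      then have "p v \<in> sub s" using less.hyps by blast
      then show ?thesis using sub_step[OF less.prems(1) \<open>v \<noteq> r\<close> False] by blast
    qed
  qed
  have relpow_sym: "(u, v) \<in> E ^^ n \<Longrightarrow> (v, u) \<in> E ^^ n" for u v n
  proof (induction n arbitrary: v)
    case (Suc n)
    then obtain w where "(u, w) \<in> E ^^ n" "(w, v) \<in> E" by auto
    then have "(w, u) \<in> E ^^ n" "(v, w) \<in> E" using Suc.IH E_sym by (auto simp: sym_def)
    then show ?case by (meson relpow_Suc_I2)
  qed simp
  have dist: "?d u v \<le> ereal (real (h u - h w + (h v - h w)))"
    if "w \<in> V" "u \<in> sub w" "v \<in> sub w" for u v w
  proof -
    have "(u, w) \<in> E ^^ (h u - h w)" "(w, v) \<in> E ^^ (h v - h w)"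
      using relpow_sym ancestor_relpow that by blast+
    then have "(u, v) \<in> E ^^ (h u - h w + (h v - h w))"
      by (auto simp: relpow_add)
    moreover have "u \<in> V" using that(2) sub_subset by blast
    ultimately show ?thesis by (rule \<mu>_le_relpow[OF pair_graph_G, unfolded parent_graph_simps])
  qed
  have sub_r: "v \<in> sub r" if "v \<in> V" for v
    using that
  proof (induction "h v" arbitrary: v rule: less_induct)
    case less
    show ?case
    proof (cases "v = r")
      case False
      then show ?thesis using less.hyps[of "p v"] par dep less.prems sub_step[OF less.prems False False] by simp
    qed (use sub_self root in simp)
  qed
  have hs: "h s = 1" using dep[OF s(1,2)] s(3) root by simp
  have upper: "?d u v \<le> ereal (real (k1 + k2))" if uv: "u \<in> V" "v \<in> V" for u v
  proof (cases "S u \<and> S v")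
    case True
    have "h u - 1 + (h v - 1) \<le> k1 + k2" using k2[OF uv(1)] k2[OF uv(2)] True k by simp
    moreover have "?d u v \<le> ereal (real (h u - 1 + (h v - 1)))"
      using dist[OF s(1), of u v] S_sub uv True hs by simp
    ultimately show ?thesis by (meson ereal_less_eq(3) of_nat_mono order_trans)
  next
    case False
    then have "h u + h v \<le> k1 + k2"
      using k1[OF uv(1)] k2[OF uv(1)] k1[OF uv(2)] k2[OF uv(2)] k(1) by (cases "S u"; cases "S v") auto
    moreover have "?d u v \<le> ereal (real (h u + h v))"
      using dist[OF root(1), of u v] sub_r uv root by simp
    ultimately show ?thesis by (meson ereal_less_eq(3) of_nat_mono order_trans)
  qed
  \<comment> \<open>Depth with a sign for the side: a potential of slope at most one that separates
    the two extremal vertices by the full diameter.\<close>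
  define f where "f v = (if S v then int (h v) else - int (h v))" for v
  have fp: "\<bar>f v - f (p v)\<bar> \<le> 1" if v: "v \<in> V" "v \<noteq> r" for v
  proof (cases "v = s")
    case True
    then show ?thesis using s S hs root by (simp add: f_def)
  next
    case False
    then show ?thesis using S(3)[OF v False] dep[OF v] by (auto simp: f_def)
  qed
  have "\<bar>f u - f v\<bar> \<le> 1" if "(u, v) \<in> E" for u v
    using that fp[of u] fp[of v] unfolding arcs_iff by auto
  then have "ereal (real_of_int (f b - f a)) \<le> ?d a b"
    by (intro lipschitz_le_\<mu>[OF pair_graph_G]) simp
  moreover have "f b - f a = int (k1 + k2)" using ex1 ex2 by (simp add: f_def)
  ultimately have lower: "ereal (real (k1 + k2)) \<le> ?d a b" by simp
  show ?thesis
    unfolding graph_diameter_def parent_graph_simps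
  proof (rule antisym)
    show "(SUP u\<in>V. SUP v\<in>V. ?d u v) \<le> ereal (real (k1 + k2))"
      by (intro SUP_least upper)
    show "ereal (real (k1 + k2)) \<le> (SUP u\<in>V. SUP v\<in>V. ?d u v)"
      using lower ex1(1) ex2(1) by (intro SUP_upper2[of a] SUP_upper2[of b]) auto
  qed
qed

lemma diametral_path:
  assumes T: "is_tree T" and d: "graph_diameter T = ereal (real d)"
  obtains v where "inj_on v {..d}" "v ` {..d} \<subseteq> pverts T" "\<And>i. i < d \<Longrightarrow> (v i, v (Suc i)) \<in> parcs T"
proof -
  interpret T: pair_graph T using T by (simp add: is_tree_def)
  let ?V = "pverts T"
  have sc: "strongly_connected (with_proj T)"
    using T.symmetric_connected_imp_strongly_connected T T.sym_arcs by (auto simp: is_tree_def)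
  have fin: "finite ?V" "?V \<noteq> {}" using sc T.pair_finite_verts by (auto simp: strongly_connected_def)
  have attain: "\<exists>u\<in>?V. (SUP u\<in>?V. f u) = f u" for f :: "'a \<Rightarrow> ereal"
  proof -
    have "Sup (f ` ?V) = Max (f ` ?V)" using fin by (intro cSup_eq_Max) auto
    moreover have "Max (f ` ?V) \<in> f ` ?V" using fin by (intro Max_in) auto
    ultimately show ?thesis by auto
  qed
  obtain a where a: "a \<in> ?V" "(SUP v\<in>?V. T.\<mu> (\<lambda>_. 1) a v) = ereal (real d)"
    using attain[of "\<lambda>u. SUP v\<in>?V. T.\<mu> (\<lambda>_. 1) u v"] d unfolding graph_diameter_def by auto
  obtain b where b: "b \<in> ?V" "T.\<mu> (\<lambda>_. 1) a b = ereal (real d)"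
    using attain[of "\<lambda>v. T.\<mu> (\<lambda>_. 1) a v"] a(2) by auto
  have "a \<rightarrow>\<^sup>*\<^bsub>with_proj T\<^esub> b" using sc a(1) b(1) by (auto simp: strongly_connected_def)
  from T.min_cost_awalk[OF this, of "\<lambda>_. 1"] obtain q where
    q: "T.apath a q b" "T.\<mu> (\<lambda>_. 1) a b = T.awalk_cost (\<lambda>_. 1) q" by auto
  have "T.awalk_cost (\<lambda>_. 1) q = real (length q)" by (induction q) auto
  then have len: "length q = d" using q(2) b(2) by simp
  have c: "pcas a q b" "set q \<subseteq> parcs T" "distinct (pawalk_verts a q)"
    using q by (auto simp: T.apath_def T.awalk_def)
  have lenv: "length (pawalk_verts a q) = Suc d" using len T.length_awalk_verts[of a q] by simp
  show ?thesis
  proof (rule that[of "\<lambda>i. pawalk_verts a q ! i"])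
    show "inj_on (\<lambda>i. pawalk_verts a q ! i) {..d}"
      using c(3) lenv by (intro inj_on_nth) auto
    have "set (pawalk_verts a q) \<subseteq> ?V"
      using T.awalk_verts_in_verts[of a q] q(1) a(1) by (auto simp: T.apath_def T.awalk_def)
    then show "(\<lambda>i. pawalk_verts a q ! i) ` {..d} \<subseteq> ?V"
      using lenv by (auto simp: le_imp_less_Suc nth_mem subset_iff)
    show "(pawalk_verts a q ! i, pawalk_verts a q ! Suc i) \<in> parcs T" if "i < d" for i
      using pawalk_verts_nth[OF c(1), of i] that len c(2) nth_mem by (metis prod.collapse subset_iff)
  qed
qed

section \<open>Branches at a vertex and their extremality\<close>

context rooted_tree
begin

lemma E_image: "u \<in> V \<Longrightarrow> E `` {u} = (if u = r then {} else {p u}) \<union> ch u"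
  by (rule Set.set_eqI) (simp add: arcs_iff ch_iff, blast)

lemma fin_E_image [simp]: "finite (E `` {u})"
  by (rule finite_subset[of _ V]) (use E_sub fin in auto)

lemma sub_disjoint:
  assumes "u \<in> V" "w \<in> V" "h u = h w" "u \<noteq> w"
  shows "sub u \<inter> sub w = {}"
  using assms by (auto simp: sub_def)

lemma sub_child_subset:
  assumes "u \<in> V" "w \<in> ch u"
  shows "sub w \<subseteq> sub u"
proof
  fix z assume "z \<in> sub w"
  have w: "w \<in> V" "w \<noteq> r" "p w = u" using assms(2) by (auto simp: ch_iff)
  have wu: "w \<noteq> u" using par_neq[OF w(1,2)] w(3) by simp
  show "z \<in> sub u"
    using w(1) \<open>z \<in> sub w\<close>
  proof (induction rule: sub_induct)
    case self
    then show ?case using sub_step[OF w(1,2) wu] w(3) sub_self[OF assms(1)] by simp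
  next
    case (step z)
    have "z \<noteq> u" using sub_depth[OF step(4)] dep[OF w(1,2)] w(3) by auto
    then show ?case using sub_step[OF step(1,2)] step(6) by simp
  qed
qed

lemma sub_rooted: "u \<in> V \<Longrightarrow> rooted_tree (sub u) u p (\<lambda>v. h v - h u)"
proof
  assume u: "u \<in> V"
  show "finite (sub u)" using sub_subset fin by (rule finite_subset)
  show "u \<in> sub u" using u by (rule sub_self)
  fix v assume v: "v \<in> sub u" "v \<noteq> u"
  have vV: "v \<in> V" "v \<noteq> r" using v sub_subset root_sub[OF u] by auto
  show *: "p v \<in> sub u" using sub_step[OF vV v(2)] v(1) by simp
  show "h v - h u = Suc (h (p v) - h u)" using dep[OF vV] sub_depth[OF *] by simp
qed simp

lemma qform_sub_graph:
  assumes u: "u \<in> V" and y: "supp_in (sub u) y"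
  shows "qform (parent_arcs (sub u) u p) y = qform E y" "sqn (sub u) y = sqn V y"
proof -
  interpret S: rooted_tree "sub u" u p "\<lambda>v. h v - h u" by (rule sub_rooted[OF u])
  have "(\<Sum>v\<in>sub u - {u}. y v * y (p v)) = (\<Sum>v\<in>V - {r}. y v * y (p v))"
  proof (intro sum.mono_neutral_left ballI)
    show "finite (V - {r})" using fin by simp
    show "sub u - {u} \<subseteq> V - {r}" using sub_subset root_sub[OF u] by auto
    fix v assume v: "v \<in> V - {r} - (sub u - {u})"
    then have "v \<notin> sub u \<or> p v \<notin> sub u" using par_not_sub[OF u] by auto
    then show "y v * y (p v) = 0" using y by (auto simp: supp_in_def)
  qed
  then show "qform (parent_arcs (sub u) u p) y = qform E y" by (simp add: S.qform_parent qform_parent)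
  show "sqn (sub u) y = sqn V y"
    unfolding sqn_def using fin sub_subset y by (intro sum.mono_neutral_left) (auto simp: supp_in_def)
qed

lemma eig1_sub_le:
  assumes u: "u \<in> V" and le: "\<And>y. supp_in (sub u) y \<Longrightarrow> qform E y \<le> c * sqn V y"
  shows "eig 1 (parent_graph (sub u) u p) \<le> c"
proof -
  interpret S: rooted_tree "sub u" u p "\<lambda>v. h v - h u" by (rule sub_rooted[OF u])
  show ?thesis
    by (rule eig1_le[OF S.pair_graph_G]) (use S.root qform_sub_graph[OF u] le in auto)
qed

lemma sub_cover:
  assumes "v \<in> V" "v \<noteq> r"
  shows "\<exists>u\<in>ch r. v \<in> sub u"
  using assms
proof (induction "h v" arbitrary: v rule: less_induct)
  case less
  show ?case
  proof (cases "p v = r")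
    case True
    then show ?thesis using less.prems sub_self by (intro bexI[of _ v]) (auto simp: ch_iff)
  next
    case False
    then obtain u where u: "u \<in> ch r" "p v \<in> sub u"
      using less.hyps[of "p v"] less.prems par dep by auto
    have "v \<noteq> u" using par_not_sub[of u] u by (auto simp: ch_iff)
    then show ?thesis using u sub_step[OF less.prems] by blast
  qed
qed

lemma child_depth: "u \<in> ch w \<Longrightarrow> h u = Suc (h w)"
  using dep by (auto simp: ch_iff)

lemma arc_in_branch:
  assumes "(v, w) \<in> E" "v \<noteq> r" "w \<noteq> r"
  shows "\<exists>u\<in>ch r. v \<in> sub u \<and> w \<in> sub u"
proof -
  have "v \<in> V" using assms(1) E_sub by auto
  then obtain u where u: "u \<in> ch r" "v \<in> sub u" using sub_cover assms(2) by blast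
  have "u \<in> V" "p u = r" using u(1) by (auto simp: ch_iff)
  then show ?thesis using sub_arc[OF _ assms(1) u(2)] assms(3) u by auto
qed

lemma remove_root:
  "pverts (remove_vert G r) = V - {r}" "parcs (remove_vert G r) = {e \<in> E. fst e \<noteq> r \<and> snd e \<noteq> r}"
  by (simp_all add: remove_vert_def)

lemma disjoint_union_branches:
  assumes "\<And>u. u \<in> ch r \<Longrightarrow> Q (parent_graph (sub u) u p)"
  shows "disjoint_union_of Q (remove_vert G r)"
  unfolding disjoint_union_of_def
proof (intro exI[of _ "(\<lambda>u. parent_graph (sub u) u p) ` ch r"] conjI)
  let ?C = "(\<lambda>u. parent_graph (sub u) u p) ` ch r"
  show "\<forall>C\<in>?C. Q C" using assms by auto
  show "pairwise (\<lambda>C D. disjnt (pverts C) (pverts D)) ?C"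
  proof (intro pairwiseI)
    fix C D assume "C \<in> ?C" "D \<in> ?C" "C \<noteq> D"
    then obtain u w where uw: "u \<in> ch r" "w \<in> ch r" "u \<noteq> w" "C = parent_graph (sub u) u p" "D = parent_graph (sub w) w p"
      by auto
    then have "sub u \<inter> sub w = {}" using child_depth by (intro sub_disjoint) (auto simp: ch_iff)
    then show "disjnt (pverts C) (pverts D)" using uw by (simp add: disjnt_def)
  qed
  have subs: "sub u \<subseteq> V - {r}" if "u \<in> ch r" for u
    using that sub_subset root_sub[of u] by (auto simp: ch_iff)
  show "pverts (remove_vert G r) = \<Union> (pverts ` ?C)"
    unfolding remove_root using sub_cover subs by auto
  show "parcs (remove_vert G r) = \<Union> (parcs ` ?C)"
  proof (intro equalityI subsetI)
    fix e assume "e \<in> parcs (remove_vert G r)"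
    then obtain a b where ab: "e = (a, b)" "(a, b) \<in> E" "a \<noteq> r" "b \<noteq> r" by (cases e) (auto simp: remove_root)
    obtain u where u: "u \<in> ch r" "a \<in> sub u" "b \<in> sub u" using arc_in_branch[OF ab(2-4)] by blast
    have uV: "u \<in> V" "u \<noteq> r" using u(1) by (auto simp: ch_iff)
    have "(a, b) \<in> parent_arcs (sub u) u p"
      using ab(2) u(2,3) par_not_sub[OF uV] unfolding arcs_iff parent_arcs_def by auto
    then show "e \<in> \<Union> (parcs ` ?C)" using u(1) ab(1) by auto
  next
    fix e assume "e \<in> \<Union> (parcs ` ?C)"
    then obtain u where u: "u \<in> ch r" "e \<in> parent_arcs (sub u) u p" by auto
    have uV: "u \<in> V" "u \<noteq> r" using u(1) by (auto simp: ch_iff)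
    interpret S: rooted_tree "sub u" u p "\<lambda>v. h v - h u" by (rule sub_rooted[OF uV(1)])
    have "fst e \<in> sub u" "snd e \<in> sub u" using S.E_sub u(2) by auto
    moreover have "e \<in> E" using u(2) subs[OF u(1)] unfolding parent_arcs_def by auto
    ultimately show "e \<in> parcs (remove_vert G r)" using subs[OF u(1)] by (auto simp: remove_root)
  qed
qed

lemma pair_graph_remove_root: "pair_graph (remove_vert G r)"
proof -
  interpret GG: pair_graph G by (rule pair_graph_G)
  show ?thesis
    using pair_graph_G E_sub by (auto simp: pair_graph_iff remove_vert_def sym_def irrefl_def)
qed

lemma eig1_remove_root_le:
  assumes ne: "V \<noteq> {r}" and le: "\<And>u y. u \<in> ch r \<Longrightarrow> supp_in (sub u) y \<Longrightarrow> qform E y \<le> c * sqn V y"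
  shows "eig 1 (remove_vert G r) \<le> c"
proof (rule eig1_le[OF pair_graph_remove_root])
  show "pverts (remove_vert G r) \<noteq> {}" using ne root by (auto simp: remove_root)
  fix y assume y: "supp_in (pverts (remove_vert G r)) y"
  then have y: "supp_in (V - {r}) y" by (simp add: remove_root)
  have "qform (parcs (remove_vert G r)) y = qform E y"
    unfolding bform_def remove_root using fin E_sub y
    by (intro sum.mono_neutral_left) (auto simp: supp_in_def intro: finite_subset)
  moreover have "sqn (pverts (remove_vert G r)) y = sqn V y"
    unfolding sqn_def remove_root using fin y by (intro sum.mono_neutral_left) (auto simp: supp_in_def)
  moreover have "qform E y \<le> c * sqn V y"
  proof (rule qform_block_le[where \<D> = "sub ` ch r"])
    have subs: "sub u \<subseteq> V - {r}" if "u \<in> ch r" for u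
      using that sub_subset root_sub[of u] by (auto simp: ch_iff)
    have "V - {r} \<subseteq> \<Union> (sub ` ch r)" using sub_cover by blast
    then show "supp_in (\<Union> (sub ` ch r)) y" using y by (rule supp_in_mono[rotated])
    show "\<Union> (sub ` ch r) \<subseteq> V" using sub_subset by blast
    show "pairwise disjnt (sub ` ch r)"
    proof (intro pairwiseI)
      fix C D assume "C \<in> sub ` ch r" "D \<in> sub ` ch r" "C \<noteq> D"
      then obtain u w where uw: "u \<in> ch r" "w \<in> ch r" "u \<noteq> w" "C = sub u" "D = sub w" by auto
      then have "sub u \<inter> sub w = {}" using child_depth by (intro sub_disjoint) (auto simp: ch_iff)
      then show "disjnt C D" using uw by (simp add: disjnt_def)
    qed
    show "\<exists>D\<in>sub ` ch r. a \<in> D \<and> b \<in> D" if "(a, b) \<in> E" "a \<in> \<Union> (sub ` ch r)" "b \<in> \<Union> (sub ` ch r)" for a b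
    proof -
      have "a \<noteq> r" "b \<noteq> r" using that(2,3) subs by auto
      then show ?thesis using arc_in_branch[OF that(1)] by blast
    qed
    show "qform E x \<le> c * sqn V x" if "D \<in> sub ` ch r" "supp_in D x" for D x
      using that le by blast
  qed (use fin in simp_all)
  ultimately show "qform (parcs (remove_vert G r)) y \<le> c * sqn (pverts (remove_vert G r)) y" by simp
qed

text \<open>The vector \<open>x\<close> attains \<open>c\<close> away from the branch, and
  \<open>p u\<close> is adjacent to a point where it is positive. A vector on the branch that beats
  \<open>c\<close> would, together with \<open>x\<close> perturbed at \<open>p u\<close>, push the
  second eigenvalue above \<open>c\<close>.\<close>

lemma branch_qform_le:
  assumes u: "u \<in> V" "u \<noteq> r" and x: "supp_in D x" "D \<subseteq> V" "\<And>v. 0 \<le> x v" "c * sqn V x \<le> qform E x"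
    and D: "D \<inter> sub u = {}" "p u \<notin> D" and b: "b \<in> D" "(p u, b) \<in> E" "0 < x b"
    and eig: "eig 2 G \<le> c" and y: "supp_in (sub u) y"
  shows "qform E y \<le> c * sqn V y"
proof (rule ccontr)
  assume less: "\<not> ?thesis"
  have card: "2 \<le> card V"
  proof -
    have "card {r, u} \<le> card V" using fin root u by (intro card_mono) auto
    then show ?thesis using u by simp
  qed
  have cross: "bform E x y = 0"
  proof -
    have "bform E y x = 0"
      unfolding bform_def
    proof (intro sum.neutral ballI)
      fix e assume e: "e \<in> E"
      obtain a b where ab: "e = (a, b)" by (cases e)
      have "y a * x b = 0"
      proof (cases "a \<in> sub u")
        case True
        then have "b \<notin> D" using sub_arc[OF u(1), of a b] e ab D by auto
        then show ?thesis using x(1) by (simp add: supp_in_def)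
      qed (use y in \<open>simp add: supp_in_def\<close>)
      then show "(case e of (a, b) \<Rightarrow> y a * x b) = 0" by (simp add: ab)
    qed
    then show ?thesis by (simp add: bform_sym[OF E_sym, of x y])
  qed
  have "x v * y v = 0" for v using x(1) y D(1) by (cases "v \<in> D") (auto simp: supp_in_def)
  then have xy: "(\<Sum>v\<in>V. x v * y v) = 0" by (intro sum.neutral) blast
  have "x b \<le> (\<Sum>w\<in>E `` {p u}. x w)"
    using b(2) x(3) by (intro member_le_sum) auto
  then have adj: "0 < adj_app E x (p u)" using b(3) by (simp add: adj_app_def)
  have "c < eig 2 G"
  proof (rule eig2_greater_perturb[OF pair_graph_G, where x = x and y = y and a = "p u"])
    show "p u \<in> pverts G" using par u by simp
    show "supp_in (pverts G) x" using supp_in_mono[OF x(1,2)] by simp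
    show "supp_in (pverts G) y" using supp_in_mono[OF y sub_subset] by simp
    show "x (p u) = 0" using x(1) D(2) by (simp add: supp_in_def)
    show "y (p u) = 0" using y par_not_sub[OF u] by (simp add: supp_in_def)
  qed (use card xy cross x(4) less adj in simp_all)
  then show False using eig by simp
qed

text \<open>The roles are exchanged: now \<open>x\<close> beats \<open>c\<close> strictly, and a
  branch vector that merely attains \<open>c\<close> is the one to perturb. Its absolute value is
  positive at \<open>u\<close> by Perron, so \<open>p u\<close> sees it.\<close>

lemma branch_qform_less:
  assumes u: "u \<in> V" "u \<noteq> r" and x: "supp_in D x" "D \<subseteq> V" "\<And>v. 0 \<le> x v" "c * sqn V x < qform E x"
    and D: "D \<inter> sub u = {}" "p u \<notin> D" and b: "b \<in> D" "(p u, b) \<in> E" "0 < x b"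
    and eig: "eig 2 G \<le> c" and y: "supp_in (sub u) y" "y \<noteq> (\<lambda>_. 0)"
  shows "qform E y < c * sqn V y"
proof (rule ccontr)
  assume less: "\<not> ?thesis"
  have max: "qform E y' \<le> c * sqn V y'" if "supp_in (sub u) y'" for y'
    by (rule branch_qform_le[OF u x(1-3) less_imp_le[OF x(4)] D b eig that])
  define w where "w v = \<bar>y v\<bar>" for v
  have w: "supp_in (sub u) w" "w \<noteq> (\<lambda>_. 0)" "\<And>v. 0 \<le> w v" "c * sqn V w \<le> qform E w"
  proof -
    show "supp_in (sub u) w" using y(1) by (simp add: supp_in_def w_def)
    show "w \<noteq> (\<lambda>_. 0)" using y(2) by (auto simp: w_def fun_eq_iff)
    show "0 \<le> w v" for v by (simp add: w_def)
    show "c * sqn V w \<le> qform E w"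
      using qform_abs_ge[of E y] sqn_abs[of V y] less unfolding w_def by simp
  qed
  have wu: "0 < w u" by (rule sub_maximiser_pos[OF u(1) w max sub_self[OF u(1)]])
  have card: "2 \<le> card V"
  proof -
    have "card {r, u} \<le> card V" using fin root u by (intro card_mono) auto
    then show ?thesis using u by simp
  qed
  have cross: "bform E w x = 0"
    unfolding bform_def
  proof (intro sum.neutral ballI)
    fix e assume e: "e \<in> E"
    obtain a b where ab: "e = (a, b)" by (cases e)
    have "w a * x b = 0"
    proof (cases "a \<in> sub u")
      case True
      then have "b \<notin> D" using sub_arc[OF u(1), of a b] e ab D by auto
      then show ?thesis using x(1) by (simp add: supp_in_def)
    qed (use w(1) in \<open>simp add: supp_in_def\<close>)
    then show "(case e of (a, b) \<Rightarrow> w a * x b) = 0" by (simp add: ab)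
  qed
  have "w v * x v = 0" for v using x(1) w(1) D(1) by (cases "v \<in> D") (auto simp: supp_in_def)
  then have wx: "(\<Sum>v\<in>V. w v * x v) = 0" by (intro sum.neutral) blast
  have "(p u, u) \<in> E" using u by (simp add: arcs_iff)
  then have "w u \<le> (\<Sum>z\<in>E `` {p u}. w z)" using w(3) by (intro member_le_sum) auto
  then have adj: "0 < adj_app E w (p u)" using wu by (simp add: adj_app_def)
  have "c < eig 2 G"
  proof (rule eig2_greater_perturb[OF pair_graph_G, where x = w and y = x and a = "p u"])
    show "p u \<in> pverts G" using par u by simp
    show "supp_in (pverts G) x" using supp_in_mono[OF x(1,2)] by simp
    show "supp_in (pverts G) w" using supp_in_mono[OF w(1) sub_subset] by simp
    show "x (p u) = 0" using x(1) D(2) by (simp add: supp_in_def)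
    show "w (p u) = 0" using w(1) par_not_sub[OF u] by (simp add: supp_in_def)
  qed (use card wx cross x(4) w(4) adj in simp_all)
  then show False using eig by simp
qed

end

section \<open>Trees with a distinguished path\<close>

lemma path_along_simps:
  "pverts (path_along v (Suc d)) = v ` {..d}"
  "parcs (path_along v (Suc d)) = (\<Union>i<d. {(v i, v (Suc i)), (v (Suc i), v i)})"
  by (auto simp: path_along_def lessThan_Suc_atMost)

text \<open>Deleting the centre leaves two half paths on \<open>d div 2\<close> vertices and the
  components of the attached tree, each with spectral radius at most \<open>c\<close>. This serves
  the comparison tree as well as the converse in the even case.\<close>

lemma path_with_tree_eig2_le:
  assumes T: "pair_graph T" and pt: "path_with_tree T d v B" and d: "even d" "2 \<le> d"
    and du: "disjoint_union_of (\<lambda>C. smith_graph C \<and> eig 1 C \<le> c) (remove_vert B (v (d div 2)))"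
    and c: "eig 1 (path_graph (d div 2)) \<le> c"
  shows "eig 2 T \<le> c"
proof -
  define k where "k = d div 2"
  have dk: "d = k + k" "0 < k" using d by (auto simp: k_def)
  let ?r = "v k"
  have inj: "inj_on v {..d}" and B: "is_tree B" and int: "v ` {..d} \<inter> pverts B = {?r}"
    and VT: "pverts T = v ` {..d} \<union> pverts B"
    and ET: "parcs T = parcs (path_along v (Suc d)) \<union> parcs B"
    using pt unfolding path_with_tree_def path_along_simps(1) k_def by auto
  have EB: "parcs B \<subseteq> pverts B \<times> pverts B" using B by (auto simp: is_tree_def pair_graph_iff)
  have Tg: "finite (pverts T)" "parcs T \<subseteq> pverts T \<times> pverts T" "sym (parcs T)" "irrefl (parcs T)"
    using T by (auto simp: pair_graph_iff)
  have veq: "v i = v j \<longleftrightarrow> i = j" if "i \<le> d" "j \<le> d" for i j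
    using inj that by (auto simp: inj_on_def)
  obtain \<C> where C: "\<And>C. C \<in> \<C> \<Longrightarrow> smith_graph C \<and> eig 1 C \<le> c"
    "pairwise (\<lambda>C D. disjnt (pverts C) (pverts D)) \<C>"
    "pverts B - {?r} = \<Union> (pverts ` \<C>)" "{e \<in> parcs B. fst e \<noteq> ?r \<and> snd e \<noteq> ?r} = \<Union> (parcs ` \<C>)"
    using du unfolding disjoint_union_of_def remove_vert_def k_def[symmetric] by auto
  define P1 P2 where "P1 = v ` {..<k}" and "P2 = (\<lambda>i. v (Suc k + i)) ` {..<k}"
  define \<D> where "\<D> = insert P1 (insert P2 (pverts ` \<C>))"
  have P2: "P2 = v ` {k<..d}"
  proof -
    have "{k<..d} = (\<lambda>i. Suc k + i) ` {..<k}"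
      using image_add_atLeastLessThan[of "Suc k" 0 k] by (auto simp: dk atLeast0LessThan)
    then show ?thesis by (simp add: P2_def image_image)
  qed
  have spine: "v ` {..d} = insert ?r (P1 \<union> P2)"
    unfolding P1_def P2 image_insert[symmetric] image_Un[symmetric] by (intro arg_cong[of _ _ "image v"]) (auto simp: dk)
  have rP: "?r \<notin> P1" "?r \<notin> P2" "P1 \<inter> P2 = {}"
    using veq by (auto simp: P1_def P2 dk)
  have int': "x = ?r" if "x \<in> v ` {..d}" "x \<in> pverts B" for x
    using int that by blast
  have P_B: "P1 \<inter> pverts B = {}" "P2 \<inter> pverts B = {}"
    using int' rP(1,2) unfolding spine by blast+
  have inner: "(v i, v j) \<notin> parcs B" if "i \<le> d" "j \<le> d" for i j
  proof
    assume "(v i, v j) \<in> parcs B"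
    then have "v i \<in> pverts B" "v j \<in> pverts B" "v i \<noteq> v j" using EB Tg(4) ET by (auto simp: irrefl_def)
    then show False using int'[of "v i"] int'[of "v j"] that by auto
  qed
  have arc: "(v i, v j) \<in> parcs T \<longleftrightarrow> j = Suc i \<or> i = Suc j" if "i \<le> d" "j \<le> d" for i j
  proof
    assume "(v i, v j) \<in> parcs T"
    then have "(v i, v j) \<in> parcs (path_along v (Suc d))" using inner[OF that] ET by auto
    then show "j = Suc i \<or> i = Suc j" using veq that by (auto simp: path_along_simps)
  next
    assume "j = Suc i \<or> i = Suc j"
    then show "(v i, v j) \<in> parcs T" using that unfolding ET path_along_simps by auto
  qed
  have card: "2 \<le> card (pverts T)"
  proof -
    have "card (v ` {..d}) \<le> card (pverts T)" using VT Tg(1) by (intro card_mono) auto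
    then show ?thesis using card_image[OF inj] d by simp
  qed
  \<comment> \<open>Connected graphs have a vertex, so disjoint members are distinguished by their
    vertex sets, of which there are finitely many.\<close>
  have fin: "finite \<C>"
  proof -
    have ne: "pverts C \<noteq> {}" if "C \<in> \<C>" for C
      using C(1)[OF that] by (auto simp: smith_graph_def connected_conv)
    have "inj_on pverts \<C>"
    proof (intro inj_onI)
      fix C D assume "C \<in> \<C>" "D \<in> \<C>" "pverts C = pverts D"
      then show "C = D" using C(2) ne[of C] by (auto simp: pairwise_def disjnt_def)
    qed
    moreover have "finite (pverts ` \<C>)"
    proof (rule finite_subset)
      show "pverts ` \<C> \<subseteq> Pow (pverts T)" using C(3) VT by blast
    qed (use Tg(1) in simp)
    ultimately show ?thesis by (simp add: finite_image_iff)
  qed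
  have le_c: "eig 1 (path_graph k) \<le> c" using c by (simp add: k_def)
  show ?thesis
  proof (rule eig2_le_blocks[OF T card, of ?r \<D>])
    show "?r \<in> pverts T" using VT dk by auto
    show "finite \<D>" using fin by (simp add: \<D>_def)
    show "\<Union>\<D> = pverts T - {?r}"
    proof -
      have "\<Union>\<D> = P1 \<union> P2 \<union> (pverts B - {?r})" unfolding \<D>_def C(3) by auto
      also have "\<dots> = pverts T - {?r}" unfolding VT spine using rP by auto
      finally show ?thesis .
    qed
    have CB: "pverts C \<subseteq> pverts B" if "C \<in> \<C>" for C using that C(3) by auto
    have "pairwise disjnt (pverts ` \<C>)"
    proof (intro pairwiseI)
      fix x y assume "x \<in> pverts ` \<C>" "y \<in> pverts ` \<C>" "x \<noteq> y"
      then obtain C D where "C \<in> \<C>" "D \<in> \<C>" "C \<noteq> D" "x = pverts C" "y = pverts D" by auto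
      then show "disjnt x y" using pairwiseD[OF C(2), of C D] by simp
    qed
    moreover have "disjnt P1 P2" "disjnt P2 P1"
      "\<forall>C\<in>\<C>. disjnt P1 (pverts C) \<and> disjnt (pverts C) P1 \<and> disjnt P2 (pverts C) \<and> disjnt (pverts C) P2"
      using rP(3) P_B CB unfolding disjnt_def by blast+
    ultimately show "pairwise disjnt \<D>"
      unfolding \<D>_def by (simp add: pairwise_insert) blast
    show "\<exists>D\<in>\<D>. a \<in> D \<and> b \<in> D" if ab: "(a, b) \<in> parcs T" "a \<noteq> ?r" "b \<noteq> ?r" for a b
    proof (cases "(a, b) \<in> parcs B")
      case True
      then have "(a, b) \<in> \<Union> (parcs ` \<C>)" using ab C(4) by auto
      then obtain D where D: "D \<in> \<C>" "(a, b) \<in> parcs D" by auto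
      then have "a \<in> pverts D" "b \<in> pverts D" using C(1)[OF D(1)] by (auto simp: smith_graph_def pair_graph_iff)
      then show ?thesis using D(1) by (auto simp: \<D>_def)
    next
      case False
      then have "(a, b) \<in> parcs (path_along v (Suc d))" using ab ET by auto
      then obtain i where i: "i < d" "(a, b) = (v i, v (Suc i)) \<or> (a, b) = (v (Suc i), v i)"
        by (auto simp: path_along_simps)
      then have "i \<noteq> k" "Suc i \<noteq> k" using ab by auto
      then have "v i \<in> P1 \<and> v (Suc i) \<in> P1 \<or> v i \<in> P2 \<and> v (Suc i) \<in> P2"
        using i(1) by (cases "i < k") (auto simp: P1_def P2)
      then show ?thesis using i(2) by (auto simp: \<D>_def)
    qed
    show "qform (parcs T) y \<le> c * sqn (pverts T) y" if D: "D \<in> \<D>" and y: "supp_in D y" for D y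
    proof -
      have chain: "qform (parcs T) y \<le> c * sqn (pverts T) y"
        if e: "\<And>i. i < k \<Longrightarrow> e i = v (m + i)" and m: "m + k \<le> Suc d" and ye: "supp_in (e ` {..<k}) y" for e m
      proof -
        have inj_e: "inj_on e {..<k}" using e veq m by (auto simp: inj_on_def)
        have "parcs T \<inter> (e ` {..<k} \<times> e ` {..<k}) = map_prod e e ` parcs (path_graph k)"
          unfolding parcs_path_graph
        proof (intro equalityI subsetI)
          fix x assume "x \<in> parcs T \<inter> (e ` {..<k} \<times> e ` {..<k})"
          then obtain i j where ij: "x = (e i, e j)" "i < k" "j < k" "(e i, e j) \<in> parcs T" by auto
          then have "j = Suc i \<or> i = Suc j" using arc[of "m + i" "m + j"] e m by auto
          then show "x \<in> map_prod e e ` {(i, j). i < k \<and> j < k \<and> (j = Suc i \<or> i = Suc j)}"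
            using ij by (intro image_eqI[of _ _ "(i, j)"]) auto
        next
          fix x assume "x \<in> map_prod e e ` {(i, j). i < k \<and> j < k \<and> (j = Suc i \<or> i = Suc j)}"
          then obtain i j where ij: "x = (e i, e j)" "i < k" "j < k" "j = Suc i \<or> i = Suc j" by auto
          then have "(v (m + i), v (m + j)) \<in> parcs T" using arc[of "m + i" "m + j"] m by auto
          then show "x \<in> parcs T \<inter> (e ` {..<k} \<times> e ` {..<k})" using ij e by auto
        qed
        moreover have "e ` {..<k} \<subseteq> pverts T" using e m VT by auto
        ultimately have "qform (parcs T) y \<le> eig 1 (path_graph k) * sqn (pverts T) y"
          using qform_chain_le[OF Tg(1,2) inj_e ye] dk(2) by blast
        also have "\<dots> \<le> c * sqn (pverts T) y" using le_c by (intro mult_right_mono) auto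
        finally show ?thesis .
      qed
      consider "D = P1" | "D = P2" | C where "C \<in> \<C>" "D = pverts C" using D by (auto simp: \<D>_def)
      then show ?thesis
      proof cases
        case 1
        then show ?thesis using chain[of v 0] y dk by (simp add: P1_def)
      next
        case 2
        then show ?thesis using chain[of "\<lambda>i. v (Suc k + i)" "Suc k"] y dk by (simp add: P2_def)
      next
        case (3 C)
        have Cg: "pair_graph C" "eig 1 C \<le> c" using C(1)[OF 3(1)] by (auto simp: smith_graph_def)
        have Csub: "pverts C \<subseteq> pverts B - {?r}" using C(3) 3(1) by auto
        have yC: "supp_in (pverts C) y" using y 3(2) by simp
        have "qform (parcs T) y = qform (parcs C) y"
          unfolding bform_def
        proof (rule sum.mono_neutral_right)
          show "finite (parcs T)" using Tg(1,2) by (auto intro: finite_subset)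
          show "parcs C \<subseteq> parcs T" using C(4) 3(1) ET by auto
          show "\<forall>e\<in>parcs T - parcs C. (case e of (u, w) \<Rightarrow> y u * y w) = 0"
          proof
            fix e assume e: "e \<in> parcs T - parcs C"
            obtain a b where ab: "e = (a, b)" by (cases e)
            show "(case e of (u, w) \<Rightarrow> y u * y w) = 0"
            proof (rule ccontr)
              assume "\<not> ?thesis"
              then have abC: "a \<in> pverts C" "b \<in> pverts C" using yC by (auto simp: ab supp_in_def)
              then have "(a, b) \<in> parcs B"
              proof -
                have "a \<notin> v ` {..d}" using abC(1) Csub int by auto
                then have "(a, b) \<notin> parcs (path_along v (Suc d))" by (auto simp: path_along_simps)
                then show ?thesis using e ab ET by auto
              qed
              moreover have "a \<noteq> ?r" "b \<noteq> ?r" using abC Csub by auto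
              ultimately have "(a, b) \<in> \<Union> (parcs ` \<C>)" using C(4) by auto
              then obtain D where Dc: "D \<in> \<C>" "(a, b) \<in> parcs D" by auto
              then have "a \<in> pverts D" using C(1)[OF Dc(1)] by (auto simp: smith_graph_def pair_graph_iff)
              then have "D = C" using C(2) Dc(1) 3(1) abC(1) by (auto simp: pairwise_def disjnt_iff)
              then show False using Dc(2) e ab by simp
            qed
          qed
        qed
        also have "\<dots> \<le> eig 1 C * sqn (pverts C) y" by (rule qform_le_eig1[OF Cg(1) yC])
        also have "\<dots> \<le> c * sqn (pverts C) y" using Cg(2) by (intro mult_right_mono) auto
        also have "sqn (pverts C) y = sqn (pverts T) y"
          unfolding sqn_def using Tg(1) Csub VT yC by (intro sum.mono_neutral_left) (auto simp: supp_in_def)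
        finally show ?thesis .
      qed
    qed
  qed
qed

section \<open>Trees rooted at the middle of a path\<close>

lemma (in rooted_tree) degree_le_2:
  assumes "u \<in> V" "u \<noteq> r" "card (ch u) \<le> 1"
  shows "out_degree (with_proj G) u \<le> 2"
proof -
  have "out_arcs (with_proj G) u = Pair u ` (E `` {u})" by (auto simp: out_arcs_def)
  then have "out_degree (with_proj G) u \<le> card (E `` {u})"
    unfolding out_degree_def by (simp add: card_image_le)
  also have "\<dots> \<le> card {p u} + card (ch u)" unfolding E_image[OF assms(1)] using assms(2) card_Un_le[of "{p u}" "ch u"] by simp
  finally show ?thesis using assms(3) by simp
qed

text \<open>Both halves of the path descend from \<open>r\<close>: the indices below
  \<open>k\<close> form one of length \<open>k\<close>, those above one of length
  \<open>d - k\<close>, which is \<open>k\<close> or \<open>k + 1\<close>. For odd \<open>d\<close>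
  the edge from \<open>r\<close> to \<open>s\<close> is the middle edge.\<close>

locale spined_tree = rooted_tree V r p h for V :: "'a set" and r p h +
  fixes v :: "nat \<Rightarrow> 'a" and d k :: nat
  assumes kd: "k = d div 2" and k0: "0 < k"
    and inj: "inj_on v {..d}" and sv: "v ` {..d} \<subseteq> V"
    and rv: "r = v k"
    and lower: "i < k \<Longrightarrow> p (v i) = v (Suc i)"
    and upper: "k \<le> i \<Longrightarrow> i < d \<Longrightarrow> p (v (Suc i)) = v i"
begin

abbreviation "s \<equiv> v (Suc k)"

lemma k_less: "k < d" "Suc k \<le> d" "d - k \<le> Suc k" "k \<le> d - k" "k \<le> d"
  using kd k0 by auto

lemma veq: "i \<le> d \<Longrightarrow> j \<le> d \<Longrightarrow> v i = v j \<longleftrightarrow> i = j"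
  using inj by (auto simp: inj_on_def)

lemma vV: "i \<le> d \<Longrightarrow> v i \<in> V"
  using sv by auto

lemma vr: "i \<le> d \<Longrightarrow> v i = r \<longleftrightarrow> i = k"
  using veq[of i k] k_less rv by auto

lemma h_upper: "k \<le> i \<Longrightarrow> i \<le> d \<Longrightarrow> h (v i) = i - k"
proof (induction i rule: dec_induct)
  case base
  then show ?case using rv root by simp
next
  case (step i)
  then show ?case using dep[of "v (Suc i)"] vV[of "Suc i"] vr[of "Suc i"] upper[of i] by simp
qed

lemma h_lower: "i \<le> k \<Longrightarrow> h (v i) = k - i"
proof (induction "k - i" arbitrary: i)
  case 0
  then show ?case using rv root by simp
next
  case (Suc n)
  then have i: "i < k" by simp
  then have "h (v (Suc i)) = k - Suc i" using Suc by simp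
  then show ?case using dep[of "v i"] vV[of i] vr[of i] lower[OF i] i k_less by simp
qed

lemma s_props: "s \<in> V" "s \<noteq> r" "p s = r" "h s = 1" "s \<in> ch r"
proof -
  show "s \<in> V" using vV k_less by simp
  moreover show "s \<noteq> r" using vr[of "Suc k"] k_less by simp
  moreover show "p s = r" using upper[of k] k_less rv by simp
  ultimately show "s \<in> ch r" by (simp add: ch_iff)
  show "h s = 1" using h_upper[of "Suc k"] k_less by simp
qed

lemma spine_arc: "i < d \<Longrightarrow> (v i, v (Suc i)) \<in> E"
proof (cases "i < k")
  case True
  then show ?thesis using lower[OF True] vV[of i] vr[of i] k_less by (simp add: arcs_iff)
next
  assume "i < d"
  case False
  then show ?thesis using upper[of i] vV[of "Suc i"] vr[of "Suc i"] \<open>i < d\<close> by (simp add: arcs_iff)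
qed

lemma upper_sub: "Suc k \<le> i \<Longrightarrow> i \<le> d \<Longrightarrow> v i \<in> sub s"
proof (induction i rule: dec_induct)
  case base
  then show ?case using sub_self s_props by simp
next
  case (step i)
  have "v (Suc i) \<noteq> s" using veq[of "Suc i" "Suc k"] step k_less by simp
  then show ?case using sub_step[of "v (Suc i)" s] vV[of "Suc i"] vr[of "Suc i"] upper[of i] step by simp
qed

lemma lower_top: "v (k - 1) \<in> V" "v (k - 1) \<noteq> r" "p (v (k - 1)) = r" "h (v (k - 1)) = 1" "v (k - 1) \<in> ch r"
  "v (k - 1) \<noteq> s"
proof -
  show "v (k - 1) \<in> V" using vV k_less by simp
  moreover show "v (k - 1) \<noteq> r" using vr[of "k - 1"] k_less k0 by simp
  moreover show "p (v (k - 1)) = r" using lower[of "k - 1"] k0 rv by simp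
  ultimately show "v (k - 1) \<in> ch r" by (simp add: ch_iff)
  show "h (v (k - 1)) = 1" using h_lower[of "k - 1"] k0 by simp
  show "v (k - 1) \<noteq> s" using veq[of "k - 1" "Suc k"] k_less by simp
qed

lemma lower_sub: "i < k \<Longrightarrow> v i \<in> sub (v (k - 1))"
proof (induction "k - i" arbitrary: i)
  case (Suc n)
  show ?case
  proof (cases "i = k - 1")
    case True
    then show ?thesis using sub_self lower_top by simp
  next
    case False
    then have "v (Suc i) \<in> sub (v (k - 1))" using Suc by simp
    moreover have "v i \<noteq> v (k - 1)" using veq[of i "k - 1"] Suc.prems False k_less by simp
    ultimately show ?thesis
      using sub_step[of "v i" "v (k - 1)"] vV[of i] vr[of i] lower[of i] Suc.prems k_less by simp
  qed
qed simp

lemma s_sub_disjoint: "u \<in> ch r \<Longrightarrow> u \<noteq> s \<Longrightarrow> sub u \<inter> sub s = {}"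
  using child_depth[of u r] s_props root by (intro sub_disjoint) (auto simp: ch_iff)

lemma lower_not_sub: "i \<le> k \<Longrightarrow> v i \<notin> sub s"
proof (cases "i = k")
  case True
  then show ?thesis using root_sub[of s] s_props rv by auto
next
  assume "i \<le> k"
  case False
  then have "v i \<in> sub (v (k - 1))" using lower_sub \<open>i \<le> k\<close> by simp
  then show ?thesis using s_sub_disjoint[OF lower_top(5,6)] by auto
qed

lemma sub_s_step: "u \<in> V \<Longrightarrow> u \<noteq> r \<Longrightarrow> u \<noteq> s \<Longrightarrow> u \<in> sub s \<longleftrightarrow> p u \<in> sub s"
  using sub_step .

lemma r_not_sub_s: "r \<notin> sub s"
  using root_sub[of s] s_props by auto

text \<open>The admissibility test for competitors: the same vertex set, and depths that reach
  exactly \<open>k\<close> and \<open>d - k\<close> on the two sides of the edge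
  \<open>r s\<close>.\<close>

lemma trees_rooted:
  assumes "rooted_tree V r p' h'" and p: "p' s = r"
    and S: "\<not> S r" "S s" "\<And>u. u \<in> V \<Longrightarrow> u \<noteq> r \<Longrightarrow> u \<noteq> s \<Longrightarrow> S u = S (p' u)"
    and k1: "\<And>u. u \<in> V \<Longrightarrow> \<not> S u \<Longrightarrow> h' u \<le> k"
    and k2: "\<And>u. u \<in> V \<Longrightarrow> S u \<Longrightarrow> h' u \<le> d - k"
    and ends: "a \<in> V" "\<not> S a" "k \<le> h' a" "b \<in> V" "S b" "d - k \<le> h' b"
  shows "parent_graph V r p' \<in> trees (card V) d"
proof -
  interpret T: rooted_tree V r p' h' by fact
  have "h' a = k" using k1[of a] ends by simp
  moreover have "h' b = d - k" using k2[of b] ends by simp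
  moreover have "k \<le> d - k" "d - k \<le> k + 2" using k_less by auto
  ultimately have "graph_diameter T.G = ereal (real (k + (d - k)))"
    using T.graph_diameter_sides[OF s_props(1,2) p, of S k "d - k" a b] S k1 k2 ends by blast
  then show ?thesis using k_less T.is_tree_G by (simp add: trees_def)
qed

abbreviation "spine \<equiv> v ` {..d}"
abbreviation "VB \<equiv> V - v ` ({..d} - {k})"
abbreviation "B \<equiv> parent_graph VB r p"

text \<open>The condition that makes \<open>VB\<close> closed under parents, so that what remains
  beside the spine is a tree through \<open>r\<close>.\<close>

definition off_path :: bool where
  "off_path \<longleftrightarrow> (\<forall>u\<in>V - spine. p u \<notin> v ` ({..d} - {k}))"

lemma r_VB: "r \<in> VB"
  using root vr by auto

lemma spine_VB: "u \<in> VB \<Longrightarrow> u \<in> spine \<Longrightarrow> u = r"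
  using rv by auto

lemma VB_rooted:
  assumes off_path
  shows "rooted_tree VB r p h"
proof
  show "finite VB" using fin by simp
  show "r \<in> VB" by (rule r_VB)
  show "h r = 0" by (rule root)
  fix u assume u: "u \<in> VB" "u \<noteq> r"
  then have "u \<in> V - spine" using spine_VB by blast
  then show "p u \<in> VB" using assms par[of u] u unfolding off_path_def by blast
  show "h u = Suc (h (p u))" using dep u by blast
qed

lemma off_path_decomposition:
  assumes off: off_path
  shows "path_with_tree G d v B"
proof -
  interpret B: rooted_tree VB r p h by (rule VB_rooted[OF off])
  have "r \<in> spine" unfolding rv using k_less by blast
  then have "spine \<inter> VB = {r}" using spine_VB r_VB by blast
  moreover have "v (d div 2) = r" using rv kd by simp
  ultimately have 1: "spine \<inter> VB = {v (d div 2)}" by (simp only:)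
  have V: "V = spine \<union> VB" using sv by auto
  have E: "E = parcs (path_along v (Suc d)) \<union> parent_arcs VB r p"
  proof (intro equalityI subsetI)
    fix e assume "e \<in> E"
    then obtain u where u: "u \<in> V" "u \<noteq> r" "e = (u, p u) \<or> e = (p u, u)" unfolding parent_arcs_def by auto
    show "e \<in> parcs (path_along v (Suc d)) \<union> parent_arcs VB r p"
    proof (cases "u \<in> VB")
      case True
      then show ?thesis using u unfolding parent_arcs_def by auto
    next
      case False
      then obtain i where i: "i \<le> d" "i \<noteq> k" "u = v i" using u(1) by auto
      show ?thesis
      proof (cases "i < k")
        case True
        then show ?thesis using u(3) i lower[OF True] k_less by (auto simp: path_along_simps)
      next
        case False
        then obtain j where "i = Suc j" "k \<le> j" "j < d" using i by (cases i) auto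
        then show ?thesis using u(3) i(3) upper[of j] by (auto simp: path_along_simps)
      qed
    qed
  next
    fix e assume "e \<in> parcs (path_along v (Suc d)) \<union> parent_arcs VB r p"
    then consider i where "i < d" "e = (v i, v (Suc i)) \<or> e = (v (Suc i), v i)" | "e \<in> parent_arcs VB r p"
      by (auto simp: path_along_simps)
    then show "e \<in> E"
    proof cases
      case 1
      then show ?thesis using spine_arc[of i] E_sym by (auto simp: sym_def)
    next
      case 2
      then show ?thesis unfolding parent_arcs_def by auto
    qed
  qed
  show ?thesis
    unfolding path_with_tree_def path_along_simps(1) parent_graph_simps
    by (intro conjI inj B.is_tree_G 1 V E)
qed

lemma off_path_children:
  assumes off: off_path and i: "i \<le> d" "i \<noteq> k"
  shows "card (ch (v i)) \<le> 1"
proof -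
  have "ch (v i) \<subseteq> {if i < k then v (i - 1) else v (Suc i)}"
  proof
    fix u assume u: "u \<in> ch (v i)"
    then have uV: "u \<in> V" "u \<noteq> r" "p u = v i" by (auto simp: ch_iff)
    then have "u \<in> spine" using off i unfolding off_path_def by auto
    then obtain j where j: "j \<le> d" "u = v j" by auto
    then have jk: "j \<noteq> k" using uV vr by auto
    show "u \<in> {if i < k then v (i - 1) else v (Suc i)}"
    proof (cases "j < k")
      case True
      then have "i = Suc j" using lower[OF True] uV j veq[of "Suc j" i] i k_less by auto
      then show ?thesis using True i j by auto
    next
      case False
      then obtain l where l: "j = Suc l" "k \<le> l" "l < d" using jk j by (cases j) auto
      then have "i = l" using upper[of l] uV j veq[of l i] i by auto
      then show ?thesis using l i j by auto
    qed
  qed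
  then have "card (ch (v i)) \<le> card {if i < k then v (i - 1) else v (Suc i)}"
    by (intro card_mono) auto
  then show ?thesis by simp
qed

end

text \<open>The orientation is forced outwards from the root: the arc at \<open>v k\<close> must
  point to it, and a vertex whose parent is already the previous path vertex cannot have the next
  one as parent too.\<close>

lemma spined_of_path:
  assumes T: "is_tree T" and inj: "inj_on v {..d}" and sv: "v ` {..d} \<subseteq> pverts T"
    and arcs: "\<And>i. i < d \<Longrightarrow> (v i, v (Suc i)) \<in> parcs T" and kd: "k = d div 2" "0 < k"
  obtains p h where "spined_tree (pverts T) (v k) p h v d k" "T = parent_graph (pverts T) (v k) p"
proof -
  have k: "k < d" using kd by auto
  have "v k \<in> pverts T" using sv k by auto
  then obtain p h where ph: "rooted_tree (pverts T) (v k) p h" "T = parent_graph (pverts T) (v k) p"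
    by (rule is_tree_rooted[OF T])
  interpret rooted_tree "pverts T" "v k" p h by (rule ph(1))
  have veq: "v i = v j \<longleftrightarrow> i = j" if "i \<le> d" "j \<le> d" for i j
    using inj that by (auto simp: inj_on_def)
  have ET: "parcs T = E" using ph(2) by (metis parent_graph_simps(2))
  have arc: "v i \<noteq> v k \<and> v (Suc i) = p (v i) \<or> v (Suc i) \<noteq> v k \<and> v i = p (v (Suc i))" if "i < d" for i
    using arcs[OF that] unfolding ET arcs_iff by auto
  have upper: "p (v (Suc i)) = v i" if "k \<le> i" "i < d" for i
    using that
  proof (induction i rule: dec_induct)
    case base
    then show ?case using arc[of k] k by auto
  next
    case (step i)
    then have "p (v (Suc i)) = v i" by simp
    moreover have "v (Suc (Suc i)) \<noteq> v i" using veq step by simp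
    ultimately show ?case using arc[of "Suc i"] step by auto
  qed
  have lower: "p (v i) = v (Suc i)" if "i < k" for i
    using that
  proof (induction "k - i" arbitrary: i)
    case (Suc n)
    show ?case
    proof (cases "Suc i = k")
      case True
      then show ?thesis using arc[of i] k by auto
    next
      case False
      then have "p (v (Suc i)) = v (Suc (Suc i))" using Suc by simp
      moreover have "v (Suc (Suc i)) \<noteq> v i" using veq[of "Suc (Suc i)" i] Suc.prems False k by simp
      ultimately show ?thesis using arc[of i] Suc.prems k by auto
    qed
  qed simp
  have "spined_tree (pverts T) (v k) p h v d k"
    by unfold_locales (use kd inj sv lower upper in auto)
  then show ?thesis using that ph(2) by blast
qed

section \<open>The comparison tree and even diameter\<close>

context spined_tree
begin

lemma spine_vec:
  assumes "j + m \<le> Suc d" "0 < m"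
  shows "\<exists>x. supp_in (v ` {j..<j + m}) x \<and> (\<forall>i. j \<le> i \<and> i < j + m \<longrightarrow> 0 < x (v i)) \<and> (\<forall>u. 0 \<le> x u) \<and>
    eig 1 (path_graph m) * sqn V x \<le> qform E x \<and> 0 < sqn V x"
proof -
  let ?e = "\<lambda>i. v (j + i)"
  have "?e ` {..<m} = v ` ((+) j ` {0..<m})" by (simp only: image_image atLeast0LessThan)
  also have "(+) j ` {0..<m} = {j..<j + m}" using image_add_atLeastLessThan[of j 0 m] by (simp add: add.commute)
  finally have im: "?e ` {..<m} = v ` {j..<j + m}" .
  have "inj_on ?e {..<m}" using veq assms by (auto simp: inj_on_def)
  moreover have "?e ` {..<m} \<subseteq> V" using vV assms(1) by auto
  moreover have "(?e i, ?e (Suc i)) \<in> E" if "Suc i < m" for i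
    using spine_arc[of "j + i"] that assms by simp
  ultimately obtain x where x: "supp_in (?e ` {..<m}) x" "\<forall>i<m. 0 < x (?e i)" "\<forall>v. 0 \<le> x v"
    "eig 1 (path_graph m) * sqn V x \<le> qform E x" "0 < sqn V x"
    using chain_vector[OF fin E_sub E_sym _ _ assms(2), of ?e] by blast
  have "0 < x (v i)" if "j \<le> i" "i < j + m" for i
    using x(2)[rule_format, of "i - j"] that by simp
  then show ?thesis using x im by (intro exI[of _ x]) simp
qed

text \<open>The comparison tree: every vertex off the spine becomes a pendant neighbour of \<open>r\<close>.\<close>

definition star_parent :: "'a \<Rightarrow> 'a" where
  "star_parent u = (if u \<in> spine then p u else r)"

definition star_depth :: "'a \<Rightarrow> nat" where
  "star_depth u = (if u \<in> spine then h u else 1)"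

lemma r_spine: "r \<in> spine"
  unfolding rv using k_less by blast

lemma spine_par:
  assumes "u \<in> spine" "u \<noteq> r"
  shows "p u \<in> spine"
proof -
  obtain i where i: "i \<le> d" "u = v i" "i \<noteq> k" using assms rv by auto
  show ?thesis
  proof (cases "i < k")
    case True
    then show ?thesis using lower[of i] i k_less by simp
  next
    case False
    then obtain j where "i = Suc j" "k \<le> j" "j < d" using i by (cases i) auto
    then show ?thesis using upper[of j] i by simp
  qed
qed

lemma star_spined: "spined_tree V r star_parent star_depth v d k"
proof
  show "finite V" "r \<in> V" "k = d div 2" "0 < k" "inj_on v {..d}" "v ` {..d} \<subseteq> V" "r = v k"
    by (rule fin root(1) kd k0 inj sv rv)+
  show "star_depth r = 0" using r_spine root by (simp add: star_depth_def)
  show "star_parent u \<in> V" if "u \<in> V" "u \<noteq> r" for u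
    using that par root by (simp add: star_parent_def)
  show "star_depth u = Suc (star_depth (star_parent u))" if "u \<in> V" "u \<noteq> r" for u
    using that dep spine_par r_spine root by (auto simp: star_depth_def star_parent_def)
  show "star_parent (v i) = v (Suc i)" if "i < k" for i
    using lower[OF that] that k_less by (simp add: star_parent_def)
  show "star_parent (v (Suc i)) = v i" if "k \<le> i" "i < d" for i
    using upper[OF that] that by (simp add: star_parent_def)
qed

text \<open>Pendant neighbours of \<open>r\<close> have depth 1, which is at most \<open>k\<close>,
  so the diameter is still that of the spine.\<close>

lemma star_trees: "parent_graph V r star_parent \<in> trees (card V) d"
proof -
  interpret S: spined_tree V r star_parent star_depth v d k by (rule star_spined)
  define S where "S u \<longleftrightarrow> u \<in> v ` {Suc k..d}" for u
  have Sv: "S (v i) \<longleftrightarrow> k < i" if "i \<le> d" for i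
    using veq that by (auto simp: S_def)
  show ?thesis
  proof (rule trees_rooted[of star_parent star_depth S "v 0" "v d"])
    show "rooted_tree V r star_parent star_depth" by (rule S.rooted_tree_axioms)
    show "star_parent s = r" by (rule S.s_props(3))
    show "\<not> S r" "S s" "\<not> S (v 0)" "S (v d)" using Sv[of k] Sv[of "Suc k"] Sv[of 0] Sv[of d] k_less rv k0 by auto
    show "S u = S (star_parent u)" if u: "u \<in> V" "u \<noteq> r" "u \<noteq> s" for u
    proof (cases "u \<in> spine")
      case True
      then obtain i where i: "i \<le> d" "u = v i" by auto
      then have ik: "i \<noteq> k" "i \<noteq> Suc k" using u rv by auto
      show ?thesis
      proof (cases "i < k")
        case True
        then show ?thesis using S.lower[of i] i Sv[of i] Sv[of "Suc i"] k_less by simp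
      next
        case False
        then obtain j where "i = Suc j" "k < j" "j < d" using ik i by (cases i) auto
        then show ?thesis using S.upper[of j] i Sv[of i] Sv[of j] by simp
      qed
    next
      case False
      then show ?thesis using \<open>\<not> S r\<close> by (auto simp: star_parent_def S_def)
    qed
    show "star_depth u \<le> k" if "u \<in> V" "\<not> S u" for u
    proof (cases "u \<in> spine")
      case True
      then obtain i where i: "i \<le> d" "u = v i" by auto
      then show ?thesis using that Sv[of i] S.h_lower[of i] by simp
    qed (use k0 in \<open>simp add: star_depth_def\<close>)
    show "star_depth u \<le> d - k" if "u \<in> V" "S u" for u
      using that S.h_upper by (auto simp: S_def)
    show "k \<le> star_depth (v 0)" "d - k \<le> star_depth (v d)" using S.h_lower[of 0] S.h_upper[of d] k_less by auto
    show "v 0 \<in> V" "v d \<in> V" using vV by auto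
  qed
qed

lemma star_off_path: "spined_tree.off_path V star_parent v d k"
proof -
  interpret S: spined_tree V r star_parent star_depth v d k by (rule star_spined)
  show ?thesis unfolding S.off_path_def star_parent_def using vr by auto
qed

lemma ch_spine:
  assumes "u \<in> ch r" "u \<in> spine"
  shows "u = s \<or> u = v (k - 1)"
proof -
  obtain i where i: "i \<le> d" "u = v i" using assms(2) by auto
  have hu: "h u = 1" using child_depth[OF assms(1)] root by simp
  show ?thesis
  proof (cases "i \<le> k")
    case True
    then show ?thesis using h_lower[of i] hu i by (cases "i = k - 1") auto
  next
    case False
    then show ?thesis using h_upper[of i] hu i by (cases "i = Suc k") auto
  qed
qed

text \<open>The branches of \<open>B\<close> at \<open>r\<close> sit inside branches of the whole
  tree that avoid both spine neighbours of \<open>r\<close>, so bounds transfer by extending vectors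
  by zero.\<close>

lemma off_path_qform_le:
  assumes off: off_path
    and le: "\<And>u y. u \<in> ch r \<Longrightarrow> u \<noteq> s \<Longrightarrow> u \<noteq> v (k - 1) \<Longrightarrow> supp_in (sub u) y \<Longrightarrow> qform E y \<le> c * sqn V y"
    and u: "u \<in> rooted_tree.ch VB r p r" "supp_in (rooted_tree.sub VB p h u) y"
  shows "qform (parent_arcs VB r p) y \<le> c * sqn VB y"
proof -
  interpret B: rooted_tree VB r p h by (rule VB_rooted[OF off])
  have uB: "u \<in> VB" "u \<noteq> r" "p u = r" using u(1) by (auto simp: B.ch_iff)
  then have "u \<in> ch r" by (auto simp: ch_iff)
  moreover have "u \<notin> spine" using uB spine_VB by blast
  moreover have "s \<in> spine" "v (k - 1) \<in> spine" using k_less by auto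
  moreover have "supp_in (sub u) y"
    by (rule supp_in_mono[OF u(2)]) (auto simp: B.sub_def sub_def)
  ultimately have "qform E y \<le> c * sqn V y" using le by blast
  moreover have y: "y w = 0" if "w \<notin> VB" for w
    using u(2) B.sub_subset[of u] that by (auto simp: supp_in_def)
  have "qform (parent_arcs VB r p) y = qform E y"
    unfolding B.qform_parent qform_parent using fin y
    by (intro arg_cong[of _ _ "(*) 2"] sum.mono_neutral_left) auto
  moreover have "sqn VB y = sqn V y"
    unfolding sqn_def using fin y by (intro sum.mono_neutral_left) auto
  ultimately show ?thesis by simp
qed

lemma off_path_eig1_le:
  assumes off: off_path and card: "d + 2 \<le> card V"
    and le: "\<And>u y. u \<in> ch r \<Longrightarrow> u \<noteq> s \<Longrightarrow> u \<noteq> v (k - 1) \<Longrightarrow> supp_in (sub u) y \<Longrightarrow> qform E y \<le> c * sqn V y"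
  shows "eig 1 (remove_vert B r) \<le> c"
proof -
  interpret B: rooted_tree VB r p h by (rule VB_rooted[OF off])
  have "VB \<noteq> {r}"
  proof
    assume "VB = {r}"
    then have "V \<subseteq> spine" using r_spine by blast
    then have "card V \<le> card spine" by (intro card_mono) auto
    also have "\<dots> \<le> Suc d" using card_image_le[of "{..d}" v] by simp
    finally show False using card by simp
  qed
  then show ?thesis
    using off_path_qform_le[OF off le] by (intro B.eig1_remove_root_le) blast+
qed

lemma off_path_disjoint_union:
  assumes off: off_path and c: "c \<le> 2"
    and le: "\<And>u y. u \<in> ch r \<Longrightarrow> u \<noteq> s \<Longrightarrow> u \<noteq> v (k - 1) \<Longrightarrow> supp_in (sub u) y \<Longrightarrow> qform E y \<le> c * sqn V y"
  shows "disjoint_union_of (\<lambda>C. smith_graph C \<and> eig 1 C \<le> c) (remove_vert B r)"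
proof -
  interpret B: rooted_tree VB r p h by (rule VB_rooted[OF off])
  show ?thesis
  proof (rule B.disjoint_union_branches)
    fix u assume u: "u \<in> B.ch r"
    then have uB: "u \<in> VB" by (auto simp: B.ch_iff)
    interpret S: rooted_tree "B.sub u" u p "\<lambda>v. h v - h u" by (rule B.sub_rooted[OF uB])
    have "eig 1 (parent_graph (B.sub u) u p) \<le> c"
    proof (rule B.eig1_sub_le[OF uB])
      fix y assume y: "supp_in (B.sub u) y"
      show "qform (parent_arcs VB r p) y \<le> c * sqn VB y"
        by (rule off_path_qform_le[OF off _ u y]) (rule le)
    qed
    then show "smith_graph (parent_graph (B.sub u) u p) \<and> eig 1 (parent_graph (B.sub u) u p) \<le> c"
      unfolding smith_graph_def using S.pair_graph_G S.connected_G c by simp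
  qed
qed

text \<open>Vertices off the spine have become leaves, so such a branch is a single vertex and
  carries no edge.\<close>

lemma star_branch:
  assumes u: "u \<in> rooted_tree.ch V r star_parent r" "u \<notin> spine"
  shows "rooted_tree.sub V star_parent star_depth u \<subseteq> {u}"
    "supp_in (rooted_tree.sub V star_parent star_depth u) y \<Longrightarrow> qform (parent_arcs V r star_parent) y = 0"
proof -
  interpret S: spined_tree V r star_parent star_depth v d k by (rule star_spined)
  have uV: "u \<in> V" using u by (auto simp: S.ch_iff)
  have "w = u" if "w \<in> S.sub u" for w
    using uV that
  proof (induction rule: S.sub_induct)
    case (step w)
    then have "star_parent w \<in> spine" using spine_par[of w] r_spine by (auto simp: star_parent_def)
    then show ?case using step(6) u(2) by simp
  qed simp
  then show sub: "S.sub u \<subseteq> {u}" by blast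
  assume y: "supp_in (S.sub u) y"
  have "y w * y (star_parent w) = 0" if "w \<in> V - {r}" for w
  proof -
    have "star_parent w \<noteq> w" using S.par_neq that by auto
    then have "w \<notin> S.sub u \<or> star_parent w \<notin> S.sub u" using sub by auto
    then show ?thesis using y by (auto simp: supp_in_def)
  qed
  then show "qform (parent_arcs V r star_parent) y = 0" unfolding S.qform_parent by (simp add: sum.neutral)
qed

lemma star_eig2_le:
  assumes "even d"
  shows "eig 2 (parent_graph V r star_parent) \<le> eig 1 (path_graph k)"
proof -
  interpret S: spined_tree V r star_parent star_depth v d k by (rule star_spined)
  obtain k' where k': "k = Suc k'" using k0 by (cases k) auto
  show ?thesis
  proof (rule path_with_tree_eig2_le[OF S.pair_graph_G S.off_path_decomposition[OF star_off_path] assms])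
    show "2 \<le> d" using kd k0 by auto
    show "eig 1 (path_graph (d div 2)) \<le> eig 1 (path_graph k)" using kd by simp
    have "disjoint_union_of (\<lambda>C. smith_graph C \<and> eig 1 C \<le> eig 1 (path_graph k)) (remove_vert S.B r)"
    proof (rule S.off_path_disjoint_union[OF star_off_path])
      show "eig 1 (path_graph k) \<le> 2" using eig1_path_less_2[of k'] k' by simp
      fix u y assume u: "u \<in> S.ch r" "u \<noteq> s" "u \<noteq> v (k - 1)" "supp_in (S.sub u) y"
      then have "u \<notin> spine" using S.ch_spine by blast
      then have "qform S.E y = 0" using star_branch(2) u by blast
      then show "qform S.E y \<le> eig 1 (path_graph k) * sqn V y" using eig1_path_nonneg[OF k0] by simp
    qed
    then show "disjoint_union_of (\<lambda>C. smith_graph C \<and> eig 1 C \<le> eig 1 (path_graph k)) (remove_vert S.B (v (d div 2)))"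
      using rv kd by simp
  qed
qed

lemma card_ge_2: "2 \<le> card V"
proof -
  have "card {r, s} \<le> card V" using fin root s_props by (intro card_mono) auto
  then show ?thesis using s_props by simp
qed

text \<open>Each half of the spine attains the bound supplied by the comparison tree. One half
  limits every branch disjoint from it, and the two halves together give the matching lower bound
  for the second eigenvalue.\<close>

lemma even_optimal:
  assumes d: "even d" and opt: "\<And>T' :: 'a pair_pre_digraph. T' \<in> trees (card V) d \<Longrightarrow> eig 2 G \<le> eig 2 T'"
  shows "eig 2 G = eig 1 (path_graph k)" "off_path"
    "\<And>u y. u \<in> ch r \<Longrightarrow> supp_in (sub u) y \<Longrightarrow> qform E y \<le> eig 1 (path_graph k) * sqn V y"
proof -
  let ?c = "eig 1 (path_graph k)"
  have dk: "d = k + k" using d kd by auto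
  have le: "eig 2 G \<le> ?c" using opt[OF star_trees] star_eig2_le[OF d] by simp
  have seg: "0 + k \<le> Suc d" "Suc k + k \<le> Suc d" using dk by auto
  obtain x where x: "supp_in (v ` {0..<0 + k}) x" "\<forall>i. 0 \<le> i \<and> i < 0 + k \<longrightarrow> 0 < x (v i)" "\<forall>u. 0 \<le> x u"
    "?c * sqn V x \<le> qform E x" "0 < sqn V x"
    using spine_vec[OF seg(1) k0] by blast
  obtain y where y: "supp_in (v ` {Suc k..<Suc k + k}) y" "\<forall>i. Suc k \<le> i \<and> i < Suc k + k \<longrightarrow> 0 < y (v i)" "\<forall>u. 0 \<le> y u"
    "?c * sqn V y \<le> qform E y" "0 < sqn V y"
    using spine_vec[OF seg(2) k0] by blast
  have px: "v ` {0..<0 + k} \<subseteq> sub (v (k - 1))" using lower_sub by auto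
  have py: "v ` {Suc k..<Suc k + k} \<subseteq> sub s"
  proof
    fix u assume "u \<in> v ` {Suc k..<Suc k + k}"
    then obtain i where "u = v i" "Suc k \<le> i" "i \<le> d" using dk by auto
    then show "u \<in> sub s" using upper_sub by simp
  qed
  note xs = supp_in_mono[OF x(1) px] and ys = supp_in_mono[OF y(1) py]
  have dis: "sub (v (k - 1)) \<inter> sub s = {}" using s_sub_disjoint lower_top by blast
  have xne: "x \<noteq> (\<lambda>_. 0)" "y \<noteq> (\<lambda>_. 0)" using x(5) y(5) by (auto simp: sqn_def)
  have arcs_r: "(r, s) \<in> E" "(r, v (k - 1)) \<in> E" using s_props lower_top by (auto simp: arcs_iff)
  have qs: "qform E z \<le> ?c * sqn V z" if u: "u \<in> ch r" and z: "supp_in (sub u) z" for u z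
  proof -
    have uV: "u \<in> V" "u \<noteq> r" "p u = r" using u by (auto simp: ch_iff)
    show ?thesis
    \<comment> \<open>The half used as test vector must avoid the branch: the upper half works for
      every branch except that of \<open>s\<close>, where the lower half takes over.\<close>
    proof (cases "u = s")
      case False
      have 1: "v ` {Suc k..<Suc k + k} \<inter> sub u = {}" using s_sub_disjoint[OF u False] py by blast
      have 2: "p u \<notin> v ` {Suc k..<Suc k + k}" unfolding uV(3) using py r_not_sub_s by blast
      have 3: "s \<in> v ` {Suc k..<Suc k + k}" using k0 by auto
      have 4: "v ` {Suc k..<Suc k + k} \<subseteq> V" using py sub_subset by blast
      have 5: "0 < y s" using y(2)[rule_format, of "Suc k"] k0 by simp
      have 6: "(p u, s) \<in> E" unfolding uV(3) by (rule arcs_r(1))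
      show ?thesis
        by (rule branch_qform_le[OF uV(1,2) y(1) 4 spec[OF y(3)] y(4) 1 2 3 6 5 le z])
    next
      case True
      have 1: "v ` {0..<0 + k} \<inter> sub u = {}" using px dis True by blast
      have 2: "p u \<notin> v ` {0..<0 + k}" unfolding uV(3) using px root_sub[of "v (k - 1)"] lower_top(1,2) by blast
      have 3: "v (k - 1) \<in> v ` {0..<0 + k}" using k0 by auto
      have 4: "v ` {0..<0 + k} \<subseteq> V" using px sub_subset by blast
      have 5: "0 < x (v (k - 1))" using x(2)[rule_format, of "k - 1"] k0 by simp
      have 6: "(p u, v (k - 1)) \<in> E" unfolding uV(3) by (rule arcs_r(2))
      show ?thesis
        by (rule branch_qform_le[OF uV(1,2) x(1) 4 spec[OF x(3)] x(4) 1 2 3 6 5 le z])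
    qed
  qed
  then show "\<And>u y. u \<in> ch r \<Longrightarrow> supp_in (sub u) y \<Longrightarrow> qform E y \<le> ?c * sqn V y" .
  \<comment> \<open>The transplanted Perron vector maximises on the branch of \<open>s\<close>,
    hence is positive on all of it; as it vanishes off the spine, the branch holds nothing else. The
    lower half is treated alike.\<close>
  have sub_s: "sub s \<subseteq> spine"
  proof
    fix u assume "u \<in> sub s"
    then have "0 < y u" using sub_maximiser_pos[OF s_props(1) ys xne(2) spec[OF y(3)] y(4) qs[OF s_props(5)]] by blast
    then have "u \<in> v ` {Suc k..<Suc k + k}" using y(1) unfolding supp_in_def by (metis less_irrefl)
    then show "u \<in> spine" using dk by auto
  qed
  have sub_l: "sub (v (k - 1)) \<subseteq> spine"
  proof
    fix u assume "u \<in> sub (v (k - 1))"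
    then have "0 < x u" using sub_maximiser_pos[OF lower_top(1) xs xne(1) spec[OF x(3)] x(4) qs[OF lower_top(5)]] by blast
    then have "u \<in> v ` {0..<0 + k}" using x(1) unfolding supp_in_def by (metis less_irrefl)
    then show "u \<in> spine" using dk by auto
  qed
  show off_path
    unfolding off_path_def
  proof (intro ballI notI)
    fix u assume u: "u \<in> V - spine" "p u \<in> v ` ({..d} - {k})"
    then obtain i where i: "i \<le> d" "i \<noteq> k" "p u = v i" by auto
    have "u \<noteq> r" "u \<noteq> s" "u \<noteq> v (k - 1)" using u(1) r_spine k_less by auto
    then have "u \<in> sub s \<or> u \<in> sub (v (k - 1))"
      using sub_step[of u s] sub_step[of u "v (k - 1)"] u(1) i upper_sub[of i] lower_sub[of i]
      by (cases "i < k") auto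
    then show False using sub_s sub_l u(1) by blast
  qed
  \<comment> \<open>The two halves are neither adjacent nor overlapping, so the form is diagonal on
    their span.\<close>
  have "?c \<le> eig 2 G"
  proof (rule eig2_ge[OF pair_graph_G])
    show "2 \<le> card (pverts G)" using card_ge_2 by simp
    show "supp_in (pverts G) x" "supp_in (pverts G) y"
      using supp_in_mono[OF xs sub_subset] supp_in_mono[OF ys sub_subset] by auto
    fix a b :: real assume ab: "(a, b) \<noteq> (0, 0)"
    have "x w * y w = 0" for w using xs ys dis by (cases "w \<in> sub s") (auto simp: supp_in_def)
    then have xy: "(\<Sum>w\<in>V. x w * y w) = 0" by (intro sum.neutral) blast
    have bxy: "bform E x y = 0"
      unfolding bform_def
    proof (intro sum.neutral ballI)
      fix e assume e: "e \<in> E"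
      obtain w z where wz: "e = (w, z)" by (cases e)
      have "x w * y z = 0"
      proof (cases "w \<in> sub (v (k - 1))")
        case True
        have "z \<notin> sub s"
          using sub_arc[OF lower_top(1), of w z] e wz True dis lower_top(3) r_not_sub_s by auto
        then show ?thesis using ys by (simp add: supp_in_def)
      qed (use xs in \<open>simp add: supp_in_def\<close>)
      then show "(case e of (w, z) \<Rightarrow> x w * y z) = 0" by (simp add: wz)
    qed
    have s: "sqn V (\<lambda>w. a * x w + b * y w) = a\<^sup>2 * sqn V x + b\<^sup>2 * sqn V y" by (simp add: sqn_comb xy)
    have q: "qform E (\<lambda>w. a * x w + b * y w) = a\<^sup>2 * qform E x + b\<^sup>2 * qform E y"
      by (simp add: qform_comb[OF E_sym] bxy)
    have "a\<^sup>2 * (?c * sqn V x) + b\<^sup>2 * (?c * sqn V y) \<le> a\<^sup>2 * qform E x + b\<^sup>2 * qform E y"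
      using x(4) y(4) by (intro add_mono mult_left_mono) auto
    moreover have "0 < a\<^sup>2 * sqn V x + b\<^sup>2 * sqn V y"
      using ab x(5) y(5) by (cases "a = 0") (auto intro: add_pos_nonneg add_nonneg_pos)
    ultimately show "0 < sqn (pverts G) (\<lambda>v. a * x v + b * y v) \<and>
      ?c * sqn (pverts G) (\<lambda>v. a * x v + b * y v) \<le> qform (parcs G) (\<lambda>v. a * x v + b * y v)"
      by (simp add: s q distrib_left mult.left_commute)
  qed
  then show "eig 2 G = ?c" using le by simp
qed

end

section \<open>Odd diameter\<close>

context rooted_tree
begin

text \<open>A vertex that is too deep has \<open>k + 1\<close> successive ancestors, itself
  included, that avoid \<open>r\<close> and \<open>s\<close>. Going up, the certificate values
  dominate the chain coefficients, which therefore stay positive; this would put the spectral radius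
  of the path on \<open>k + 1\<close> vertices below \<open>c\<close>.\<close>

lemma depth_bound:
  assumes s: "s \<in> V" "s \<noteq> r" "p s = r"
    and S: "\<not> S r" "S s" "\<And>u. u \<in> V \<Longrightarrow> u \<noteq> r \<Longrightarrow> u \<noteq> s \<Longrightarrow> S u = S (p u)"
    and pos: "\<And>u. u \<in> V \<Longrightarrow> u \<noteq> r \<Longrightarrow> u \<noteq> s \<Longrightarrow> 0 < g u"
    and le: "\<And>u. u \<in> V \<Longrightarrow> u \<noteq> r \<Longrightarrow> u \<noteq> s \<Longrightarrow> (\<Sum>w\<in>ch u. g w) + 1 / g u \<le> c"
    and c: "c < eig 1 (path_graph (Suc k))" "0 < c"
    and u: "u \<in> V"
  shows "h u \<le> (if S u then Suc k else k)"
proof (rule ccontr)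
  assume deep: "\<not> ?thesis"
  have hs: "h s = 1" using dep[OF s(1,2)] s(3) root by simp
  \<comment> \<open>On the side of \<open>s\<close> one more level is available before the chain is
    exhausted, since there it is \<open>s\<close>, of depth 1, that must not be reached.\<close>
  have anc: "(p ^^ i) u \<in> V \<and> h ((p ^^ i) u) = h u - i \<and> S ((p ^^ i) u) = S u \<and> (p ^^ i) u \<noteq> r \<and> (p ^^ i) u \<noteq> s"
    if "i \<le> k" for i
    using that
  proof (induction i)
    case 0
    have "u \<noteq> r" "u \<noteq> s" using deep root hs S(1,2) by auto
    then show ?case using u by simp
  next
    case (Suc i)
    let ?a = "(p ^^ i) u"
    have a: "?a \<in> V" "h ?a = h u - i" "S ?a = S u" "?a \<noteq> r" "?a \<noteq> s" using Suc by auto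
    have b: "p ?a \<in> V" "h (p ?a) = h u - Suc i" "S (p ?a) = S u"
      using par[OF a(1,4)] dep[OF a(1,4)] S(3)[OF a(1,4,5)] a by auto
    have "p ?a \<noteq> r" using b deep root Suc.prems by (auto split: if_splits)
    moreover have "p ?a \<noteq> s" using b deep hs S(2) Suc.prems by (auto split: if_splits)
    ultimately show ?case using b by simp
  qed
  have "0 < chain_coeff c i \<and> chain_coeff c i \<le> g ((p ^^ i) u)" if "i \<le> k" for i
    using that
  proof (induction i)
    case 0
    have a: "u \<in> V" "u \<noteq> r" "u \<noteq> s" using anc[of 0] by auto
    have "0 \<le> (\<Sum>w\<in>ch u. g w)"
    proof (intro sum_nonneg)
      fix w assume w: "w \<in> ch u"
      then have "w \<noteq> s" using s(3) a(2) by (auto simp: ch_iff)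
      then show "0 \<le> g w" using pos[of w] w by (simp add: ch_iff less_imp_le)
    qed
    then have "1 / g u \<le> c" using le[OF a] by simp
    then have "1 / c \<le> g u" using pos[OF a] c(2) by (simp add: field_simps)
    then show ?case using c(2) by simp
  next
    case (Suc i)
    let ?a = "(p ^^ i) u"
    have a: "?a \<in> V" "?a \<noteq> r" "?a \<noteq> s" and b: "p ?a \<in> V" "p ?a \<noteq> r" "p ?a \<noteq> s"
      using anc[of i] anc[of "Suc i"] Suc.prems by auto
    have IH: "0 < chain_coeff c i" "chain_coeff c i \<le> g ?a" using Suc by auto
    have "g ?a \<le> (\<Sum>w\<in>ch (p ?a). g w)"
    proof (intro member_le_sum)
      show "?a \<in> ch (p ?a)" using a by (simp add: ch_iff)
      fix w assume w: "w \<in> ch (p ?a) - {?a}"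
      then have "w \<noteq> s" using s(3) b(2) by (auto simp: ch_iff)
      then show "0 \<le> g w" using pos[of w] w by (simp add: ch_iff less_imp_le)
    qed simp
    then have "g ?a + 1 / g (p ?a) \<le> c" using le[OF b] by simp
    then have 1: "1 / g (p ?a) \<le> c - chain_coeff c i" using IH(2) by simp
    moreover have gp: "0 < g (p ?a)" by (rule pos[OF b])
    ultimately have 2: "0 < c - chain_coeff c i" by (meson less_le_trans zero_less_divide_1_iff)
    have "1 \<le> (c - chain_coeff c i) * g (p ?a)" using 1 gp by (simp add: divide_le_eq)
    then have "1 / (c - chain_coeff c i) \<le> g (p ?a)" using 2 by (simp add: divide_le_eq mult.commute)
    then show ?case using 2 by (simp add: chain_coeff.simps(2))
  qed
  then have "eig 1 (path_graph (Suc k)) < c" by (intro eig1_path_less) blast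
  then show False using c(1) by simp
qed

lemma bare_chain:
  assumes "u \<in> V" "\<And>x. x \<in> V \<Longrightarrow> h u \<le> h x \<Longrightarrow> card (ch x) \<le> 1"
  shows "\<exists>m e. e 0 = u \<and> (\<forall>i<m. ch (e i) = {e (Suc i)}) \<and> ch (e m) = {}"
  using assms
proof (induction "Max (h ` V) - h u" arbitrary: u rule: less_induct)
  case less
  show ?case
  proof (cases "ch u = {}")
    case True
    then show ?thesis by (intro exI[of _ 0] exI[of _ "\<lambda>_. u"]) simp
  next
    case False
    moreover have "card (ch u) \<le> 1" using less.prems by simp
    moreover have "card (ch u) \<noteq> 0" using False by simp
    ultimately have "card (ch u) = 1" by linarith
    then obtain w where w: "ch u = {w}" by (rule card_1_singletonE)
    then have wu: "w \<in> ch u" by simp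
    have wV: "w \<in> V" "h w = Suc (h u)" using wu child_depth[OF wu] by (auto simp: ch_iff)
    have "h w \<le> Max (h ` V)" using wV(1) fin by simp
    then have "Max (h ` V) - h w < Max (h ` V) - h u" using wV(2) by simp
    then obtain m e where e: "e 0 = w" "\<forall>i<m. ch (e i) = {e (Suc i)}" "ch (e m) = {}"
      using less.hyps[of w] wV less.prems(2) by (metis Suc_leD)
    define e' where "e' i = (case i of 0 \<Rightarrow> u | Suc j \<Rightarrow> e j)" for i
    have "ch (e' i) = {e' (Suc i)}" if "i < Suc m" for i
      using that e w by (cases i) (auto simp: e'_def)
    then show ?thesis using e(3) by (intro exI[of _ "Suc m"] exI[of _ e']) (simp add: e'_def)
  qed
qed

lemma bare_chain_props:
  assumes u: "u \<in> V" and e: "e 0 = u" "\<And>i. i < m \<Longrightarrow> ch (e i) = {e (Suc i)}" "i \<le> m"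
  shows "e i \<in> V" "h (e i) = h u + i"
proof -
  have "e i \<in> V \<and> h (e i) = h u + i"
    using e(3)
  proof (induction i)
    case (Suc i)
    then have "e (Suc i) \<in> ch (e i)" using e(2)[of i] by simp
    then show ?case using child_depth[of "e (Suc i)" "e i"] Suc by (auto simp: ch_iff)
  qed (use u e(1) in simp)
  then show "e i \<in> V" "h (e i) = h u + i" by auto
qed

text \<open>Without slack the recursion determines the certificate from the leaf upwards. Positions
  count from the top of the chain and coefficients from its end, hence the reversal
  \<open>m - i\<close>.\<close>

lemma bare_chain_coeff:
  assumes e: "\<And>i. i < m \<Longrightarrow> ch (e i) = {e (Suc i)}" "ch (e m) = {}"
    and g: "\<And>i. i \<le> m \<Longrightarrow> (\<Sum>w\<in>ch (e i). g w) + 1 / g (e i) = c" "\<And>i. i \<le> m \<Longrightarrow> 0 < g (e i)"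
    and i: "i \<le> m"
  shows "g (e (m - i)) = chain_coeff c i"
  using i
proof (induction i)
  case 0
  have "1 / g (e m) = c" using g(1)[of m] e(2) by simp
  then have "g (e m) = 1 / c" by (metis divide_divide_eq_right mult_1 div_by_1)
  then show ?case by simp
next
  case (Suc i)
  have "ch (e (m - Suc i)) = {e (m - i)}" using e(1)[of "m - Suc i"] Suc.prems by (simp add: Suc_diff_Suc)
  then have "g (e (m - i)) + 1 / g (e (m - Suc i)) = c" using g(1)[of "m - Suc i"] by simp
  then have "1 / g (e (m - Suc i)) = c - chain_coeff c i" using Suc by simp
  then have "g (e (m - Suc i)) = 1 / (c - chain_coeff c i)" by (metis divide_divide_eq_right mult_1 div_by_1)
  then show ?case by (simp add: chain_coeff.simps(2))
qed

end

context spined_tree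
begin

lemma off_path_ch:
  assumes off: off_path
  shows "0 < i \<Longrightarrow> i < k \<Longrightarrow> ch (v i) = {v (i - 1)}" "ch (v 0) = {}"
    "k < i \<Longrightarrow> i < d \<Longrightarrow> ch (v i) = {v (Suc i)}" "ch (v d) = {}"
proof -
  have sub: "u = (if i < k then v (i - 1) else v (Suc i)) \<and> i \<noteq> 0 \<and> i < d"
    if i: "i \<le> d" "i \<noteq> k" and u: "u \<in> ch (v i)" for i u
  proof -
    have uV: "u \<in> V" "u \<noteq> r" "p u = v i" using u by (auto simp: ch_iff)
    then have "u \<in> spine" using off i unfolding off_path_def by auto
    then obtain j where j: "j \<le> d" "u = v j" by auto
    then have jk: "j \<noteq> k" using uV vr by auto
    show ?thesis
    proof (cases "j < k")
      case True
      then have "i = Suc j" using lower[OF True] uV j veq[of "Suc j" i] i k_less by auto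
      then show ?thesis using True i j k_less by auto
    next
      case False
      then obtain l where l: "j = Suc l" "k \<le> l" "l < d" using jk j by (cases j) auto
      then have "i = l" using upper[of l] uV j veq[of l i] i by auto
      then show ?thesis using l i j by auto
    qed
  qed
  have "u \<notin> ch (v 0)" for u using sub[of 0 u] k0 by linarith
  then show "ch (v 0) = {}" by blast
  have "u \<notin> ch (v d)" for u using sub[of d u] k_less by linarith
  then show "ch (v d) = {}" by blast
  show "ch (v i) = {v (i - 1)}" if "0 < i" "i < k"
  proof (rule Set.set_eqI)
    fix u
    have "v (i - 1) \<in> ch (v i)" using lower[of "i - 1"] vV[of "i - 1"] vr[of "i - 1"] that k_less by (simp add: ch_iff)
    moreover have "u = v (i - 1)" if "u \<in> ch (v i)" using sub[OF _ _ that] \<open>i < k\<close> k_less by simp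
    ultimately show "u \<in> ch (v i) \<longleftrightarrow> u \<in> {v (i - 1)}" by blast
  qed
  show "ch (v i) = {v (Suc i)}" if "k < i" "i < d"
  proof (rule Set.set_eqI)
    fix u
    have "v (Suc i) \<in> ch (v i)" using upper[of i] vV[of "Suc i"] vr[of "Suc i"] that by (simp add: ch_iff)
    moreover have "u = v (Suc i)" if "u \<in> ch (v i)" using sub[OF _ _ that] \<open>k < i\<close> \<open>i < d\<close> by simp
    ultimately show "u \<in> ch (v i) \<longleftrightarrow> u \<in> {v (Suc i)}" by blast
  qed
qed

text \<open>Cutting the middle edge leaves two paths on \<open>k + 1\<close> vertices; ratios of
  their Perron vectors form a certificate on both halves. The spare freedom is the value at
  \<open>s\<close>, which may be as negative as the pendant vertices at \<open>r\<close>
  require.\<close>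

lemma star_eig2_less:
  assumes "odd d"
  shows "eig 2 (parent_graph V r star_parent) < eig 1 (path_graph (Suc k))"
proof -
  interpret S: spined_tree V r star_parent star_depth v d k by (rule star_spined)
  let ?c = "eig 1 (path_graph (Suc k))"
  have dk: "d = Suc (k + k)" using assms kd by (auto elim!: oddE)
  have c: "0 < ?c" using eig1_path_pos[of "Suc k"] k0 by simp
  obtain y where y: "supp_in {..<Suc k} y" "\<forall>i<Suc k. 0 < y i"
    "\<forall>i<Suc k. (if i = 0 then 0 else y (i - 1)) + y (Suc i) = ?c * y i"
    using path_graph_eigenvector[OF zero_less_Suc[of k]] by blast
  have yz: "y (Suc k) = 0" using y(1) by (simp add: supp_in_def)
  have ypos: "0 < y i" if "i \<le> k" for i using y(2) that by simp
  have "y (Suc 0) = ?c * y 0" using y(3)[rule_format, of 0] by simp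
  then have y1: "y (Suc 0) / y 0 = ?c" using ypos[of 0] by simp
  have ystep: "y (Suc (Suc j)) / y (Suc j) + 1 / (y (Suc j) / y j) = ?c" if j: "Suc j \<le> k" for j
  proof -
    have p: "0 < y (Suc j)" by (rule ypos[OF j])
    have "y j + y (Suc (Suc j)) = ?c * y (Suc j)" using y(3)[rule_format, of "Suc j"] j by simp
    then have "(y (Suc (Suc j)) + y j) / y (Suc j) = ?c" using p by (simp add: nonzero_divide_eq_eq add.commute)
    then show ?thesis by (simp add: add_divide_distrib)
  qed
  define idx where "idx u = the_inv_into {..d} v u" for u
  have idx: "idx (v i) = i" if "i \<le> d" for i
    unfolding idx_def using inj that by (intro the_inv_into_f_f) auto
  define f where "f j = y (Suc j) / y j" for j
  \<comment> \<open>At \<open>r\<close> the lower half contributes exactly \<open>?c\<close> and the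
    pendant vertices at most \<open>card V / ?c\<close>, so this choice leaves slack at least 1
    there.\<close>
  define M where "M = real (card V) / ?c + 1"
  have M: "0 < M" using c by (simp add: M_def add_nonneg_pos)
  \<comment> \<open>From the neighbour of \<open>r\<close> or \<open>s\<close> outwards each half
    carries \<open>f 0\<close> to \<open>f (k - 1)\<close>; the value \<open>f k = 0\<close> plays
    the missing child at the end of the spine. Pendant vertices get the coefficient of a one-vertex
    chain.\<close>
  define g where "g u = (if u = s then - M else if u \<in> spine then
    (if idx u < k then f (k - Suc (idx u)) else f (idx u - Suc (Suc k))) else 1 / ?c)" for u
  have gs: "g s = - M" by (simp add: g_def)
  have gl: "g (v i) = f (k - Suc i)" if "i < k" for i
    using that idx[of i] veq[of i "Suc k"] k_less by (simp add: g_def)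
  have gu: "g (v i) = f (i - Suc (Suc k))" if "Suc k < i" "i \<le> d" for i
    using that idx[of i] veq[of i "Suc k"] k_less by (simp add: g_def)
  have gn: "g u = 1 / ?c" if "u \<notin> spine" for u
    using that k_less by (auto simp: g_def)
  have fpos: "0 < f j" if "j < k" for j using ypos[of j] ypos[of "Suc j"] that by (simp add: f_def)
  have fstep: "f (Suc j) + 1 / f j = ?c" if "Suc j \<le> k" for j
    using ystep[OF that] by (simp add: f_def)
  have fk: "f k = 0" using yz by (simp add: f_def)
  have cases: "P u" if u: "u \<in> V" "u \<noteq> r" "u \<noteq> s" and
    P: "\<And>i. i < k \<Longrightarrow> P (v i)" "\<And>i. Suc k < i \<Longrightarrow> i \<le> d \<Longrightarrow> P (v i)" "\<And>u. u \<in> V \<Longrightarrow> u \<notin> spine \<Longrightarrow> P u" for P u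
  proof (cases "u \<in> spine")
    case True
    then obtain i where i: "i \<le> d" "u = v i" by auto
    then have "i \<noteq> k" "i \<noteq> Suc k" using u rv by auto
    then show ?thesis using P(1)[of i] P(2)[of i] i by (cases "i < k") auto
  qed (use P(3) u in blast)
  show ?thesis
  proof (rule S.certificate_eig2_less[OF s_props(1,2), where g = g and w = r])
    show "0 < g u" if "u \<in> V" "u \<noteq> r" "u \<noteq> s" for u
      using that
    proof (rule cases)
      show "0 < g (v i)" if "i < k" for i using gl[OF that] fpos that by simp
      show "0 < g (v i)" if "Suc k < i" "i \<le> d" for i using gu[OF that] fpos[of "i - Suc (Suc k)"] that dk by simp
      show "0 < g u" if "u \<notin> spine" for u using gn[OF that] c by simp
    qed
    show "g s < 0" using gs M by simp
    show "r \<in> V" by (rule root)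
    have root_less: "(\<Sum>u\<in>S.ch r. g u) < ?c"
    proof -
      have sl: "s \<in> S.ch r" "v (k - 1) \<in> S.ch r - {s}" using S.s_props(5) S.lower_top(5,6) by auto
      have "(\<Sum>u\<in>S.ch r. g u) = g s + (g (v (k - 1)) + (\<Sum>u\<in>S.ch r - {s} - {v (k - 1)}. g u))"
        unfolding sum.remove[OF S.fin_ch sl(1)] sum.remove[OF finite_Diff[OF S.fin_ch] sl(2)] ..
      also have "(\<Sum>u\<in>S.ch r - {s} - {v (k - 1)}. g u) = (\<Sum>u\<in>S.ch r - {s} - {v (k - 1)}. 1 / ?c)"
      proof (rule sum.cong)
        fix u assume u: "u \<in> S.ch r - {s} - {v (k - 1)}"
        then have "u \<notin> spine" using S.ch_spine by blast
        then show "g u = 1 / ?c" by (rule gn)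
      qed simp
      also have "\<dots> = real (card (S.ch r - {s} - {v (k - 1)})) / ?c" by simp
      also have "\<dots> \<le> real (card V) / ?c"
      proof -
        have "card (S.ch r - {s} - {v (k - 1)}) \<le> card V"
          using fin by (intro card_mono) (auto simp: S.ch_iff)
        then show ?thesis using c by (intro divide_right_mono) auto
      qed
      also have "g (v (k - 1)) = ?c" using gl[of "k - 1"] k0 y1 by (simp add: f_def)
      finally show ?thesis using gs by (simp add: M_def)
    qed
    then show "(\<Sum>u\<in>S.ch r. g u) + (if r = r then 0 else 1 / g r) < ?c" by simp
    show "(\<Sum>w\<in>S.ch u. g w) + (if u = r then 0 else 1 / g u) \<le> ?c" if u: "u \<in> V" for u
    proof (cases "u = r")
      case True
      then show ?thesis using root_less by simp
    next
      case ur: False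
      note chs = S.off_path_ch[OF star_off_path]
      have "(\<Sum>w\<in>S.ch u. g w) + 1 / g u \<le> ?c"
      proof (cases "u = s")
        case True
        have "S.ch s = {v (Suc (Suc k))}" using chs(3)[of "Suc k"] dk k0 by simp
        moreover have "g (v (Suc (Suc k))) = ?c" using gu[of "Suc (Suc k)"] dk k0 y1 by (simp add: f_def)
        ultimately show ?thesis using True gs M by simp
      next
        case False
        with u ur show ?thesis
        proof (rule cases)
          fix i assume i: "i < k"
          show "(\<Sum>w\<in>S.ch (v i). g w) + 1 / g (v i) \<le> ?c"
          proof (cases "i = 0")
            case True
            then show ?thesis using chs(2) gl[OF i] fstep[of "k - Suc 0"] fk k0 by simp
          next
            case False
            have "g (v (i - 1)) = f (Suc (k - Suc i))" using gl[of "i - 1"] i False by (simp add: Suc_diff_Suc)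
            then show ?thesis using chs(1)[of i] gl[OF i] fstep[of "k - Suc i"] i False by simp
          qed
        next
          fix i assume i: "Suc k < i" "i \<le> d"
          show "(\<Sum>w\<in>S.ch (v i). g w) + 1 / g (v i) \<le> ?c"
          proof (cases "i = d")
            case True
            then show ?thesis using chs(4) gu[OF i] fstep[of "k - Suc 0"] fk k0 dk by simp
          next
            case False
            have "g (v (Suc i)) = f (Suc (i - Suc (Suc k)))" 
              using gu[of "Suc i"] i False Suc_diff_Suc[of "Suc k" i] by simp
            then show ?thesis using chs(3)[of i] gu[OF i] fstep[of "i - Suc (Suc k)"] i False dk by simp
          qed
        next
          fix u assume u: "u \<in> V" "u \<notin> spine"
          have "S.ch u = {}"
          proof (rule ccontr)
            assume "S.ch u \<noteq> {}"
            then obtain w where "w \<in> S.ch u" by blast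
            then have "star_parent w = u" "w \<noteq> r" by (simp_all add: S.ch_iff)
            then show False using u(2) spine_par[of w] r_spine by (auto simp: star_parent_def split: if_splits)
          qed
          then show "(\<Sum>w\<in>S.ch u. g w) + 1 / g u \<le> ?c" using gn[OF u(2)] by simp
        qed
      qed
      then show ?thesis using ur by simp
    qed
  qed
qed

end

section \<open>Minimisers of odd diameter\<close>

locale odd_optimal = spined_tree V r p h v d k for V :: "'a set" and r p h v d k +
  assumes odd_d: "odd d"
    and opt: "(T' :: 'a pair_pre_digraph) \<in> trees (card V) d \<Longrightarrow> eig 2 (parent_graph V r p) \<le> eig 2 T'"
begin

abbreviation "\<mu> \<equiv> eig 2 G"
abbreviation "\<rho> \<equiv> eig 1 (path_graph (Suc k))"

lemma dk: "d = Suc (k + k)"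
  using odd_d kd by (auto elim!: oddE)

lemma dk': "d - k = Suc k" "k + 2 \<le> d" "Suc (Suc k) \<le> d"
  using dk k0 by auto

lemma \<mu>_less: "\<mu> < \<rho>"
  using opt[OF star_trees] star_eig2_less[OF odd_d] by simp

text \<open>The middle edge splits the spine into two paths on \<open>k + 1\<close> vertices, one
  ending in \<open>r\<close> and one in \<open>s\<close>; their spectral radius \<rho> exceeds
  \<mu>, so both Perron vectors beat \<mu> strictly.\<close>

lemma segments:
  obtains x y where "supp_in (v ` {0..<0 + Suc k}) x" "0 < x r" "\<forall>u. 0 \<le> x u" "\<mu> * sqn V x < qform E x"
    "supp_in (v ` {Suc k..<Suc k + Suc k}) y" "0 < y s" "\<forall>u. 0 \<le> y u" "\<mu> * sqn V y < qform E y"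
proof -
  have strict: "\<mu> * sqn V x < qform E x" if "\<rho> * sqn V x \<le> qform E x" "0 < sqn V x" for x
    using mult_strict_right_mono[OF \<mu>_less that(2)] that(1) by simp
  have seg: "0 + Suc k \<le> Suc d" "Suc k + Suc k \<le> Suc d" using dk by auto
  obtain x where x: "supp_in (v ` {0..<0 + Suc k}) x" "\<forall>i. 0 \<le> i \<and> i < 0 + Suc k \<longrightarrow> 0 < x (v i)" "\<forall>u. 0 \<le> x u"
    "\<rho> * sqn V x \<le> qform E x" "0 < sqn V x"
    using spine_vec[OF seg(1) zero_less_Suc] by blast
  obtain y where y: "supp_in (v ` {Suc k..<Suc k + Suc k}) y" "\<forall>i. Suc k \<le> i \<and> i < Suc k + Suc k \<longrightarrow> 0 < y (v i)" "\<forall>u. 0 \<le> y u"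
    "\<rho> * sqn V y \<le> qform E y" "0 < sqn V y"
    using spine_vec[OF seg(2) zero_less_Suc] by blast
  have "0 < x r" using x(2)[rule_format, of k] rv by simp
  moreover have "0 < y s" using y(2)[rule_format, of "Suc k"] by simp
  ultimately show ?thesis
    using that[OF x(1) _ x(3) strict[OF x(4,5)] y(1) _ y(3) strict[OF y(4,5)]] by blast
qed

lemma lower_seg: "v ` {0..<0 + Suc k} \<subseteq> V" "v ` {0..<0 + Suc k} \<inter> sub s = {}" "r \<in> v ` {0..<0 + Suc k}"
proof -
  show "v ` {0..<0 + Suc k} \<subseteq> V" using vV k_less by auto
  show "v ` {0..<0 + Suc k} \<inter> sub s = {}" using lower_not_sub by auto
  show "r \<in> v ` {0..<0 + Suc k}" unfolding rv by simp
qed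

lemma upper_seg: "v ` {Suc k..<Suc k + Suc k} \<subseteq> sub s" "s \<in> v ` {Suc k..<Suc k + Suc k}"
proof
  fix u assume "u \<in> v ` {Suc k..<Suc k + Suc k}"
  then obtain i where "u = v i" "Suc k \<le> i" "i \<le> d" using dk by auto
  then show "u \<in> sub s" using upper_sub by simp
qed simp

text \<open>A branch at \<open>r\<close> faces the upper half, which is adjacent to \<open>r\<close>
  through \<open>s\<close>; a branch at \<open>s\<close> faces the lower half through
  \<open>r\<close>.\<close>

lemma branch_less:
  assumes u: "u \<in> ch r \<and> u \<noteq> s \<or> u \<in> ch s" and z: "supp_in (sub u) z" "z \<noteq> (\<lambda>_. 0)"
  shows "qform E z < \<mu> * sqn V z"
proof -
  obtain x y where x: "supp_in (v ` {0..<0 + Suc k}) x" "0 < x r" "\<forall>u. 0 \<le> x u" "\<mu> * sqn V x < qform E x"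
    and y: "supp_in (v ` {Suc k..<Suc k + Suc k}) y" "0 < y s" "\<forall>u. 0 \<le> y u" "\<mu> * sqn V y < qform E y"
    by (rule segments)
  from u show ?thesis
  proof
    assume u: "u \<in> ch r \<and> u \<noteq> s"
    then have uV: "u \<in> V" "u \<noteq> r" "p u = r" by (auto simp: ch_iff)
    have 1: "v ` {Suc k..<Suc k + Suc k} \<inter> sub u = {}" using s_sub_disjoint[of u] u upper_seg by blast
    have 2: "p u \<notin> v ` {Suc k..<Suc k + Suc k}" unfolding uV(3) using upper_seg r_not_sub_s by blast
    have 3: "v ` {Suc k..<Suc k + Suc k} \<subseteq> V" using upper_seg sub_subset by blast
    have 4: "(p u, s) \<in> E" unfolding uV(3) using s_props by (simp add: arcs_iff)
    show ?thesis
      by (rule branch_qform_less[OF uV(1,2) y(1) 3 spec[OF y(3)] y(4) 1 2 upper_seg(2) 4 y(2) order_refl z])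
  next
    assume u: "u \<in> ch s"
    then have uV: "u \<in> V" "u \<noteq> r" "p u = s" by (auto simp: ch_iff)
    have 1: "v ` {0..<0 + Suc k} \<inter> sub u = {}" using sub_child_subset[OF s_props(1) u] lower_seg(2) by blast
    have 2: "p u \<notin> v ` {0..<0 + Suc k}" unfolding uV(3) using lower_seg(2) sub_self[OF s_props(1)] by blast
    have 4: "(p u, r) \<in> E" unfolding uV(3) using s_props by (simp add: arcs_iff)
    show ?thesis
      by (rule branch_qform_less[OF uV(1,2) x(1) lower_seg(1) spec[OF x(3)] x(4) 1 2 lower_seg(3) 4 x(2) order_refl z])
  qed
qed

text \<open>The indicator of a single vertex has form zero, yet it lies in a branch where \<mu>
  times the norm strictly exceeds the form.\<close>

lemma \<mu>_pos: "0 < \<mu>"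
proof -
  let ?u = "v (k - 1)"
  define z where "z w = (if w = ?u then 1 else 0 :: real)" for w
  have supp: "supp_in (sub ?u) z" using sub_self[OF lower_top(1)] by (auto simp: supp_in_def z_def)
  have ne: "z \<noteq> (\<lambda>_. 0)" by (auto simp: z_def fun_eq_iff)
  have "z w * z (p w) = 0" if "w \<in> V - {r}" for w
    using par_neq[of w] that by (auto simp: z_def)
  then have "qform E z = 0" unfolding qform_parent by (simp add: sum.neutral)
  moreover have "qform E z < \<mu> * sqn V z" using branch_less[OF _ supp ne] lower_top(5,6) by blast
  ultimately have "0 < \<mu> * sqn V z" by simp
  then show ?thesis using sqn_nonneg[of V z] by (simp add: zero_less_mult_iff)
qed

lemma above_spectrum:
  assumes "\<And>x. qform E x \<le> \<mu> * sqn V x"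
  shows False
proof -
  obtain x y where "supp_in (v ` {0..<0 + Suc k}) x" "0 < x r" "\<forall>u. 0 \<le> x u" "\<mu> * sqn V x < qform E x"
    and "supp_in (v ` {Suc k..<Suc k + Suc k}) y" "0 < y s" "\<forall>u. 0 \<le> y u" "\<mu> * sqn V y < qform E y"
    by (rule segments)
  then show False using assms[of x] by simp
qed

text \<open>The ratios \<open>z u / z (p u)\<close> of an eigenvector for \<open>\<lambda>\<^sub>2\<close>; the sign changes only across the
  edge \<open>r s\<close>.\<close>

lemma certificate_exists:
  "\<exists>g. (\<forall>u\<in>V. u \<noteq> r \<longrightarrow> u \<noteq> s \<longrightarrow> 0 < g u) \<and> g s < 0 \<and>
    (\<forall>u\<in>V. (\<Sum>w\<in>ch u. g w) + (if u = r then 0 else 1 / g u) = \<mu>)"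
proof -
  have card: "2 \<le> card (pverts G)" using card_ge_2 by simp
  obtain z0 where z0: "supp_in V z0" "sqn V z0 = 1" "\<forall>u\<in>V. adj_app E z0 u = \<mu> * z0 u"
    using eig2_eigenvector[OF pair_graph_G card] by auto
  \<comment> \<open>The sign is normalised at \<open>r\<close>.\<close>
  define z where "z = (if 0 \<le> z0 r then z0 else (\<lambda>u. - z0 u))"
  have neg: "adj_app E (\<lambda>u. - x u) w = - adj_app E x w" for x w by (simp add: adj_app_def sum_negf)
  have zr: "0 \<le> z r" by (simp add: z_def)
  have zev: "adj_app E z u = \<mu> * z u" if "u \<in> V" for u using z0(3) that by (simp add: z_def neg)
  have zne: "\<exists>u\<in>V. z u \<noteq> 0"
  proof (rule ccontr)
    assume "\<not> ?thesis"
    then have "\<forall>u\<in>V. z0 u = 0" by (auto simp: z_def split: if_splits)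
    then show False using z0(2) by (simp add: sqn_def)
  qed
  have zeq: "(if u = r then 0 else z (p u)) + (\<Sum>w\<in>ch u. z w) = \<mu> * z u" if "u \<in> V" for u
    using zev[OF that] adj_app_parent[OF that, of z] by simp
  have br: "u \<in> V" "u \<noteq> r" "\<And>x. supp_in (sub u) x \<Longrightarrow> x \<noteq> (\<lambda>_. 0) \<Longrightarrow> qform E x < \<mu> * sqn V x"
    if "u \<in> ch r \<and> u \<noteq> s \<or> u \<in> ch s" for u
    using that branch_less[OF that] by (auto simp: ch_iff)
  have zsub: "\<And>w. w \<in> sub u \<Longrightarrow> adj_app E z w = \<mu> * z w" "\<And>w. w \<in> sub u \<Longrightarrow> adj_app E (\<lambda>u. - z u) w = \<mu> * - z w" for u
    using zev sub_subset by (auto simp: neg)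
  \<comment> \<open>With boundary value zero the minimum principle applies to both \<open>z\<close>
    and its negative.\<close>
  have zero: "z w = 0" if u: "u \<in> ch r \<and> u \<noteq> s \<or> u \<in> ch s" and pu: "z (p u) = 0" and w: "w \<in> sub u" for u w
  proof -
    have "0 \<le> z w"
      using sub_eigenvector_nonneg[OF br(1,2)[OF u] zsub(1)[of _ u] _ br(3)[OF u] w] pu by simp
    moreover have "0 \<le> - z w"
      using sub_eigenvector_nonneg[OF br(1,2)[OF u] zsub(2)[of _ u] _ br(3)[OF u] w] pu by simp
    ultimately show ?thesis by simp
  qed
  have pos: "0 < z w" if u: "u \<in> ch r \<and> u \<noteq> s \<or> u \<in> ch s" and pu: "0 < z (p u)" and w: "w \<in> sub u" for u w
    by (rule sub_eigenvector_pos[OF br(1,2)[OF u] zsub(1)[of _ u] pu br(3)[OF u] \<mu>_pos w])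
  have negs: "z w < 0" if u: "u \<in> ch r \<and> u \<noteq> s \<or> u \<in> ch s" and pu: "z (p u) < 0" and w: "w \<in> sub u" for u w
    using sub_eigenvector_pos[OF br(1,2)[OF u] zsub(2)[of _ u] _ br(3)[OF u] \<mu>_pos w] pu by simp
  \<comment> \<open>Inside \<open>sub s\<close> the branches are first found in the subtree rooted
    at \<open>s\<close> and then identified with those of the whole tree.\<close>
  have cover: "u = r \<or> u = s \<or> (\<exists>w. w \<in> ch r \<and> w \<noteq> s \<and> u \<in> sub w) \<or> (\<exists>w. w \<in> ch s \<and> u \<in> sub w)" if uV: "u \<in> V" for u
  proof (cases "u = r")
    case False
    then obtain w where w: "w \<in> ch r" "u \<in> sub w" using sub_cover[OF uV False] by blast
    show ?thesis
    proof (cases "w = s")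
      case True
      interpret S: rooted_tree "sub s" s p "\<lambda>u. h u - h s" by (rule sub_rooted[OF s_props(1)])
      show ?thesis
      proof (cases "u = s")
        case us: False
        then obtain w' where w': "w' \<in> S.ch s" "u \<in> S.sub w'" using S.sub_cover w(2) True by blast
        have "w' \<in> sub s" "w' \<noteq> s" "p w' = s" using w'(1) by (auto simp: S.ch_iff)
        then have "w' \<in> ch s" using sub_subset root_sub[of s] s_props(1,2) by (auto simp: ch_iff)
        moreover have "u \<in> sub w'"
        proof -
          have wV: "w' \<in> V" using \<open>w' \<in> ch s\<close> by (simp add: ch_iff)
          show ?thesis using \<open>w' \<in> sub s\<close> w'(2)
          proof (induction rule: S.sub_induct)
            case self
            then show ?case using sub_self wV by blast
          next
            case (step x)
            have "x \<in> V" "x \<noteq> r" using step(1) sub_subset root_sub[of s] s_props(1,2) by auto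
            then show ?case using sub_step[of x w'] step(3,6) by blast
          qed
        qed
        ultimately show ?thesis by blast
      qed simp
    qed (use w in blast)
  qed simp
  have sum_r: "(\<Sum>w\<in>ch r. z w) = z s + (\<Sum>w\<in>ch r - {s}. z w)"
    by (rule sum.remove[OF fin_ch s_props(5)])
  \<comment> \<open>A zero at \<open>r\<close> kills the branches at \<open>r\<close>; the equation
    at \<open>r\<close> then gives a zero at \<open>s\<close>, which kills the branches at
    \<open>s\<close>.\<close>
  have zr0: "z r \<noteq> 0"
  proof
    assume r0: "z r = 0"
    have 1: "z w = 0" if "u \<in> ch r" "u \<noteq> s" "w \<in> sub u" for u w
      using zero[of u w] that r0 by (auto simp: ch_iff)
    have "(\<Sum>w\<in>ch r - {s}. z w) = 0"
    proof (intro sum.neutral ballI)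
      fix w assume "w \<in> ch r - {s}"
      then show "z w = 0" using 1[of w w] sub_self by (auto simp: ch_iff)
    qed
    then have s0: "z s = 0" using zeq[OF root(1)] sum_r r0 by simp
    have 2: "z w = 0" if "u \<in> ch s" "w \<in> sub u" for u w
      using zero[of u w] that s0 by (auto simp: ch_iff)
    show False using zne cover 1 2 r0 s0 by metis
  qed
  then have zr: "0 < z r" using zr by simp
  have A: "0 < z w" if "u \<in> ch r" "u \<noteq> s" "w \<in> sub u" for u w
    using pos[of u w] that zr by (auto simp: ch_iff)
  have eq_s: "z r + (\<Sum>w\<in>ch s. z w) = \<mu> * z s" using zeq[OF s_props(1)] s_props by simp
  \<comment> \<open>A zero at \<open>s\<close> contradicts the equation there. A positive value
    makes \<open>z\<close> positive everywhere, so its ratios bound the whole form by \<mu>,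
    although the halves of the spine exceed \<mu>.\<close>
  have zs: "z s < 0"
  proof (rule ccontr)
    assume "\<not> ?thesis"
    then consider "z s = 0" | "0 < z s" by linarith
    then show False
    proof cases
      case 1
      have "(\<Sum>w\<in>ch s. z w) = 0"
      proof (intro sum.neutral ballI)
        fix w assume w: "w \<in> ch s"
        then have "p w = s" "w \<in> sub w" using sub_self by (auto simp: ch_iff)
        then show "z w = 0" using zero[of w w] w 1 by simp
      qed
      then show False using eq_s 1 zr by simp
    next
      case 2
      have B: "0 < z w" if "u \<in> ch s" "w \<in> sub u" for u w
        using pos[of u w] that 2 by (auto simp: ch_iff)
      have zpos: "0 < z u" if "u \<in> V" for u
        using cover[OF that] A B zr 2 by blast
      define g where "g u = z u / z (p u)" for u
      have "qform E x \<le> \<mu> * sqn V x" for x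
      proof (rule qform_le_certificate[of g])
        show "0 < g u" if "u \<in> V" "u \<noteq> r" for u using zpos par that by (simp add: g_def)
        show "(\<Sum>w\<in>ch u. g w) + (if u = r then 0 else 1 / g u) \<le> \<mu>" if u: "u \<in> V" for u
        proof -
          have "(\<Sum>w\<in>ch u. g w) = (\<Sum>w\<in>ch u. z w) / z u"
            unfolding sum_divide_distrib by (intro sum.cong) (auto simp: g_def ch_iff)
          then have "(\<Sum>w\<in>ch u. g w) + (if u = r then 0 else 1 / g u) =
            ((if u = r then 0 else z (p u)) + (\<Sum>w\<in>ch u. z w)) / z u"
            by (simp add: g_def add_divide_distrib)
          also have "\<dots> = \<mu>" unfolding zeq[OF u] using zpos[OF u] by simp
          finally show ?thesis by simp
        qed
      qed
      then show False by (rule above_spectrum)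
    qed
  qed
  have B: "z w < 0" if "u \<in> ch s" "w \<in> sub u" for u w
    using negs[of u w] that zs by (auto simp: ch_iff)
  have nz: "z u \<noteq> 0" if "u \<in> V" for u
    using cover[OF that] A B zr zs by (metis less_irrefl)
  define g where "g u = z u / z (p u)" for u
  have "(\<Sum>w\<in>ch u. g w) + (if u = r then 0 else 1 / g u) = \<mu>" if u: "u \<in> V" for u
  proof -
    have "(\<Sum>w\<in>ch u. g w) = (\<Sum>w\<in>ch u. z w) / z u"
      unfolding sum_divide_distrib by (intro sum.cong) (auto simp: g_def ch_iff)
    then have "(\<Sum>w\<in>ch u. g w) + (if u = r then 0 else 1 / g u) =
      ((if u = r then 0 else z (p u)) + (\<Sum>w\<in>ch u. z w)) / z u"
      by (simp add: g_def add_divide_distrib)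
    also have "\<dots> = \<mu>" unfolding zeq[OF u] using nz[OF u] by simp
    finally show ?thesis .
  qed
  moreover have "g s < 0" using zs zr s_props(3) by (simp add: g_def divide_neg_pos)
  moreover have "0 < g u" if u: "u \<in> V" "u \<noteq> r" "u \<noteq> s" for u
  proof -
    consider w where "w \<in> ch r" "w \<noteq> s" "u \<in> sub w" | w where "w \<in> ch s" "u \<in> sub w"
      using cover[OF u(1)] u by blast
    then show ?thesis
    proof cases
      case (1 w)
      have "0 < z (p u)"
      proof (cases "u = w")
        case True
        then show ?thesis using zr 1(1) by (simp add: ch_iff)
      next
        case False
        then show ?thesis using A[OF 1(1,2)] sub_step[OF u(1,2) False] 1(3) by blast
      qed
      then show ?thesis using A[OF 1] by (simp add: g_def)
    next
      case (2 w)
      have "z (p u) < 0"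
      proof (cases "u = w")
        case True
        then show ?thesis using zs 2(1) by (simp add: ch_iff)
      next
        case False
        then show ?thesis using B[OF 2(1)] sub_step[OF u(1,2) False] 2(2) by blast
      qed
      then show ?thesis using B[OF 2] by (simp add: g_def divide_neg_neg)
    qed
  qed
  ultimately show ?thesis by (intro exI[of _ g]) blast
qed

text \<open>The certificate works twice: it bounds the depths on both sides, so that the competitor
  with path ends \<open>a\<close> and \<open>b\<close> has diameter \<open>d\<close>, and its slack
  at \<open>w\<close> puts the competitor's second eigenvalue below the minimum.\<close>

lemma no_better_certificate:
  assumes T: "rooted_tree V r p' h'" "p' s = r"
    and S: "\<not> S r" "S s" "\<And>u. u \<in> V \<Longrightarrow> u \<noteq> r \<Longrightarrow> u \<noteq> s \<Longrightarrow> S u = S (p' u)"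
    and pos: "\<And>u. u \<in> V \<Longrightarrow> u \<noteq> r \<Longrightarrow> u \<noteq> s \<Longrightarrow> 0 < g u" and neg: "g s < 0"
    and le: "\<And>u. u \<in> V \<Longrightarrow> (\<Sum>x\<in>rooted_tree.ch V r p' u. g x) + (if u = r then 0 else 1 / g u) \<le> \<mu>"
    and less: "w \<in> V" "(\<Sum>x\<in>rooted_tree.ch V r p' w. g x) + (if w = r then 0 else 1 / g w) < \<mu>"
    and ends: "a \<in> V" "\<not> S a" "k \<le> h' a" "b \<in> V" "S b" "Suc k \<le> h' b"
  shows False
proof -
  interpret T: rooted_tree V r p' h' by (rule T(1))
  have bound: "h' u \<le> (if S u then Suc k else k)" if "u \<in> V" for u
  proof (rule T.depth_bound[where g = g and c = \<mu> and s = s])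
    show "(\<Sum>x\<in>T.ch u. g x) + 1 / g u \<le> \<mu>" if "u \<in> V" "u \<noteq> r" "u \<noteq> s" for u
      using le[OF that(1)] that(2) by simp
  qed (use s_props T(2) S pos \<mu>_less \<mu>_pos that in simp_all)
  have "T.G \<in> trees (card V) d"
  proof (rule trees_rooted[of p' h' S a b])
    show "h' u \<le> k" if "u \<in> V" "\<not> S u" for u using bound[OF that(1)] that(2) by simp
    show "h' u \<le> d - k" if "u \<in> V" "S u" for u using bound[OF that(1)] that(2) dk' by simp
    show "d - k \<le> h' b" using ends(6) dk' by simp
  qed (use T S ends in simp_all)
  then have "\<mu> \<le> eig 2 T.G" by (rule opt)
  moreover have "eig 2 T.G < \<mu>"
    by (rule T.certificate_eig2_less[OF s_props(1,2) pos neg le less])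
  ultimately show False by simp
qed

lemma inverse_chain_coeff: "1 / chain_coeff c (Suc j) = c - chain_coeff c j"
  by (simp add: chain_coeff.simps(2))

text \<open>At a deepest branching vertex other than \<open>r\<close>, \<open>s\<close>, two children start bare chains;
  appending one chain to the other would give a better certificate.\<close>

lemma single_child:
  assumes w0: "w0 \<in> V" "w0 \<noteq> r" "w0 \<noteq> s"
  shows "card (ch w0) \<le> 1"
proof (rule ccontr)
  assume branching: "\<not> ?thesis"
  \<comment> \<open>A deepest branching vertex is chosen so that only bare chains hang below
    it.\<close>
  define W where "W = {w \<in> V. w \<noteq> r \<and> w \<noteq> s \<and> 2 \<le> card (ch w)}"
  have "finite W" "W \<noteq> {}" using fin w0 branching by (auto simp: W_def)
  then obtain w where w: "w \<in> W" "h w = Max (h ` W)" by (metis obtains_MAX)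
  have wmax: "card (ch x) \<le> 1" if x: "x \<in> V" "h w < h x" "x \<noteq> s" for x
  proof (rule ccontr)
    assume "\<not> card (ch x) \<le> 1"
    moreover have "x \<noteq> r" using x(2) root by auto
    ultimately have "x \<in> W" using x by (simp add: W_def)
    then have "h x \<le> Max (h ` W)" using \<open>finite W\<close> by simp
    then show False using w(2) x(2) by simp
  qed
  have wV: "w \<in> V" "w \<noteq> r" "w \<noteq> s" and "2 \<le> card (ch w)" using w(1) by (auto simp: W_def)
  then have "\<not> (\<forall>x\<in>ch w. \<forall>y\<in>ch w. x = y)" using card_le_Suc0_iff_eq[OF fin_ch, of w] by auto
  then obtain a0 b0 where ab: "a0 \<in> ch w" "b0 \<in> ch w" "a0 \<noteq> b0" by blast
  have hw: "0 < h w" using dep[OF wV(1,2)] by simp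
  \<comment> \<open>Vertices below \<open>w\<close> have depth at least 2, whereas \<open>s\<close>,
    which may branch, has depth 1.\<close>
  have deep: "card (ch x) \<le> 1" if "x \<in> V" "Suc (h w) \<le> h x" for x
  proof (rule wmax)
    show "x \<noteq> s" using that(2) hw s_props(4) by auto
  qed (use that in auto)
  have ab0: "a0 \<in> V" "b0 \<in> V" "h a0 = Suc (h w)" "h b0 = Suc (h w)" "p a0 = w" "p b0 = w" "a0 \<noteq> r" "b0 \<noteq> r"
    using ab child_depth by (auto simp: ch_iff)
  obtain m a where a: "a 0 = a0" "\<forall>i<m. ch (a i) = {a (Suc i)}" "ch (a m) = {}"
    using bare_chain[OF ab0(1)] deep ab0(3) by metis
  obtain l b where b: "b 0 = b0" "\<forall>i<l. ch (b i) = {b (Suc i)}" "ch (b l) = {}"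
    using bare_chain[OF ab0(2)] deep ab0(4) by metis
  have aV: "a i \<in> V" "h (a i) = Suc (h w) + i" if "i \<le> m" for i
    using bare_chain_props[where e = a and m = m, OF ab0(1) a(1) _ that] a(2) ab0(3) by auto
  have bV: "b i \<in> V" "h (b i) = Suc (h w) + i" if "i \<le> l" for i
    using bare_chain_props[where e = b and m = l, OF ab0(2) b(1) _ that] b(2) ab0(4) by auto
  have pa: "p (a (Suc i)) = a i" if "i < m" for i
  proof -
    have "a (Suc i) \<in> ch (a i)" using a(2) that by simp
    then show ?thesis by (simp add: ch_iff)
  qed
  have pb: "p (b (Suc i)) = b i" if "i < l" for i
  proof -
    have "b (Suc i) \<in> ch (b i)" using b(2) that by simp
    then show ?thesis by (simp add: ch_iff)
  qed
  have cha: "i < m \<and> x = a (Suc i)" if "x \<in> ch (a i)" "i \<le> m" for x i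
    using that a(2,3) by (cases "i = m") auto
  have chb: "i < l \<and> x = b (Suc i)" if "x \<in> ch (b i)" "i \<le> l" for x i
    using that b(2,3) by (cases "i = l") auto
  have neq: "a i \<noteq> b j" if "i \<le> m" "j \<le> l" for i j
    using that
  proof (induction i arbitrary: j)
    case 0
    show ?case
    proof
      assume e: "a 0 = b j"
      then have "j = 0" using aV(2)[of 0] bV(2)[OF 0(2)] by simp
      then show False using e a(1) b(1) ab(3) by simp
    qed
  next
    case (Suc i)
    show ?case
    proof
      assume e: "a (Suc i) = b j"
      then have j: "j = Suc i" using aV(2)[OF Suc.prems(1)] bV(2)[OF Suc.prems(2)] by simp
      then have "a i = b i" using pa[of i] pb[of i] e Suc.prems by simp
      then show False using Suc.IH[of i] Suc.prems j by simp
    qed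
  qed
  define A where "A = a ` {..m}"
  define Bs where "Bs = b ` {..l}"
  have AB: "A \<inter> Bs = {}" using neq by (auto simp: A_def Bs_def)
  have Ah: "Suc (h w) \<le> h x" if "x \<in> A \<union> Bs" for x using that aV(2) bV(2) by (auto simp: A_def Bs_def)
  have Anot: "r \<notin> A \<union> Bs" "s \<notin> A \<union> Bs" "w \<notin> A \<union> Bs"
    using Ah[of r] Ah[of s] Ah[of w] root s_props(4) hw by auto
  have inA: "a i \<in> A" if "i \<le> m" for i using that by (simp add: A_def)
  have inB: "b i \<in> Bs" if "i \<le> l" for i using that by (simp add: Bs_def)
  have a_not: "a i \<noteq> r" "a i \<noteq> s" if "i \<le> m" for i using inA[OF that] Anot by auto
  have b_not: "b i \<noteq> r" "b i \<noteq> s" if "i \<le> l" for i using inB[OF that] Anot by auto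
  obtain g where g: "\<And>u. u \<in> V \<Longrightarrow> u \<noteq> r \<Longrightarrow> u \<noteq> s \<Longrightarrow> 0 < g u" "g s < 0"
    "\<And>u. u \<in> V \<Longrightarrow> (\<Sum>w\<in>ch u. g w) + (if u = r then 0 else 1 / g u) = \<mu>"
    using certificate_exists by metis
  have geq: "(\<Sum>w\<in>ch u. g w) + 1 / g u = \<mu>" if "u \<in> V" "u \<noteq> r" for u using g(3)[OF that(1)] that(2) by simp
  have ga: "g (a (m - i)) = chain_coeff \<mu> i" if i: "i \<le> m" for i
  proof (rule bare_chain_coeff[where e = a and m = m])
    show "(\<Sum>w\<in>ch (a j). g w) + 1 / g (a j) = \<mu>" if "j \<le> m" for j
      using geq[OF aV(1)[OF that] a_not(1)[OF that]] .
    show "0 < g (a j)" if "j \<le> m" for j using g(1)[OF aV(1)[OF that] a_not[OF that]] .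
  qed (use a i in auto)
  have gb: "g (b (l - i)) = chain_coeff \<mu> i" if i: "i \<le> l" for i
  proof (rule bare_chain_coeff[where e = b and m = l])
    show "(\<Sum>w\<in>ch (b j). g w) + 1 / g (b j) = \<mu>" if "j \<le> l" for j
      using geq[OF bV(1)[OF that] b_not(1)[OF that]] .
    show "0 < g (b j)" if "j \<le> l" for j using g(1)[OF bV(1)[OF that] b_not[OF that]] .
  qed (use b i in auto)
  have ccm: "0 < chain_coeff \<mu> i" if "i \<le> m" for i
  proof -
    have mi: "m - i \<le> m" by simp
    have "0 < g (a (m - i))" by (rule g(1)[OF aV(1)[OF mi] a_not[OF mi]])
    then show ?thesis using ga[OF that] by simp
  qed
  have ccl: "0 < chain_coeff \<mu> i" if "i \<le> l" for i
  proof -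
    have li: "l - i \<le> l" by simp
    have "0 < g (b (l - i))" by (rule g(1)[OF bV(1)[OF li] b_not[OF li]])
    then show ?thesis using gb[OF that] by simp
  qed
  have ga0: "g a0 = chain_coeff \<mu> m" and gb0: "g b0 = chain_coeff \<mu> l" using ga[of m] gb[of l] a(1) b(1) by simp_all
  define R where "R = (\<Sum>x\<in>ch w - {b0} - {a0}. g x)"
  have a0': "a0 \<in> ch w - {b0}" using ab by simp
  have sum_w: "(\<Sum>x\<in>ch w. g x) = g b0 + (g a0 + R)"
    unfolding R_def sum.remove[OF fin_ch ab(2), of g] sum.remove[OF finite_Diff[OF fin_ch] a0', of g] ..
  have "0 \<le> R"
    unfolding R_def
  proof (intro sum_nonneg)
    fix x assume "x \<in> ch w - {b0} - {a0}"
    then have "x \<in> V" "x \<noteq> r" "x \<noteq> s" using s_props(3) wV(2) by (auto simp: ch_iff)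
    then show "0 \<le> g x" using g(1) by (simp add: less_imp_le)
  qed
  moreover have "0 < 1 / g w" using g(1)[OF wV] by simp
  \<comment> \<open>The remaining children contribute \<open>R \<ge> 0\<close> and
    \<open>1 / g w\<close> is positive, so the two chains alone stay below \<mu>, as merging
    requires.\<close>
  ultimately have sum_less: "chain_coeff \<mu> m + chain_coeff \<mu> l < \<mu>"
    using geq[OF wV(1,2)] sum_w ga0 gb0 by linarith
  note merge = chain_coeff_merge[OF ccm ccl sum_less]
  \<comment> \<open>The chain of \<open>b0\<close> is hung under the end \<open>a m\<close> of the
    other, which lowers its vertices by \<open>m + 1\<close> levels. Its coefficients depend only on
    what lies below and stay; the vertices of the upper chain get those of the lengthened chain,
    which now has \<open>m + l + 2\<close> vertices.\<close>
  define p' where "p' = p(b0 := a m)"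
  define h' where "h' x = (if x \<in> Bs then h x + Suc m else h x)" for x
  define g' where "g' x = (if x \<in> A then chain_coeff \<mu> (m + l + 1 - (h x - Suc (h w))) else g x)" for x
  have g'a: "g' (a i) = chain_coeff \<mu> (m + l + 1 - i)" if "i \<le> m" for i
    using inA[OF that] aV(2)[OF that] by (simp add: g'_def)
  have b0B: "b0 \<in> Bs" using inB[of 0] b(1) by simp
  have up_B: "x \<in> Bs" if xB: "x \<in> V" "x \<noteq> r" "p x \<in> Bs" for x
  proof -
    obtain i where i: "i \<le> l" "p x = b i" using xB(3) by (auto simp: Bs_def)
    then have "x \<in> ch (b i)" using xB(1,2) by (simp add: ch_iff)
    then have "i < l" "x = b (Suc i)" using chb[OF _ i(1)] by blast+
    then show ?thesis using inB[of "Suc i"] by simp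
  qed
  have rt: "rooted_tree V r p' h'"
  proof
    show "finite V" "r \<in> V" by (rule fin root(1))+
    show "h' r = 0" using Anot root by (simp add: h'_def)
    fix x assume x: "x \<in> V" "x \<noteq> r"
    show "p' x \<in> V" using par[OF x] aV(1)[of m] by (simp add: p'_def)
    show "h' x = Suc (h' (p' x))"
    proof (cases "x = b0")
      case True
      have "a m \<notin> Bs" using inA[of m] AB by blast
      then show ?thesis using True b0B ab0(4) aV(2)[of m] by (simp add: h'_def p'_def)
    next
      case False
      then have px: "p' x = p x" by (simp add: p'_def)
      have "x \<in> Bs \<longleftrightarrow> p x \<in> Bs"
      proof
        assume "x \<in> Bs"
        then obtain i where i: "i \<le> l" "x = b i" by (auto simp: Bs_def)
        then obtain j where j: "i = Suc j" using False b(1) by (cases i) auto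
        then show "p x \<in> Bs" using pb[of j] i inB[of j] by simp
      qed (rule up_B[OF x])
      then show ?thesis using dep[OF x] by (simp add: h'_def px)
    qed
  qed
  interpret T: rooted_tree V r p' h' by (rule rt)
  have Tch: "x \<in> T.ch u \<longleftrightarrow> (if x = b0 then u = a m else x \<in> ch u)" for x u
  proof -
    have "p' b0 = a m" "x \<noteq> b0 \<Longrightarrow> p' x = p x" by (simp_all add: p'_def)
    then show ?thesis using ab0(2,8) by (auto simp: T.ch_iff ch_iff)
  qed
  have Tch_w: "T.ch w = ch w - {b0}"
    using Tch[of _ w] inA[of m] Anot by (intro Set.set_eqI) auto
  have Tch_am: "T.ch (a m) = {b0}"
    using Tch[of _ "a m"] a(3) by (intro Set.set_eqI) auto
  have Tch_else: "T.ch u = ch u" if "u \<noteq> w" "u \<noteq> a m" for u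
    using Tch[of _ u] that ab0(6) by (intro Set.set_eqI) (auto simp: ch_iff)
  show False
  proof (rule no_better_certificate[where p' = p' and h' = h' and S = "\<lambda>x. x \<in> sub s" and g = g' and w = w and a = "v 0" and b = "v d"])
    show "rooted_tree V r p' h'" by (rule rt)
    show "p' s = r" using s_props(3) Anot b0B by (auto simp: p'_def)
    show "r \<notin> sub s" "s \<in> sub s" using r_not_sub_s sub_self s_props(1) by auto
    show "(u \<in> sub s) = (p' u \<in> sub s)" if u: "u \<in> V" "u \<noteq> r" "u \<noteq> s" for u
    proof (cases "u = b0")
      case True
      \<comment> \<open>The receiving chain descends from \<open>w\<close>, so the moved vertices
        keep their side of the middle edge.\<close>
      have "a i \<in> sub s \<longleftrightarrow> w \<in> sub s" if "i \<le> m" for i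
        using that
      proof (induction i)
        case 0
        have "a0 \<noteq> s" using inA[of 0] a(1) Anot by auto
        then show ?case using sub_s_step[OF ab0(1,7)] ab0(5) a(1) by simp
      next
        case (Suc i)
        have "a (Suc i) \<noteq> s" "a (Suc i) \<noteq> r" using inA[OF Suc.prems] Anot by auto
        then show ?case using sub_s_step[OF aV(1)[OF Suc.prems]] pa[of i] Suc by simp
      qed
      then show ?thesis using True sub_s_step[OF u] ab0(6) by (simp add: p'_def)
    next
      case False
      then show ?thesis using sub_s_step[OF u] by (simp add: p'_def)
    qed
    show "0 < g' u" if u: "u \<in> V" "u \<noteq> r" "u \<noteq> s" for u
    proof (cases "u \<in> A")
      case True
      then show ?thesis using merge(1)[of "m + l + 1 - (h u - Suc (h w))"] by (simp add: g'_def)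
    next
      case False
      then show ?thesis using g(1)[OF u] by (simp add: g'_def)
    qed
    show "g' s < 0" using g(2) Anot by (simp add: g'_def)
    show "w \<in> V" by (rule wV(1))
    \<comment> \<open>The slack arises at \<open>w\<close>, where two summands are replaced by the
      smaller coefficient of the merged chain.\<close>
    have less_w: "(\<Sum>x\<in>T.ch w. g' x) + (if w = r then 0 else 1 / g' w) < \<mu>"
    proof -
      have "(\<Sum>x\<in>T.ch w. g' x) = g' a0 + (\<Sum>x\<in>ch w - {b0} - {a0}. g' x)"
        unfolding Tch_w by (rule sum.remove[OF finite_Diff[OF fin_ch] a0'])
      also have "(\<Sum>x\<in>ch w - {b0} - {a0}. g' x) = R"
        unfolding R_def
      proof (rule sum.cong)
        fix x assume x: "x \<in> ch w - {b0} - {a0}"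
        have "x \<notin> A"
        proof
          assume "x \<in> A"
          then obtain i where i: "i \<le> m" "x = a i" by (auto simp: A_def)
          then have "i = 0" using child_depth[of x w] x aV(2)[of i] by simp
          then show False using x i a(1) by simp
        qed
        then show "g' x = g x" by (simp add: g'_def)
      qed simp
      also have "g' a0 = chain_coeff \<mu> (m + l + 1)" using g'a[of 0] a(1) by simp
      finally have "(\<Sum>x\<in>T.ch w. g' x) < g b0 + (g a0 + R)" using merge(2) ga0 gb0 by simp
      moreover have "g' w = g w" using Anot by (simp add: g'_def)
      ultimately show ?thesis using geq[OF wV(1,2)] sum_w wV(2) by simp
    qed
    then show "(\<Sum>x\<in>T.ch w. g' x) + (if w = r then 0 else 1 / g' w) < \<mu>" .
    show "(\<Sum>x\<in>T.ch u. g' x) + (if u = r then 0 else 1 / g' u) \<le> \<mu>" if u: "u \<in> V" for u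
    proof (cases "u \<in> A")
      case True
      then obtain i where i: "i \<le> m" "u = a i" by (auto simp: A_def)
      have ur: "u \<noteq> r" using True Anot by blast
      have "(\<Sum>x\<in>T.ch u. g' x) = chain_coeff \<mu> (m + l - i)"
      proof (cases "i = m")
        case True
        have "b0 \<notin> A" using b0B AB by blast
        then show ?thesis using Tch_am i True gb0 by (simp add: g'_def)
      next
        case False
        then have im: "i < m" using i by simp
        have "u \<noteq> a m" using aV(2)[of i] aV(2)[of m] i im by auto
        moreover have "u \<noteq> w" using True Anot by blast
        ultimately have "T.ch u = {a (Suc i)}" using Tch_else a(2) im i(2) by simp
        then show ?thesis using g'a[of "Suc i"] im by simp
      qed
      moreover have "1 / g' u = \<mu> - chain_coeff \<mu> (m + l - i)"
      proof -
        have "m + l + 1 - i = Suc (m + l - i)" using i(1) by simp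
        then show ?thesis using g'a[OF i(1)] i(2) inverse_chain_coeff by simp
      qed
      ultimately show ?thesis using ur by simp
    next
      case False
      show ?thesis
      proof (cases "u = w")
        case True
        show ?thesis unfolding True by (rule less_imp_le[OF less_w])
      next
        case uw: False
        have "u \<noteq> a m" using False inA[of m] by auto
        then have "T.ch u = ch u" using Tch_else uw by blast
        moreover have "(\<Sum>x\<in>ch u. g' x) = (\<Sum>x\<in>ch u. g x)"
        proof (rule sum.cong)
          fix x assume x: "x \<in> ch u"
          have "x \<notin> A"
          proof
            assume "x \<in> A"
            then obtain i where i: "i \<le> m" "x = a i" by (auto simp: A_def)
            show False
            proof (cases i)
              case 0
              then show ?thesis using i x uw a(1) ab0(5) by (simp add: ch_iff)
            next
              case (Suc j)
              then have "p x = a j" "j \<le> m" using pa[of j] i by auto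
              then show ?thesis using x False inA[of j] by (auto simp: ch_iff)
            qed
          qed
          then show "g' x = g x" by (simp add: g'_def)
        qed simp
        moreover have "g' u = g u" using False by (simp add: g'_def)
        ultimately show ?thesis using g(3)[OF u] by (simp only: order_refl)
      qed
    qed
    show "v 0 \<in> V" "v d \<in> V" using vV by auto
    show "v 0 \<notin> sub s" using lower_not_sub[of 0] by simp
    show "v d \<in> sub s" using upper_sub[of d] k_less by simp
    show "k \<le> h' (v 0)" using h_lower[of 0] by (simp add: h'_def)
    show "Suc k \<le> h' (v d)" using h_upper[of d] dk' k_less by (simp add: h'_def)
  qed
qed

text \<open>The ends of the spine are leaves because the depth bound applies to the minimiser's own
  certificate; the inner vertices have their spine child and cannot branch.\<close>

lemma spine_ch:
  shows "0 < i \<Longrightarrow> i < k \<Longrightarrow> ch (v i) = {v (i - 1)}" "ch (v 0) = {}"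
    "Suc k < i \<Longrightarrow> i < d \<Longrightarrow> ch (v i) = {v (Suc i)}" "ch (v d) = {}"
proof -
  obtain g where g: "\<And>u. u \<in> V \<Longrightarrow> u \<noteq> r \<Longrightarrow> u \<noteq> s \<Longrightarrow> 0 < g u" "g s < 0"
    "\<And>u. u \<in> V \<Longrightarrow> (\<Sum>w\<in>ch u. g w) + (if u = r then 0 else 1 / g u) = \<mu>"
    using certificate_exists by metis
  have bound: "h u \<le> (if u \<in> sub s then Suc k else k)" if u: "u \<in> V" for u
  proof (rule depth_bound[where g = g and c = \<mu> and s = s and S = "\<lambda>u. u \<in> sub s"])
    show "(\<Sum>x\<in>ch u. g x) + 1 / g u \<le> \<mu>" if "u \<in> V" "u \<noteq> r" "u \<noteq> s" for u
      using g(3)[OF that(1)] that(2) by simp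
    show "(u \<in> sub s) = (p u \<in> sub s)" if "u \<in> V" "u \<noteq> r" "u \<noteq> s" for u
      by (rule sub_s_step[OF that])
  qed (use s_props r_not_sub_s sub_self \<mu>_less \<mu>_pos u g(1) in simp_all)
  have not_s: "u \<noteq> s" if "u \<in> ch (v i)" "i \<noteq> k" "i \<le> d" for u i
    using that s_props(3) vr[of i] by (auto simp: ch_iff)
  show "ch (v 0) = {}"
  proof (rule ccontr)
    assume "ch (v 0) \<noteq> {}"
    then obtain u where u: "u \<in> ch (v 0)" by blast
    then have uV: "u \<in> V" "u \<noteq> r" "p u = v 0" by (auto simp: ch_iff)
    have "u \<notin> sub s" using sub_s_step[OF uV(1,2) not_s[OF u]] uV(3) lower_not_sub[of 0] k0 by simp
    then have "h u \<le> k" using bound[OF uV(1)] by simp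
    then show False using child_depth[OF u] h_lower[of 0] by simp
  qed
  show "ch (v d) = {}"
  proof (rule ccontr)
    assume "ch (v d) \<noteq> {}"
    then obtain u where u: "u \<in> ch (v d)" by blast
    then have uV: "u \<in> V" "u \<noteq> r" "p u = v d" by (auto simp: ch_iff)
    have "h u \<le> Suc k" using bound[OF uV(1)] by (simp split: if_splits)
    then show False using child_depth[OF u] h_upper[of d] k_less dk' by simp
  qed
  have single: "ch x = {y}" if "x \<in> V" "x \<noteq> r" "x \<noteq> s" "y \<in> ch x" for x y
  proof -
    have "\<forall>a\<in>ch x. \<forall>b\<in>ch x. a = b"
      using single_child[OF that(1-3)] card_le_Suc0_iff_eq[OF fin_ch, of x] by simp
    then show ?thesis using that(4) by blast
  qed
  show "ch (v i) = {v (i - 1)}" if "0 < i" "i < k"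
  proof (rule single)
    show "v i \<in> V" "v i \<noteq> r" "v i \<noteq> s" using that vV[of i] vr[of i] veq[of i "Suc k"] k_less by auto
    show "v (i - 1) \<in> ch (v i)"
      using lower[of "i - 1"] vV[of "i - 1"] vr[of "i - 1"] that k_less by (simp add: ch_iff)
  qed
  show "ch (v i) = {v (Suc i)}" if "Suc k < i" "i < d"
  proof (rule single)
    show "v i \<in> V" "v i \<noteq> r" "v i \<noteq> s" using that vV[of i] vr[of i] veq[of i "Suc k"] k_less by auto
    show "v (Suc i) \<in> ch (v i)"
      using upper[of i] vV[of "Suc i"] vr[of "Suc i"] that by (simp add: ch_iff)
  qed
qed

lemma second_in_ch_s: "v (Suc (Suc k)) \<in> ch s"
  using upper[of "Suc k"] vV[of "Suc (Suc k)"] vr[of "Suc (Suc k)"] dk' by (simp add: ch_iff)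

text \<open>If both \<open>r\<close> and \<open>s\<close> had branches off the spine, moving those of \<open>s\<close> to \<open>r\<close> would give a
  better certificate.\<close>

lemma one_sided: "ch s = {v (Suc (Suc k))} \<or> ch r = {s, v (k - 1)}"
proof (rule ccontr)
  assume contra: "\<not> ?thesis"
  let ?t = "v (Suc (Suc k))"
  define X where "X = ch s - {?t}"
  define Y where "Y = ch r - {s} - {v (k - 1)}"
  have "X \<noteq> {}" using contra second_in_ch_s by (auto simp: X_def)
  have "Y \<noteq> {}" using contra s_props(5) lower_top(5) by (auto simp: Y_def)
  obtain g where g: "\<And>u. u \<in> V \<Longrightarrow> u \<noteq> r \<Longrightarrow> u \<noteq> s \<Longrightarrow> 0 < g u" "g s < 0"
    "\<And>u. u \<in> V \<Longrightarrow> (\<Sum>w\<in>ch u. g w) + (if u = r then 0 else 1 / g u) = \<mu>"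
    using certificate_exists by metis
  have geq: "(\<Sum>w\<in>ch u. g w) + 1 / g u = \<mu>" if "u \<in> V" "u \<noteq> r" for u using g(3)[OF that(1)] that(2) by simp
  \<comment> \<open>Beyond \<open>r\<close> and \<open>s\<close> the spine consists of two bare
    chains on \<open>k\<close> vertices each, so the same coefficient occurs at both.\<close>
  define F where "F = chain_coeff \<mu> (k - 1)"
  have low_props: "v i \<in> V" "v i \<noteq> r" "v i \<noteq> s" if "i < k" for i
    using that vV[of i] vr[of i] veq[of i "Suc k"] k_less by auto
  have up_props: "v i \<in> V" "v i \<noteq> r" "v i \<noteq> s" if "Suc k < i" "i \<le> d" for i
    using that vV[of i] vr[of i] veq[of i "Suc k"] k_less by auto
  have low: "g (v (k - 1 - (k - 1 - i))) = chain_coeff \<mu> i" if "i \<le> k - 1" for i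
  proof (rule bare_chain_coeff[where e = "\<lambda>i. v (k - 1 - i)" and m = "k - 1"])
    show "ch (v (k - 1 - i)) = {v (k - 1 - Suc i)}" if "i < k - 1" for i
      using spine_ch(1)[of "k - 1 - i"] that by simp
    show "ch (v (k - 1 - (k - 1))) = {}" using spine_ch(2) by simp
    show "(\<Sum>w\<in>ch (v (k - 1 - i)). g w) + 1 / g (v (k - 1 - i)) = \<mu>" if "i \<le> k - 1" for i
      using k0 that by (intro geq low_props) auto
    show "0 < g (v (k - 1 - i))" if "i \<le> k - 1" for i
      using k0 that by (intro g(1) low_props) auto
  qed (rule that)
  have F_low: "g (v (k - 1)) = F" using low[of "k - 1"] by (simp add: F_def)
  have ccpos: "0 < chain_coeff \<mu> i" if "i \<le> k - 1" for i
    using low[OF that] g(1)[OF low_props, of "k - 1 - (k - 1 - i)"] k0 that by simp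
  have F_up: "g ?t = F"
  proof -
    have "g (v (Suc (Suc k) + (k - 1 - (k - 1)))) = chain_coeff \<mu> (k - 1)"
    proof (rule bare_chain_coeff[where e = "\<lambda>i. v (Suc (Suc k) + i)" and m = "k - 1"])
      show "ch (v (Suc (Suc k) + i)) = {v (Suc (Suc k) + Suc i)}" if "i < k - 1" for i
        using spine_ch(3)[of "Suc (Suc k) + i"] that dk by simp
      have "Suc (Suc k) + (k - 1) = d" using dk k0 by simp
      then show "ch (v (Suc (Suc k) + (k - 1))) = {}" using spine_ch(4) by simp
      show "(\<Sum>w\<in>ch (v (Suc (Suc k) + i)). g w) + 1 / g (v (Suc (Suc k) + i)) = \<mu>" if "i \<le> k - 1" for i
        using k0 that dk by (intro geq up_props) auto
      show "0 < g (v (Suc (Suc k) + i))" if "i \<le> k - 1" for i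
        using k0 that dk by (intro g(1) up_props) auto
    qed simp
    then show ?thesis by (simp add: F_def)
  qed
  \<comment> \<open>Otherwise elimination would succeed on one vertex more and bound the spectral
    radius \<rho> by \<mu>.\<close>
  have F_gt: "\<mu> < F"
  proof (rule ccontr)
    assume "\<not> ?thesis"
    then have "eig 1 (path_graph (Suc (Suc (k - 1)))) \<le> \<mu>"
      using ccpos by (intro eig1_path_le) (auto simp: F_def)
    then show False using \<mu>_less k0 by simp
  qed
  define \<sigma> where "\<sigma> = F - \<mu>"
  have \<sigma>: "0 < \<sigma>" using F_gt by (simp add: \<sigma>_def)
  define x y where "x = sum g X" and "y = sum g Y"
  have XV: "u \<in> V \<and> u \<noteq> r \<and> u \<noteq> s \<and> p u = s" if "u \<in> X" for u
    using that s_props(2,3) by (auto simp: X_def ch_iff)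
  have YV: "u \<in> V \<and> u \<noteq> r \<and> u \<noteq> s \<and> p u = r" if "u \<in> Y" for u
    using that by (auto simp: Y_def ch_iff)
  have finXY: "finite X" "finite Y" by (simp_all add: X_def Y_def)
  have xy: "0 < x" "0 < y"
    unfolding x_def y_def using finXY \<open>X \<noteq> {}\<close> \<open>Y \<noteq> {}\<close> XV YV g(1) by (auto intro!: sum_pos)
  have sum_s: "sum g (ch s) = F + x"
    using sum.remove[OF fin_ch second_in_ch_s, of g] F_up by (simp add: X_def x_def)
  have lt: "v (k - 1) \<in> ch r - {s}" using lower_top(5,6) by simp
  have sum_r: "sum g' (ch r) = g' s + (g' (v (k - 1)) + sum g' Y)" for g' :: "'a \<Rightarrow> real"
    unfolding Y_def sum.remove[OF fin_ch s_props(5), of g'] sum.remove[OF finite_Diff[OF fin_ch] lt, of g'] ..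
  have gs: "- g s = \<sigma> + y"
    using g(3)[OF root(1)] sum_r[of g] F_low by (simp add: \<sigma>_def y_def)
  have gs': "- (1 / g s) = \<sigma> + x"
    using geq[OF s_props(1,2)] sum_s by (simp add: \<sigma>_def)
  \<comment> \<open>The equations at \<open>r\<close> and \<open>s\<close> determine
    \<open>g s\<close> and \<open>1 / g s\<close>; multiplying them eliminates \<open>g s\<close>.
    After the move the value at \<open>s\<close> must be -1/\<sigma>, and slack at \<open>r\<close>
    means that (\<sigma> + x + y) \<sigma> is below 1; it equals 1 - x y.\<close>
  have "(\<sigma> + y) * (\<sigma> + x) = 1"
    unfolding gs[symmetric] gs'[symmetric] using g(2) by simp
  moreover have "(\<sigma> + y) * (\<sigma> + x) = (\<sigma> + x + y) * \<sigma> + x * y" by (simp add: algebra_simps)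
  moreover have "0 < x * y" using xy by simp
  ultimately have "(\<sigma> + x + y) * \<sigma> < 1" by linarith
  then have key: "\<sigma> + x + y < 1 / \<sigma>" using \<sigma> by (simp add: less_divide_eq)
  \<comment> \<open>After the move the side of \<open>s\<close> consists of the upper half of the
    spine alone.\<close>
  define U where "U = v ` {Suc k..d}"
  have U_sub: "U \<subseteq> sub s" using upper_sub by (auto simp: U_def)
  have sU: "s \<in> U" using k_less by (simp add: U_def)
  have rU: "r \<notin> U" using U_sub r_not_sub_s by blast
  have XU: "u \<notin> U" if "u \<in> X" for u
  proof
    assume "u \<in> U"
    then obtain i where i: "Suc k \<le> i" "i \<le> d" "u = v i" by (auto simp: U_def)
    have "i \<noteq> Suc k" using XV[OF that] i by auto
    then obtain j where j: "i = Suc j" "Suc k \<le> j" "j < d" using i by (cases i) auto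
    then have "p u = v j" using upper[of j] i by simp
    then have "v j = s" using XV[OF that] by simp
    then have "j = Suc k" using veq[of j "Suc k"] j k_less by simp
    then show False using that i j by (simp add: X_def)
  qed
  have up_U: "u \<in> U \<or> u \<in> X" if u: "u \<in> V" "u \<noteq> r" "p u \<in> U" for u
  proof -
    obtain i where i: "Suc k \<le> i" "i \<le> d" "p u = v i" using u(3) by (auto simp: U_def)
    then have uc: "u \<in> ch (v i)" using u by (simp add: ch_iff)
    consider "i = Suc k" | "Suc k < i" "i < d" | "i = d" "Suc k < i" using i by linarith
    then show ?thesis
    proof cases
      case 1
      then show ?thesis using uc dk' by (auto simp: X_def U_def)
    next
      case 2
      then show ?thesis using uc spine_ch(3)[OF 2] by (auto simp: U_def)
    next
      case 3
      then show ?thesis using uc spine_ch(4) by simp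
    qed
  qed
  have down_U: "p u \<in> U" if u: "u \<in> U" "u \<noteq> s" for u
  proof -
    obtain i where i: "Suc k \<le> i" "i \<le> d" "u = v i" using u by (auto simp: U_def)
    have "i \<noteq> Suc k" using i u by auto
    then obtain j where j: "i = Suc j" "Suc k \<le> j" "j < d" using i by (cases i) auto
    then have "p u = v j" using upper[of j] i by simp
    then show ?thesis using j by (simp add: U_def)
  qed
  have X_sub: "u \<in> sub s" if "u \<in> X" for u
    using sub_s_step[of u] XV[OF that] sub_self[OF s_props(1)] by simp
  define p' where "p' u = (if u \<in> X then r else p u)" for u
  \<comment> \<open>Vertices of the moved branches rise by one level, from below \<open>s\<close> to
    below \<open>r\<close>.\<close>
  define h' where "h' u = (if u \<in> sub s \<and> u \<notin> U then h u - 1 else h u)" for u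
  have rt: "rooted_tree V r p' h'"
  proof
    show "finite V" "r \<in> V" by (rule fin root(1))+
    show "h' r = 0" using r_not_sub_s root by (simp add: h'_def)
    fix u assume u: "u \<in> V" "u \<noteq> r"
    show "p' u \<in> V" using par[OF u] root by (simp add: p'_def)
    show "h' u = Suc (h' (p' u))"
    proof (cases "u \<in> X")
      case True
      have "h u = 2" using dep[OF u] XV[OF True] s_props(4) by simp
      then show ?thesis using True X_sub[OF True] XU[OF True] \<open>h' r = 0\<close> by (simp add: h'_def p'_def)
    next
      case False
      then have pu: "p' u = p u" by (simp add: p'_def)
      show ?thesis
      proof (cases "u = s")
        case True
        then show ?thesis using sU s_props(3,4) \<open>h' r = 0\<close> pu by (simp add: h'_def)
      next
        case us: False
        have 1: "u \<in> sub s \<longleftrightarrow> p u \<in> sub s" by (rule sub_s_step[OF u us])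
        have 2: "u \<in> U \<longleftrightarrow> p u \<in> U" using up_U[OF u] down_U[OF _ us] False by blast
        have "p u \<noteq> s" if "u \<notin> U" using that 2 sU by auto
        moreover have "1 \<le> h (p u)" if "p u \<in> sub s" using sub_depth[OF that] s_props(4) by simp
        ultimately show ?thesis using dep[OF u] 1 2 by (cases "p u \<in> sub s") (auto simp: h'_def pu)
      qed
    qed
  qed
  interpret T: rooted_tree V r p' h' by (rule rt)
  have Tch: "z \<in> T.ch u \<longleftrightarrow> (if z \<in> X then u = r else z \<in> ch u)" for z u
    using XV[of z] by (auto simp: T.ch_iff ch_iff p'_def)
  have Tch_s: "T.ch s = {?t}"
  proof (rule Set.set_eqI)
    show "z \<in> T.ch s \<longleftrightarrow> z \<in> {?t}" for z
      using Tch[of z s] s_props(2) second_in_ch_s by (auto simp: X_def)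
  qed
  have Tch_r: "T.ch r = ch r \<union> X"
    using Tch[of _ r] by (intro Set.set_eqI) auto
  have Tch_else: "T.ch u = ch u" if "u \<noteq> r" "u \<noteq> s" for u
  proof (rule Set.set_eqI)
    show "z \<in> T.ch u \<longleftrightarrow> z \<in> ch u" for z
      using Tch[of z u] that XV[of z] by (auto simp: ch_iff)
  qed
  define g' where "g' = g(s := - 1 / \<sigma>)"
  have g's: "g' s = - 1 / \<sigma>" and g'o: "\<And>u. u \<noteq> s \<Longrightarrow> g' u = g u" by (simp_all add: g'_def)
  show False
  proof (rule no_better_certificate[where p' = p' and h' = h' and S = "\<lambda>u. u \<in> U" and g = g' and w = r and a = "v 0" and b = "v d"])
    show "rooted_tree V r p' h'" by (rule rt)
    have "s \<notin> X" using XV by blast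
    then show "p' s = r" using s_props(3) by (simp add: p'_def)
    show "r \<notin> U" "s \<in> U" by (rule rU sU)+
    show "(u \<in> U) = (p' u \<in> U)" if u: "u \<in> V" "u \<noteq> r" "u \<noteq> s" for u
      using up_U[OF u(1,2)] down_U[OF _ u(3)] XU[of u] rU by (auto simp: p'_def)
    show "0 < g' u" if "u \<in> V" "u \<noteq> r" "u \<noteq> s" for u using g(1)[OF that] g'o[OF that(3)] by simp
    show "g' s < 0" using g's \<sigma> by simp
    show "r \<in> V" by (rule root(1))
    have root_less: "sum g' (T.ch r) < \<mu>"
    proof -
      have "ch r \<inter> X = {}" using XV s_props(2) by (auto simp: ch_iff)
      then have "sum g' (T.ch r) = sum g' (ch r) + sum g' X"
        unfolding Tch_r using finXY(1) by (intro sum.union_disjoint) auto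
      also have "sum g' X = x" unfolding x_def using XV g'o by (intro sum.cong) auto
      also have "sum g' (ch r) = g' s + (g' (v (k - 1)) + sum g' Y)" by (rule sum_r)
      also have "sum g' Y = y" unfolding y_def using YV g'o by (intro sum.cong) auto
      also have "g' (v (k - 1)) = F" using g'o[OF lower_top(6)] F_low by simp
      finally show ?thesis using key g's by (simp add: \<sigma>_def)
    qed
    then show "sum g' (T.ch r) + (if r = r then 0 else 1 / g' r) < \<mu>" by simp
    show "sum g' (T.ch u) + (if u = r then 0 else 1 / g' u) \<le> \<mu>" if u: "u \<in> V" for u
    proof (cases "u = r")
      case True
      then show ?thesis using root_less by simp
    next
      case ur: False
      show ?thesis
      proof (cases "u = s")
        case True
        have "?t \<noteq> s" using up_props(3)[of "Suc (Suc k)"] dk' by simp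
        then have "sum g' (T.ch s) = F" unfolding Tch_s using g'o F_up by simp
        moreover have "1 / g' s = - \<sigma>" by (simp add: g's)
        ultimately show ?thesis using True ur by (simp add: \<sigma>_def)
      next
        case us: False
        have "sum g' (ch u) = sum g (ch u)"
        proof (rule sum.cong)
          fix z assume "z \<in> ch u"
          then have "z \<noteq> s" using s_props(3) ur by (auto simp: ch_iff)
          then show "g' z = g z" by (rule g'o)
        qed simp
        then show ?thesis using geq[OF u ur] Tch_else[OF ur us] g'o[OF us] ur by simp
      qed
    qed
    show "v 0 \<in> V" "v d \<in> V" using vV by auto
    have v0: "v 0 \<notin> sub s" using lower_not_sub[of 0] by simp
    then show "v 0 \<notin> U" using U_sub by blast
    show "v d \<in> U" using k_less by (simp add: U_def)
    then show "Suc k \<le> h' (v d)" using h_upper[of d] dk' k_less by (simp add: h'_def)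
    show "k \<le> h' (v 0)" using v0 h_lower[of 0] by (simp add: h'_def)
  qed
qed

lemma one_sided_off_path:
  assumes one: "ch s = {v (Suc (Suc k))}"
  shows off_path
  unfolding off_path_def
proof (intro ballI notI)
  fix u assume u: "u \<in> V - spine" "p u \<in> v ` ({..d} - {k})"
  then obtain i where i: "i \<le> d" "i \<noteq> k" "p u = v i" by auto
  have "u \<noteq> r" using u(1) r_spine by auto
  then have uc: "u \<in> ch (v i)" using u(1) i by (simp add: ch_iff)
  consider "i = 0" | "0 < i" "i < k" | "i = Suc k" | "Suc k < i" "i < d" | "i = d"
    using i by linarith
  then have "ch (v i) \<subseteq> spine"
  proof cases
    case 1
    then show ?thesis using spine_ch(2) by simp
  next
    case 2
    then show ?thesis using spine_ch(1)[OF 2] k_less by auto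
  next
    case 3
    then show ?thesis using one dk' by auto
  next
    case 4
    then show ?thesis using spine_ch(3)[OF 4] by auto
  next
    case 5
    then show ?thesis using spine_ch(4) by simp
  qed
  then show False using uc u(1) by blast
qed

text \<open>The Perron vector of \<open>k\<close> spine vertices lives in a branch at
  \<open>r\<close>, where \<mu> is a strict bound.\<close>

lemma path_less: "eig 1 (path_graph k) < \<mu>"
proof -
  have seg: "0 + k \<le> Suc d" using k_less by simp
  obtain x where x: "supp_in (v ` {0..<0 + k}) x" "eig 1 (path_graph k) * sqn V x \<le> qform E x" "0 < sqn V x"
    using spine_vec[OF seg k0] by blast
  have "v ` {0..<0 + k} \<subseteq> sub (v (k - 1))" using lower_sub by auto
  then have supp: "supp_in (sub (v (k - 1))) x" by (rule supp_in_mono[OF x(1)])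
  have "x \<noteq> (\<lambda>_. 0)" using x(3) by (auto simp: sqn_def)
  then have "qform E x < \<mu> * sqn V x" using branch_less[OF _ supp] lower_top(5,6) by blast
  then have "eig 1 (path_graph k) * sqn V x < \<mu> * sqn V x" using x(2) by simp
  then show ?thesis using x(3) by simp
qed

lemma branch_le:
  assumes "u \<in> ch r" "u \<noteq> s" "supp_in (sub u) y"
  shows "qform E y \<le> \<mu> * sqn V y"
proof (cases "y = (\<lambda>_. 0)")
  case True
  then show ?thesis by (simp add: bform_def sqn_def)
next
  case False
  then show ?thesis using branch_less[of u y] assms by (intro less_imp_le) blast
qed

lemma one_sided_star:
  assumes one: "ch s = {v (Suc (Suc k))}"
  shows "star_subdivision G r" "star_subdivision B r"
proof -
  have ch1: "card (ch u) \<le> 1" if "u \<in> V" "u \<noteq> r" for u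
    using single_child[OF that] one by (cases "u = s") auto
  show "star_subdivision G r"
    unfolding star_subdivision_def using is_tree_G root ch1 degree_le_2 by simp
  interpret B: rooted_tree VB r p h by (rule VB_rooted[OF one_sided_off_path[OF one]])
  have "card (B.ch u) \<le> 1" if "u \<in> VB" "u \<noteq> r" for u
  proof -
    have "card (B.ch u) \<le> card (ch u)" by (intro card_mono) (auto simp: B.ch_iff ch_iff)
    then show ?thesis using ch1[of u] that by simp
  qed
  then show "star_subdivision B r"
    unfolding star_subdivision_def using B.is_tree_G B.root B.degree_le_2 by simp
qed

end

text \<open>As \<open>d = 2 * k + 1\<close>, reversing the numbering exchanges \<open>r\<close> and
  \<open>s\<close>. The unbranched old root becomes the new \<open>s\<close>, whose only child
  continues the spine.\<close>

lemma (in odd_optimal) reverse_path: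
  assumes one: "ch r = {s, v (k - 1)}"
  obtains p2 h2 where "odd_optimal V (v (d - k)) p2 h2 (\<lambda>i. v (d - i)) d k" "G = parent_graph V (v (d - k)) p2"
    "rooted_tree.ch V (v (d - k)) p2 (v (d - Suc k)) = {v (d - Suc (Suc k))}"
proof -
  let ?v = "\<lambda>i. v (d - i)"
  have inj': "inj_on ?v {..d}"
  proof (rule inj_onI)
    fix i j assume ij: "i \<in> {..d}" "j \<in> {..d}" "v (d - i) = v (d - j)"
    then have "d - i = d - j" using veq[of "d - i" "d - j"] by simp
    then show "i = j" using ij(1,2) by simp
  qed
  have sv': "?v ` {..d} \<subseteq> pverts G" using vV by auto
  have arcs': "(?v i, ?v (Suc i)) \<in> parcs G" if "i < d" for i
  proof -
    have "(v (d - Suc i), v (Suc (d - Suc i))) \<in> E" using that by (intro spine_arc) simp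
    moreover have "Suc (d - Suc i) = d - i" using that by simp
    ultimately show ?thesis using E_sym by (auto simp: sym_def)
  qed
  obtain p2 h2 where R: "spined_tree (pverts G) (?v k) p2 h2 ?v d k" "G = parent_graph (pverts G) (?v k) p2"
    by (rule spined_of_path[OF is_tree_G inj' sv' arcs' kd k0])
  interpret R: spined_tree V "?v k" p2 h2 ?v d k using R(1) by simp
  have GR: "G = R.G" using R(2) by simp
  have O: "odd_optimal V (?v k) p2 h2 ?v d k"
  proof unfold_locales
    show "odd d" by (rule odd_d)
    show "eig 2 R.G \<le> eig 2 T'" if "T' \<in> trees (card V) d" for T' :: "'a pair_pre_digraph"
      using opt[OF that] GR by simp
  qed
  interpret R: odd_optimal V "?v k" p2 h2 ?v d k by (rule O)
  have ER: "E = R.E" using GR by (metis parent_graph_simps(2))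
  have "d - Suc k = k" "d - k = Suc k" using dk by linarith+
  then have rs: "?v (Suc k) = r" "?v k = s" using rv by simp_all
  have "R.ch (?v (Suc k)) = {?v (Suc (Suc k))}"
  proof (rule equalityI)
    show "{?v (Suc (Suc k))} \<subseteq> R.ch (?v (Suc k))" using R.second_in_ch_s by simp
    show "R.ch (?v (Suc k)) \<subseteq> {?v (Suc (Suc k))}"
    proof
      fix x assume x: "x \<in> R.ch (?v (Suc k))"
      then have x': "x \<in> V" "x \<noteq> ?v k" "p2 x = ?v (Suc k)" by (simp_all add: R.ch_iff)
      then have "(x, ?v (Suc k)) \<in> R.E" by (simp add: R.arcs_iff)
      then have "(x, r) \<in> E" unfolding ER rs(1) .
      then have "x \<in> ch r" unfolding arcs_iff ch_iff by auto
      then have "x = v (k - 1)" using one x'(2) unfolding rs(2) by blast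
      moreover have "d - Suc (Suc k) = k - 1" using dk by linarith
      ultimately show "x \<in> {?v (Suc (Suc k))}" by simp
    qed
  qed
  then show ?thesis using that[OF O GR] by blast
qed

theorem theorem1p6:
  fixes n d :: nat and lam :: real and T :: "'a pair_pre_digraph"
  assumes "4 \<le> n" and "3 \<le> d" and "d \<le> n - 2"
    and lam: "lam = Min (eig 2 ` (trees n d :: 'a pair_pre_digraph set))"
    and "T \<in> trees n d" and "eig 2 T = lam"
  shows "\<exists>v B.
    path_with_tree T d v B \<and>
    (\<forall>i\<le>d. i \<noteq> d div 2 \<longrightarrow> out_degree (with_proj T) (v i) \<le> 2) \<and>
    (eig 1 (remove_vert B (v (d div 2))) \<le> lam \<and> lam \<le> eig 1 (path_graph ((d + 1) div 2))) \<and>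
    (even d \<longrightarrow>
      lam = eig 1 (path_graph (d div 2)) \<and> lam < 2 \<and>
      disjoint_union_of (\<lambda>C. smith_graph C \<and> eig 1 C \<le> lam) (remove_vert B (v (d div 2))) \<and>
      (\<forall>T' \<in> trees n d. \<forall>v' (B' :: 'a pair_pre_digraph).
        path_with_tree T' d v' B' \<and>
        disjoint_union_of (\<lambda>C. smith_graph C \<and> eig 1 C \<le> lam) (remove_vert B' (v' (d div 2)))
        \<longrightarrow> eig 2 T' = lam)) \<and>
    (odd d \<longrightarrow>
      eig 1 (path_graph ((d - 1) div 2)) < lam \<and> lam < eig 1 (path_graph ((d + 1) div 2)) \<and>
      star_subdivision T (v ((d - 1) div 2)) \<and> star_subdivision B (v ((d - 1) div 2)))"
proof -
  define k where "k = d div 2"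
  have k0: "0 < k" using assms(2) by (simp add: k_def)
  have T: "is_tree T" "card (pverts T) = n" "graph_diameter T = ereal (real d)"
    using assms(5) by (auto simp: trees_def)
  have opt: "eig 2 T \<le> eig 2 T'" if "T' \<in> trees n d" for T' :: "'a pair_pre_digraph"
    unfolding assms(6) lam using that by (intro Min_le finite_eig_trees imageI)
  \<comment> \<open>At least one vertex lies off the path, so \<open>B\<close> without its centre is
    nonempty and has a largest eigenvalue.\<close>
  have card: "d + 2 \<le> card (pverts T)" using T(2) assms(1,3) by simp
  obtain v where v: "inj_on v {..d}" "v ` {..d} \<subseteq> pverts T" "\<And>i. i < d \<Longrightarrow> (v i, v (Suc i)) \<in> parcs T"
    by (rule diametral_path[OF T(1,3)]) blast
  obtain p h where ph: "spined_tree (pverts T) (v k) p h v d k" "T = parent_graph (pverts T) (v k) p"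
    by (rule spined_of_path[OF T(1) v k_def k0])
  show ?thesis
  proof (cases "even d")
    case True
    interpret S: spined_tree "pverts T" "v k" p h v d k by (rule ph(1))
    have TG: "S.G = T" by (rule ph(2)[symmetric])
    have optS: "eig 2 S.G \<le> eig 2 T'" if "T' \<in> trees (card (pverts T)) d" for T' :: "'a pair_pre_digraph"
      unfolding TG using opt that T(2) by simp
    have ev1: "eig 2 S.G = eig 1 (path_graph k)" by (rule S.even_optimal(1)[OF True]) (rule optS)
    have ev2: S.off_path by (rule S.even_optimal(2)[OF True]) (rule optS)
    have lam_eq: "lam = eig 1 (path_graph k)" using ev1 TG assms(6) by simp
    obtain k' where k': "k = Suc k'" using k0 by (cases k) auto
    have lam2: "lam < 2" unfolding lam_eq k' by (rule eig1_path_less_2)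
    have le: "qform S.E y \<le> lam * sqn (pverts T) y" if "u \<in> S.ch (v k)" "supp_in (S.sub u) y" for u y
      unfolding lam_eq by (rule S.even_optimal(3)[OF True _ that]) (rule optS)
    have 1: "path_with_tree T d v S.B" using S.off_path_decomposition[OF ev2] TG by simp
    have 2: "\<forall>i\<le>d. i \<noteq> d div 2 \<longrightarrow> out_degree (with_proj T) (v i) \<le> 2"
    proof (intro allI impI)
      fix i assume i: "i \<le> d" "i \<noteq> d div 2"
      have "v i \<noteq> v k" using S.vr[OF i(1)] i(2) k_def by simp
      then have "out_degree (with_proj S.G) (v i) \<le> 2"
        using S.degree_le_2[OF S.vV[OF i(1)]] S.off_path_children[OF ev2 i(1)] i(2) k_def by simp
      then show "out_degree (with_proj T) (v i) \<le> 2" unfolding TG .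
    qed
    have 3: "eig 1 (remove_vert S.B (v k)) \<le> lam"
      by (rule S.off_path_eig1_le[OF ev2 card]) (rule le)
    have 4: "disjoint_union_of (\<lambda>C. smith_graph C \<and> eig 1 C \<le> lam) (remove_vert S.B (v k))"
      by (rule S.off_path_disjoint_union[OF ev2 less_imp_le[OF lam2]]) (rule le)
    \<comment> \<open>The upper bound comes from deleting the centre of \<open>T'\<close>, the lower
      one from minimality.\<close>
    have 5: "eig 2 T' = lam" if T': "T' \<in> trees n d" and pt: "path_with_tree T' d v' B'"
      and du: "disjoint_union_of (\<lambda>C. smith_graph C \<and> eig 1 C \<le> lam) (remove_vert B' (v' (d div 2)))"
      for T' v' and B' :: "'a pair_pre_digraph"
    proof (rule antisym)
      have "pair_graph T'" using T' by (simp add: trees_def is_tree_def)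
      then show "eig 2 T' \<le> lam"
        using path_with_tree_eig2_le[OF _ pt True _ du] assms(2) lam_eq k_def by simp
      show "lam \<le> eig 2 T'" using opt[OF T'] assms(6) by simp
    qed
    have dk: "(d + 1) div 2 = k" using True k_def by auto
    have rv: "v (d div 2) = v k" by (simp only: k_def)
    show ?thesis
    proof (intro exI[of _ v] exI[of _ S.B] conjI impI 1 2 lam2)
      show "eig 1 (remove_vert S.B (v (d div 2))) \<le> lam" unfolding rv by (rule 3)
      show "lam \<le> eig 1 (path_graph ((d + 1) div 2))" unfolding dk lam_eq by (rule order_refl)
      show "lam = eig 1 (path_graph (d div 2))" unfolding lam_eq k_def by (rule refl)
      show "disjoint_union_of (\<lambda>C. smith_graph C \<and> eig 1 C \<le> lam) (remove_vert S.B (v (d div 2)))"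
        unfolding rv by (rule 4)
      show "\<forall>T' \<in> trees n d. \<forall>v' (B' :: 'a pair_pre_digraph). path_with_tree T' d v' B' \<and>
          disjoint_union_of (\<lambda>C. smith_graph C \<and> eig 1 C \<le> lam) (remove_vert B' (v' (d div 2)))
          \<longrightarrow> eig 2 T' = lam"
        using 5 by blast
    qed (use True in simp_all)
  next
    case False
    \<comment> \<open>Root, parent function and numbering are left general, so that the same
      conclusion serves the given path and its reversal.\<close>
    have main: ?thesis
      if O: "odd_optimal (pverts T) r p h v d k" and TG: "T = parent_graph (pverts T) r p"
        and one: "rooted_tree.ch (pverts T) r p (v (Suc k)) = {v (Suc (Suc k))}" for r p h v
    proof -
      interpret S: odd_optimal "pverts T" r p h v d k by (rule O)
      have TG: "S.G = T" by (rule TG[symmetric])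
      have lam_eq: "lam = eig 2 S.G" using TG assms(6) by simp
      have off: S.off_path by (rule S.one_sided_off_path[OF one])
      have "(d - 1) div 2 = d div 2" "(d + 1) div 2 = Suc k"
        using False unfolding k_def by presburger+
      moreover have "r = v (d div 2)"
        using S.rv by (simp only: k_def)
      ultimately have rk: "r = v (d div 2)" "(d - 1) div 2 = d div 2" "(d + 1) div 2 = Suc k"
        by blast+
      have 2: "\<forall>i\<le>d. i \<noteq> d div 2 \<longrightarrow> out_degree (with_proj T) (v i) \<le> 2"
      proof (intro allI impI)
        fix i assume i: "i \<le> d" "i \<noteq> d div 2"
        have "v i \<noteq> r" using S.vr[OF i(1)] i(2) k_def by simp
        then have "out_degree (with_proj S.G) (v i) \<le> 2"
          using S.degree_le_2[OF S.vV[OF i(1)]] S.off_path_children[OF off i(1)] i(2) k_def by simp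
        then show "out_degree (with_proj T) (v i) \<le> 2" unfolding TG .
      qed
      have 3: "eig 1 (remove_vert S.B r) \<le> lam"
        unfolding lam_eq by (rule S.off_path_eig1_le[OF off card]) (rule S.branch_le)
      have 1: "path_with_tree T d v S.B" using S.off_path_decomposition[OF off] unfolding TG .
      have 4: "star_subdivision T r" "star_subdivision S.B r"
        using S.one_sided_star[OF one] unfolding TG by blast+
      have 5: "eig 1 (path_graph k) < lam" "lam < eig 1 (path_graph (Suc k))"
        unfolding lam_eq by (rule S.path_less S.\<mu>_less)+
      have rv: "v (d div 2) = r" using rk(1) by simp
      show ?thesis
        unfolding rk(2,3)
      proof (intro exI[of _ v] exI[of _ S.B] conjI impI 1 2)
        show "eig 1 (remove_vert S.B (v (d div 2))) \<le> lam" unfolding rv by (rule 3)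
        show "lam \<le> eig 1 (path_graph (Suc k))" "lam < eig 1 (path_graph (Suc k))" using 5(2) by simp_all
        show "eig 1 (path_graph (d div 2)) < lam" using 5(1) unfolding k_def .
        show "star_subdivision T (v (d div 2))" "star_subdivision S.B (v (d div 2))" unfolding rv by (rule 4)+
      qed (use False in simp_all)
    qed
    interpret S: spined_tree "pverts T" "v k" p h v d k by (rule ph(1))
    have TG: "S.G = T" by (rule ph(2)[symmetric])
    have O: "odd_optimal (pverts T) (v k) p h v d k"
    proof unfold_locales
      show "odd d" by (rule False)
      show "eig 2 S.G \<le> eig 2 T'" if "T' \<in> trees (card (pverts T)) d" for T' :: "'a pair_pre_digraph"
        unfolding TG using opt that T(2) by simp
    qed
    interpret S: odd_optimal "pverts T" "v k" p h v d k by (rule O)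
    from S.one_sided show ?thesis
    proof
      assume "S.ch (v (Suc k)) = {v (Suc (Suc k))}"
      then show ?thesis by (rule main[OF O TG[symmetric]])
    next
      assume one: "S.ch (v k) = {v (Suc k), v (k - 1)}"
      obtain p2 h2 where R: "odd_optimal (pverts T) (v (d - k)) p2 h2 (\<lambda>i. v (d - i)) d k"
        "S.G = parent_graph (pverts T) (v (d - k)) p2"
        "rooted_tree.ch (pverts T) (v (d - k)) p2 (v (d - Suc k)) = {v (d - Suc (Suc k))}"
        by (rule S.reverse_path[OF one])
      show ?thesis
        by (rule main[OF R(1) _ R(3)]) (rule trans[OF TG[symmetric] R(2)])
    qed
  qed
qed

end
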